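(* Let $d\geq 2$. Let $(X_n)_{n\geq 0}$ be independent and identically distributed real random variables, not almost surely constant, such that $\mathbb{E}[X_1]=0$ and $\mathbb{E}[|X_1|^k]<+\infty$ for all $k\geq 1$. Let $(c_n)_{n\geq 0}$ be a sequence of scalars such that $u_{rad}:=\sum_{n\geq 0}c_n\psi_n$ belongs to $\bigcap_{\varepsilon>0}\mathcal{H}^{-\varepsilon}(\mathbb{R}^d)$, and set $$\alpha_\star(c):=\inf\Big\{\alpha>0:\ \sum_{n=0}^N n^{\frac d2-1}|c_n|^2=\mathcal{O}(N^\alpha)\Big\}.$$ Then the random series $$u_{rad}^\omega(x)=\sum_{n=0}^{+\infty}X_n(\omega)c_n\psi_n(x)$$ converges almost surely in $L^p(\mathbb{R}^d)$ for any $p\in\,\big]2,\frac{d}{\alpha_\star(c)}\big[$, and diverges almost surely in $L^p(\mathbb{R}^d)$ for any real $p>\frac{d}{\alpha_\star(c)}$.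
   Context: $H=-\Delta+|x|^2$ is the harmonic oscillator on $L^2(\mathbb{R}^d)$, and $(\psi_n)_{n\geq 0}$ is the orthonormal basis of the subspace $L^2_{rad}(\mathbb{R}^d)$ of radial ($SO(d)$-invariant) functions consisting of eigenfunctions of $H$, with $H\psi_n=(4n+d)\psi_n$ (each radial eigenspace has dimension 1). For $s\in\mathbb{R}$, $\sum_n c_n\psi_n\in\mathcal{H}^s(\mathbb{R}^d)$ means $\sum_n(4n+d)^s|c_n|^2<+\infty$. By convention $\frac{d}{\alpha_\star(c)}=+\infty$ if $\alpha_\star(c)=0$. *)

theory Defs
  imports "HOL-Probability.Probability" "HOL-Library.Landau_Symbols"
begin

section \<open>Lebesgue spaces on Euclidean space\<close>

text \<open>Elements of \<open>L\<^sup>p\<close> are represented by Borel functions; every class modulo null sets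
  has such a representative.\<close>

definition in_Lp :: "real \<Rightarrow> ('a::euclidean_space \<Rightarrow> complex) \<Rightarrow> bool" where
  "in_Lp p f \<longleftrightarrow> f \<in> borel_measurable lborel \<and> integrable lborel (\<lambda>x. norm (f x) powr p)"

definition Lp_norm :: "real \<Rightarrow> ('a::euclidean_space \<Rightarrow> complex) \<Rightarrow> real" where
  "Lp_norm p f = (\<integral>x. norm (f x) powr p \<partial>lborel) powr (1 / p)"

definition L2_inner :: "('a::euclidean_space \<Rightarrow> complex) \<Rightarrow> ('a \<Rightarrow> complex) \<Rightarrow> complex" where
  "L2_inner f g = (\<integral>x. f x * cnj (g x) \<partial>lborel)"

definition Lp_tendsto ::
  "real \<Rightarrow> (nat \<Rightarrow> 'a::euclidean_space \<Rightarrow> complex) \<Rightarrow> ('a \<Rightarrow> complex) \<Rightarrow> bool" where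
  "Lp_tendsto p u f \<longleftrightarrow> (\<forall>N. in_Lp p (u N)) \<and> in_Lp p f \<and>
     (\<lambda>N. Lp_norm p (\<lambda>x. u N x - f x)) \<longlonglongrightarrow> 0"

definition series_converges_Lp ::
  "real \<Rightarrow> (nat \<Rightarrow> 'a::euclidean_space \<Rightarrow> complex) \<Rightarrow> bool" where
  "series_converges_Lp p v \<longleftrightarrow> (\<exists>f. Lp_tendsto p (\<lambda>N x. \<Sum>n\<le>N. v n x) f)"


section \<open>Radial functions and the harmonic oscillator\<close>

definition L2_rad :: "(real^'d \<Rightarrow> complex) \<Rightarrow> bool" where
  "L2_rad f \<longleftrightarrow> in_Lp 2 f \<and>
     (\<forall>A. rotation_matrix A \<longrightarrow> (AE x in lborel. f (A *v x) = f x))"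

definition partial :: "'d \<Rightarrow> (real^'d \<Rightarrow> complex) \<Rightarrow> real^'d \<Rightarrow> complex" where
  "partial i f x = frechet_derivative f (at x) (axis i 1)"

definition C2 :: "(real^'d \<Rightarrow> complex) \<Rightarrow> bool" where
  "C2 f \<longleftrightarrow> f differentiable_on UNIV \<and>
     (\<forall>i. partial i f differentiable_on UNIV \<and>
          (\<forall>j. continuous_on UNIV (partial j (partial i f))))"

definition laplacian :: "(real^'d \<Rightarrow> complex) \<Rightarrow> real^'d \<Rightarrow> complex" where
  "laplacian f x = (\<Sum>i\<in>UNIV. partial i (partial i f) x)"

definition harmonic_oscillator :: "(real^'d \<Rightarrow> complex) \<Rightarrow> real^'d \<Rightarrow> complex" where
  "harmonic_oscillator f x = - laplacian f x + of_real ((norm x)\<^sup>2) * f x"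

text \<open>The eigenfunctions of \<open>H\<close> are smooth, so they are taken in their \<open>C\<^sup>2\<close> representative and
  the eigenvalue equation is pointwise. The system is determined up to unimodular constants
  because the radial eigenspaces are one-dimensional.\<close>

definition radial_eigenbasis :: "(nat \<Rightarrow> real^'d \<Rightarrow> complex) \<Rightarrow> bool" where
  "radial_eigenbasis \<psi> \<longleftrightarrow>
     (\<forall>n. L2_rad (\<psi> n)) \<and>
     (\<forall>m n. L2_inner (\<psi> m) (\<psi> n) = (if m = n then 1 else 0)) \<and>
     (\<forall>f. L2_rad f \<longrightarrow> Lp_tendsto 2 (\<lambda>N x. \<Sum>n\<le>N. L2_inner f (\<psi> n) * \<psi> n x) f) \<and>
     (\<forall>n. C2 (\<psi> n) \<and>
          (\<forall>x. harmonic_oscillator (\<psi> n) x = of_nat (4 * n + CARD('d)) * \<psi> n x))"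

text \<open>Membership of the formal series with coefficients \<open>c\<close> along the radial eigenbasis in
  \<open>\<H>\<^sup>s(\<real>\<^sup>d)\<close>.\<close>

definition in_Hs_rad :: "nat \<Rightarrow> real \<Rightarrow> (nat \<Rightarrow> complex) \<Rightarrow> bool" where
  "in_Hs_rad d s c \<longleftrightarrow> summable (\<lambda>n. real (4 * n + d) powr s * (norm (c n))\<^sup>2)"


section \<open>The critical exponent\<close>

text \<open>For \<open>d = 2\<close> the term at \<open>n = 0\<close> is \<open>0 powr 0 = 0\<close> rather than \<open>\<bar>c 0\<bar>\<^sup>2\<close>; a constant does not
  affect an \<open>O(N\<^sup>\<alpha>)\<close> bound with \<open>\<alpha> > 0\<close>. The set is nonempty (so \<open>Inf\<close> is the
  true infimum) as soon as \<open>c\<close> is in \<open>\<H>\<^sup>-\<^sup>\<epsilon>\<close> for some \<open>\<epsilon>\<close>.\<close>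

definition alpha_star :: "nat \<Rightarrow> (nat \<Rightarrow> complex) \<Rightarrow> real" where
  "alpha_star d c = Inf {\<alpha>. \<alpha> > 0 \<and>
     (\<lambda>N. \<Sum>n\<le>N. real n powr (real d / 2 - 1) * (norm (c n))\<^sup>2) \<in> O(\<lambda>N. real N powr \<alpha>)}"

definition critical_exponent :: "nat \<Rightarrow> (nat \<Rightarrow> complex) \<Rightarrow> ereal" where
  "critical_exponent d c =
     (if alpha_star d c = 0 then \<infinity> else ereal (real d / alpha_star d c))"

end

theory Submission
  imports Defs "HOL-Real_Asymp.Real_Asymp" "HOL-Complex_Analysis.Complex_Analysis"
begin

text \<open>Why the theorem holds. For fixed \<open>x\<close> the partial sums of \<open>\<Sum> X\<^sub>n c\<^sub>n \<psi>\<^sub>n(x)\<close> are sums of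
independent centred variables, so all their moments are governed by the square function
\<open>G(x) = \<Sum> |c\<^sub>n|^2 |\<psi>\<^sub>n(x)|^2\<close>: the moment of order \<open>2m\<close> is at most a constant times \<open>G(x)^m\<close>
(\<open>even_moment_bound\<close>), and the second moment is a constant times \<open>G(x)\<close>, even when it is
restricted to an event of probability close to one (\<open>second_moment_on_large_event\<close>).
Integrating in \<open>x\<close>, convergence in \<open>L\<^sup>p\<close> is decided by the size of \<open>\<integral> G^(p/2)\<close>.

The radial eigenfunctions concentrate at the origin. One has \<open>|\<psi>\<^sub>n(x)|^2 \<approx> n^(d/2-1)\<close> for
\<open>|x| \<le> 1 / (2 sqrt n)\<close>, the decay \<open>|\<psi>\<^sub>n(x)|^2 \<le> C n^(d/2-1) (|x| sqrt n)^(1-d)\<close> up to \<open>|x| = 1\<close>, and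
\<open>|\<psi>\<^sub>n(x)|^2 \<le> C n^(-1/3)\<close> for \<open>|x| \<ge> 1\<close>. Heuristically, near the origin \<open>G(x)\<close> is the sum of \<open>n^(d/2-1) |c\<^sub>n|^2\<close>
over \<open>n \<le> |x|^(-2)\<close>, that is \<open>|x|^(-2 \<alpha>)\<close> when these sums grow like \<open>N^\<alpha>\<close>, and \<open>|x|^(-\<alpha> p)\<close> is
integrable at the origin exactly when \<open>\<alpha> p < d\<close>. Away from the origin, \<open>p > 2\<close> and
\<open>c \<in> \<H>^(-\<epsilon>)\<close> for all \<open>\<epsilon> > 0\<close> already make \<open>\<integral> G^(p/2)\<close> finite. Hence the critical exponent.\<close>

text \<open>The estimates on \<open>\<psi>\<^sub>n\<close> come from its radial profile. The eigenvalue equation becomes a second-order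
equation in \<open>r = |x|\<close> which has only one solution that is regular at \<open>0\<close> up to a factor, so \<open>\<psi>\<^sub>n\<close> is
\<open>\<psi>\<^sub>n(0)\<close> times an explicit polynomial times a Gaussian (\<open>radial_eigenfunction_eq_profile\<close>). The
value \<open>|\<psi>\<^sub>n(0)|^2\<close> is read off from Parseval's identity for Gaussians, which compares two power series
(\<open>eigenfunction_value_at_0\<close>); the decay of the profile follows from monotone energies of the
radial equation (locale \<open>oscillation\<close>), without asymptotic expansions.

For convergence, the strict inequality \<open>p < d / \<alpha>\<^sub>\<star>\<close> leaves a factor \<open>2^(-\<eta> j)\<close> in the integral of
\<open>G^(p/2)\<close> over the block of indices \<open>2^j < n \<le> 2^(j+1)\<close>. The maximum of the partial sums inside a
block costs at most the number of terms to the power \<open>p / (2m)\<close>, and as all moments of \<open>X\<^sub>n\<close> are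
finite, \<open>m\<close> can be taken so large that this cost is negligible (\<open>almost_sure_convergence\<close>).

For divergence, boundedness of the partial sums in \<open>L\<^sup>p\<close> is a tail event. If it had probability one,
the partial sums would be uniformly bounded on an event of probability close to one, where the
second moments still see \<open>G\<close>. Integrating over the ball of radius \<open>1 / (2 sqrt N)\<close> would give
\<open>\<Sum>\<^sub>n\<^sub>\<le>\<^sub>N n^(d/2-1) |c\<^sub>n|^2 = O(N^(d/p))\<close>, that is \<open>\<alpha>\<^sub>\<star> \<le> d / p\<close> (\<open>almost_sure_divergence\<close>).\<close>


section \<open>Radial profiles\<close>

text \<open>The confluent hypergeometric polynomial \<open>1F1(-n; a; y)\<close>, a multiple of the Laguerre polynomial
\<open>L\<^sub>n\<close> with parameter \<open>a - 1\<close>. Dividing by its value at \<open>0\<close> makes Gaussian integrals collapse to the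
binomial theorem. The application takes \<open>a = d / 2\<close>.\<close>

definition kummer :: "real \<Rightarrow> nat \<Rightarrow> real poly" where
  "kummer a n = (\<Sum>k\<le>n. monom ((-1) ^ k * real (n choose k) / pochhammer a k) k)"

definition profile :: "real \<Rightarrow> nat \<Rightarrow> real \<Rightarrow> real" where
  "profile a n r = poly (kummer a n) (r\<^sup>2) * exp (- r\<^sup>2 / 2)"

definition profile' :: "real \<Rightarrow> nat \<Rightarrow> real \<Rightarrow> real" where
  "profile' a n r = (2 * r * poly (pderiv (kummer a n)) (r\<^sup>2) - r * poly (kummer a n) (r\<^sup>2)) * exp (- r\<^sup>2 / 2)"

lemma coeff_kummer: "coeff (kummer a n) k = (-1) ^ k * real (n choose k) / pochhammer a k"
  by (simp add: kummer_def coeff_sum binomial_eq_0)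

lemma kummer_recurrence:
  assumes "a > 0"
  shows "real (k + 1) * (a + real k) * coeff (kummer a n) (k + 1)
       = (real k - real n) * coeff (kummer a n) k"
proof -
  have p: "pochhammer a k > 0" using assms by (rule pochhammer_pos)
  have b: "real (k + 1) * real (n choose (k + 1)) = (real n - real k) * real (n choose k)"
  proof (cases "k \<le> n")
    case True
    have "Suc k * (n choose Suc k) = (n - k) * (n choose k)"
      by (metis binomial_absorption binomial_absorb_comp)
    hence "real (Suc k * (n choose Suc k)) = real ((n - k) * (n choose k))" by (simp only:)
    thus ?thesis using True by (simp add: of_nat_diff algebra_simps)
  qed (simp add: binomial_eq_0)
  have ak: "a + real k \<noteq> 0" using assms by simp
  have "real (k + 1) * (a + real k) * coeff (kummer a n) (k + 1)
      = - ((-1) ^ k) * (real (k + 1) * real (n choose (k + 1))) / pochhammer a k * ((a + real k) / (a + real k))"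
    by (simp add: coeff_kummer pochhammer_Suc mult_ac)
  also have "\<dots> = - ((-1) ^ k) * (real (k + 1) * real (n choose (k + 1))) / pochhammer a k"
    using ak by simp
  also have "\<dots> = (real k - real n) * coeff (kummer a n) k"
    unfolding b using p by (simp add: coeff_kummer field_simps)
  finally show ?thesis .
qed

text \<open>Comparing coefficients, Kummer's equation is the two-term recurrence.\<close>

lemma kummer_ode:
  assumes "a > 0"
  shows "y * poly (pderiv (pderiv (kummer a n))) y + (a - y) * poly (pderiv (kummer a n)) y
       + real n * poly (kummer a n) y = 0"
proof -
  let ?P = "kummer a n"
  have "pCons 0 (pderiv (pderiv ?P)) + smult a (pderiv ?P) - pCons 0 (pderiv ?P) + smult (real n) ?P = 0"
  proof (rule poly_eqI)
    fix k
    show "coeff (pCons 0 (pderiv (pderiv ?P)) + smult a (pderiv ?P) - pCons 0 (pderiv ?P) + smult (real n) ?P) k = coeff 0 k"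
    proof (cases k)
      case 0
      then show ?thesis using kummer_recurrence[OF assms, of 0 n] by (simp add: coeff_pderiv)
    next
      case (Suc m)
      then show ?thesis using kummer_recurrence[OF assms, of k n]
        by (simp add: coeff_pderiv algebra_simps)
    qed
  qed
  hence "poly (pCons 0 (pderiv (pderiv ?P)) + smult a (pderiv ?P) - pCons 0 (pderiv ?P) + smult (real n) ?P) y = 0"
    by simp
  thus ?thesis by (simp add: algebra_simps)
qed

lemma profile_deriv: "(profile a n has_real_derivative profile' a n r) (at r)"
  unfolding profile_def[abs_def] profile'_def
  by (rule derivative_eq_intros refl | simp)+ (simp add: algebra_simps)

text \<open>With \<open>a = d / 2\<close> this is the radial form of the eigenvalue equation of \<open>-\<Delta> + |x|^2\<close> with eigenvalue
\<open>4 n + d\<close>; the factor \<open>(2 a - 1) / r\<close> is the \<open>(d - 1) / r\<close> of the radial Laplacian.\<close>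

lemma profile'_deriv:
  assumes "a > 0" "r \<noteq> 0"
  shows "(profile' a n has_real_derivative
     - ((2 * a - 1) / r) * profile' a n r - (4 * real n + 2 * a - r\<^sup>2) * profile a n r) (at r)"
proof -
  let ?P = "poly (kummer a n) (r\<^sup>2)" and ?P' = "poly (pderiv (kummer a n)) (r\<^sup>2)"
    and ?P'' = "poly (pderiv (pderiv (kummer a n))) (r\<^sup>2)" and ?e = "exp (- r\<^sup>2 / 2)"
  have ode: "r\<^sup>2 * ?P'' = - (a - r\<^sup>2) * ?P' - real n * ?P"
    using kummer_ode[OF assms(1), of "r\<^sup>2" n] by (simp add: algebra_simps)
  have "(profile' a n has_real_derivative (2 * ?P' + 4 * (r\<^sup>2 * ?P'') - ?P - 4 * r\<^sup>2 * ?P' + r\<^sup>2 * ?P) * ?e) (at r)"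
    unfolding profile'_def[abs_def]
    by (rule derivative_eq_intros refl | simp)+ (simp add: algebra_simps power2_eq_square)
  moreover have "(2 * ?P' + 4 * (r\<^sup>2 * ?P'') - ?P - 4 * r\<^sup>2 * ?P' + r\<^sup>2 * ?P) * ?e
     = - ((2 * a - 1) / r) * profile' a n r - (4 * real n + 2 * a - r\<^sup>2) * profile a n r"
    unfolding ode profile'_def profile_def using assms(2) by (simp add: field_simps)
  ultimately show ?thesis by simp
qed

lemma profile_0 [simp]: "profile a n 0 = 1"
  by (simp add: profile_def poly_0_coeff_0 coeff_kummer)

lemma profile'_0 [simp]: "profile' a n 0 = 0"
  by (simp add: profile'_def)

text \<open>For \<open>a \<ge> 1\<close> the coefficient of \<open>y^k\<close> is at most \<open>n^k\<close> in modulus, so a geometric series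
controls its deviation from \<open>1\<close> while \<open>n r^2 \<le> 1 / 4\<close>: the profile has no zero closer to the origin
than a distance of order \<open>n^(-1/2)\<close>.\<close>

lemma profile_lower:
  assumes "a \<ge> 1" "real n * r\<^sup>2 \<le> 1 / 4" "r\<^sup>2 \<le> 1/4"
  shows "profile a n r \<ge> 1 / 2"
proof -
  define y where "y = r\<^sup>2"
  have y0: "y \<ge> 0" by (simp add: y_def)
  have poch1: "pochhammer a k \<ge> 1" for k
  proof (induction k)
    case (Suc k)
    have "1 * 1 \<le> pochhammer a k * (a + real k)" by (intro mult_mono Suc) (use assms Suc in auto)
    then show ?case by (simp add: pochhammer_Suc)
  qed simp
  have "poly (kummer a n) y = (\<Sum>k\<le>n. (-1) ^ k * real (n choose k) / pochhammer a k * y ^ k)"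
    by (simp add: kummer_def poly_sum poly_monom)
  also have "\<dots> = 1 + (\<Sum>k\<in>{1..n}. (-1) ^ k * real (n choose k) / pochhammer a k * y ^ k)"
    by (subst sum.atMost_shift) (simp add: sum.atLeast1_atMost_eq[symmetric] sum.atLeast1_atMost_eq)
  finally have e: "poly (kummer a n) y - 1 = (\<Sum>k\<in>{1..n}. (-1) ^ k * real (n choose k) / pochhammer a k * y ^ k)"
    by simp
  have "\<bar>poly (kummer a n) y - 1\<bar> \<le> (\<Sum>k\<in>{1..n}. (1/4) ^ k)"
    unfolding e
  proof (rule order_trans[OF sum_abs], rule sum_mono)
    fix k assume "k \<in> {1..n}"
    have "\<bar>(-1) ^ k * real (n choose k) / pochhammer a k * y ^ k\<bar> = real (n choose k) * y ^ k / pochhammer a k"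
      using y0 poch1[of k] by (simp add: abs_mult power_abs)
    also have "\<dots> \<le> real (n choose k) * y ^ k / 1"
      by (rule divide_left_mono) (use y0 poch1[of k] in auto)
    also have "\<dots> \<le> real n ^ k * y ^ k"
      using y0 binomial_le_pow2 binomial_le_pow[of k n] \<open>k \<in> {1..n}\<close>
      by (simp add: mult_right_mono flip: of_nat_power)
    also have "\<dots> = (real n * y) ^ k" by (simp add: power_mult_distrib)
    also have "\<dots> \<le> (1/4) ^ k" by (rule power_mono) (use assms y0 in \<open>auto simp: y_def\<close>)
    finally show "\<bar>(-1) ^ k * real (n choose k) / pochhammer a k * y ^ k\<bar> \<le> (1/4) ^ k" .
  qed
  also have "\<dots> = (\<Sum>k<n. (1/4) ^ Suc k)"
    by (simp add: sum.atLeast1_atMost_eq)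
  also have "\<dots> = 1/4 * (\<Sum>k<n. (1/4) ^ k)" by (simp add: sum_distrib_left sum_divide_distrib)
  also have "\<dots> \<le> 1/3"
    unfolding sum_gp_strict using zero_le_power[of "1/4::real" n] by (simp add: field_simps)
  finally have 1: "poly (kummer a n) y \<ge> 2/3" by linarith
  have "exp (- y / 2) \<ge> 1 + (- y / 2)" by (rule exp_ge_add_one_self)
  hence 2: "exp (- y / 2) \<ge> 7/8" using assms(3) by (simp add: y_def)
  have "(2/3) * (7/8) \<le> poly (kummer a n) y * exp (- y / 2)"
    by (intro mult_mono 1 2) (use 1 in auto)
  thus ?thesis by (simp add: profile_def y_def)
qed


section \<open>Monotone energies of the radial equation\<close>

text \<open>The damping term \<open>\<mu> / r\<close> and the growth of \<open>r^2\<close> make this energy decrease from its value \<open>\<Lambda>\<close> at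
the origin.\<close>

lemma radial_energy_le:
  fixes f g :: "real \<Rightarrow> real" and \<mu> \<Lambda> r :: real
  assumes df: "\<And>r. (f has_real_derivative g r) (at r)"
    and dg: "\<And>r. r > 0 \<Longrightarrow> (g has_real_derivative - (\<mu> / r) * g r - (\<Lambda> - r\<^sup>2) * f r) (at r)"
    and cg: "continuous_on {0..} g"
    and "f 0 = 1" "g 0 = 0" "\<mu> \<ge> 0" "r \<ge> 0"
  shows "(g r)\<^sup>2 + (\<Lambda> - r\<^sup>2) * (f r)\<^sup>2 \<le> \<Lambda>"
proof -
  let ?e = "\<lambda>r. (g r)\<^sup>2 + (\<Lambda> - r\<^sup>2) * (f r)\<^sup>2"
  have "?e 0 \<ge> ?e r"
  proof (rule DERIV_nonpos_imp_decreasing_open[where f = ?e])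
    fix x assume "0 < x" "x < r"
    have "(?e has_real_derivative - 2 * (\<mu> / x) * (g x)\<^sup>2 - 2 * x * (f x)\<^sup>2) (at x)"
      by (rule derivative_eq_intros df dg \<open>0 < x\<close> refl | simp)+ 
         (simp add: algebra_simps power2_eq_square)
    moreover have "- 2 * (\<mu> / x) * (g x)\<^sup>2 - 2 * x * (f x)\<^sup>2 \<le> 0"
    proof -
      have "0 \<le> (\<mu> / x) * (g x)\<^sup>2" "0 \<le> x * (f x)\<^sup>2" using \<open>0 < x\<close> assms(6) by auto
      thus ?thesis by (simp add: mult.assoc)
    qed
    ultimately show "\<exists>y. (?e has_real_derivative y) (at x) \<and> y \<le> 0" by blast
  next
    have "continuous_on {0..r} f"
      by (intro continuous_at_imp_continuous_on ballI DERIV_isCont[OF df])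
    moreover have "continuous_on {0..r} g" by (rule continuous_on_subset[OF cg]) auto
    ultimately show "continuous_on {0..r} ?e" by (intro continuous_intros)
  qed (use assms in auto)
  thus ?thesis using assms by simp
qed

text \<open>The Liouville substitution \<open>w = r^(\<mu>/2) f\<close> removes the damping: \<open>w\<close> solves \<open>w'' + Q w = 0\<close> with
\<open>Q(r) = \<Lambda> - r^2 - \<nu> / r^2\<close> and \<open>\<nu> = \<mu> (\<mu> - 2) / 4\<close>.\<close>

lemma liouville_derivs:
  fixes f g :: "real \<Rightarrow> real" and \<mu> \<Lambda> r :: real
  assumes df: "(f has_real_derivative g r) (at r)"
    and dg: "(g has_real_derivative - (\<mu> / r) * g r - (\<Lambda> - r\<^sup>2) * f r) (at r)"
    and r: "r > 0"
  shows "((\<lambda>r. r powr (\<mu>/2) * f r) has_real_derivative r powr (\<mu>/2) * (g r + \<mu> / (2 * r) * f r)) (at r)"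
    and "((\<lambda>r. r powr (\<mu>/2) * (g r + \<mu> / (2 * r) * f r)) has_real_derivative
           - (\<Lambda> - r\<^sup>2 - \<mu> * (\<mu> - 2) / 4 / r\<^sup>2) * (r powr (\<mu>/2) * f r)) (at r)"
proof -
  have p: "r powr (\<mu>/2 - 1) = r powr (\<mu>/2) / r" using r by (simp add: powr_diff)
  show "((\<lambda>r. r powr (\<mu>/2) * f r) has_real_derivative r powr (\<mu>/2) * (g r + \<mu> / (2 * r) * f r)) (at r)"
    by (rule DERIV_cong, rule DERIV_mult[OF has_real_derivative_powr[OF r] df])
       (use r in \<open>simp add: p algebra_simps diff_divide_distrib\<close>)
  have e1: "((\<lambda>r. \<mu> / (2 * r)) has_real_derivative - \<mu> / (2 * r\<^sup>2)) (at r)"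
  proof -
    have "((\<lambda>r. \<mu> / 2 * inverse r) has_real_derivative \<mu> / 2 * (- (inverse r ^ Suc (Suc 0)))) (at r)"
      using r by (intro DERIV_cmult DERIV_inverse) auto
    moreover have "(\<lambda>r. \<mu> / (2 * r)) = (\<lambda>r. \<mu> / 2 * inverse r)"
      by (simp add: fun_eq_iff inverse_eq_divide)
    moreover have "\<mu> / 2 * (- (inverse r ^ Suc (Suc 0))) = - \<mu> / (2 * r\<^sup>2)"
      by (simp add: power2_eq_square inverse_eq_divide)
    ultimately show ?thesis by (simp only:)
  qed
  show "((\<lambda>r. r powr (\<mu>/2) * (g r + \<mu> / (2 * r) * f r)) has_real_derivative
           - (\<Lambda> - r\<^sup>2 - \<mu> * (\<mu> - 2) / 4 / r\<^sup>2) * (r powr (\<mu>/2) * f r)) (at r)"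
  proof -
    let ?D = "\<mu> / 2 * r powr (\<mu> / 2 - 1) * (g r + \<mu> / (2 * r) * f r) +
       (- (\<mu> / r) * g r - (\<Lambda> - r\<^sup>2) * f r + (- \<mu> / (2 * r\<^sup>2) * f r + g r * (\<mu> / (2 * r)))) * r powr (\<mu> / 2)"
    have D: "((\<lambda>r. r powr (\<mu>/2) * (g r + \<mu> / (2 * r) * f r)) has_real_derivative ?D) (at r)"
      by (rule DERIV_mult[OF has_real_derivative_powr[OF r] DERIV_add[OF dg DERIV_mult[OF e1 df]]])
    \<comment> \<open>The identity is polynomial in \<open>t = 1 / r\<close> and \<open>m = \<mu> / 2\<close>.\<close>
    have ring: "m * (R * t) * (G + m * t * y) + (- (2 * m * t) * G - x * y + (- (m * t * t) * y + G * (m * t))) * R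
        = - (x - m * (m - 1) * (t * t)) * (R * y)" for m t G x y R :: real
      by (simp add: algebra_simps)
    have h1: "\<mu> / (2 * r) = \<mu> / 2 * (1 / r)"
      and h2: "- \<mu> / (2 * r\<^sup>2) = - (\<mu> / 2 * (1 / r) * (1 / r))"
      and h3: "\<mu> / r = 2 * (\<mu> / 2) * (1 / r)" 
      and h4: "r powr (\<mu> / 2 - 1) = r powr (\<mu> / 2) * (1 / r)"
      by (simp_all add: power2_eq_square p)
    have h5: "\<mu> * (\<mu> - 2) / 4 / r\<^sup>2 = \<mu> / 2 * (\<mu> / 2 - 1) * (1 / r * (1 / r))"
      by (simp add: power2_eq_square field_simps)
    have "?D = - (\<Lambda> - r\<^sup>2 - \<mu> * (\<mu> - 2) / 4 / r\<^sup>2) * (r powr (\<mu>/2) * f r)"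
      unfolding h1 h2 h4 h5 h3 by (rule ring)
    thus ?thesis using D by simp
  qed
qed

text \<open>A decaying solution of \<open>w'' + Q w = 0\<close>, with derivative \<open>v\<close>, whose energy \<open>v^2 + Q w^2\<close> is known at
the point \<open>K / sqrt \<Lambda>\<close>. From there on \<open>\<nu> / r^2 \<le> \<Lambda> / 4\<close>, so \<open>Q\<close> is comparable to \<open>\<Lambda>\<close> up to
\<open>sqrt \<Lambda> / 2\<close>; the turning point, where \<open>Q\<close> vanishes, lies near \<open>sqrt \<Lambda>\<close>.\<close>

locale oscillation =
  fixes w v :: "real \<Rightarrow> real" and \<nu> \<Lambda> K \<Phi>0 :: real
  assumes dw: "\<And>r. r > 0 \<Longrightarrow> (w has_real_derivative v r) (at r)"
    and dv: "\<And>r. r > 0 \<Longrightarrow> (v has_real_derivative - (\<Lambda> - r\<^sup>2 - \<nu> / r\<^sup>2) * w r) (at r)"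
    and nu_low: "- 1 / 4 \<le> \<nu>" and nu_up: "4 * \<nu> \<le> K\<^sup>2"
    and K: "K \<ge> 2" and Lam: "\<Lambda> \<ge> 4 * K"
    and init: "(v (K / sqrt \<Lambda>))\<^sup>2 + (\<Lambda> - (K / sqrt \<Lambda>)\<^sup>2 - \<nu> / (K / sqrt \<Lambda>)\<^sup>2) * (w (K / sqrt \<Lambda>))\<^sup>2 \<le> \<Phi>0"
    and lim: "(w \<longlongrightarrow> 0) at_top"
begin

definition Q where "Q r = \<Lambda> - r\<^sup>2 - \<nu> / r\<^sup>2"
definition F where "F r = (v r)\<^sup>2 + Q r * (w r)\<^sup>2"
definition r0 where "r0 = K / sqrt \<Lambda>"

lemma Lam_pos: "\<Lambda> > 0" and Lam_ge8: "\<Lambda> \<ge> 8" using K Lam by linarith+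

lemma r0_pos: "r0 > 0" using K Lam_pos by (simp add: r0_def)

lemma r0_sq: "r0\<^sup>2 = K\<^sup>2 / \<Lambda>" using Lam_pos by (simp add: r0_def power_divide)

lemma r0_le: "r0 \<le> sqrt \<Lambda> / 2"
proof -
  have "2 * K \<le> \<Lambda>" using K Lam by linarith
  thus ?thesis using Lam_pos by (simp add: r0_def field_simps)
qed

lemma Q_deriv: "r > 0 \<Longrightarrow> (Q has_real_derivative - 2 * r + 2 * \<nu> / r ^ 3) (at r)"
  unfolding Q_def[abs_def]
  by (rule derivative_eq_intros refl | simp)+ (simp add: field_simps eval_nat_numeral)

lemma energy_deriv: "r > 0 \<Longrightarrow> (F has_real_derivative (- 2 * r + 2 * \<nu> / r ^ 3) * (w r)\<^sup>2) (at r)"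
  unfolding F_def[abs_def]
  by (rule derivative_eq_intros refl dw dv Q_deriv | assumption | simp)+
     (simp add: Q_def algebra_simps power2_eq_square)

lemma nu_over: "r \<ge> r0 \<Longrightarrow> \<nu> / r\<^sup>2 \<le> \<Lambda> / 4"
proof -
  assume r: "r \<ge> r0"
  have "r\<^sup>2 \<ge> r0\<^sup>2" using r r0_pos by (intro power_mono) auto
  hence "r\<^sup>2 * \<Lambda> \<ge> K\<^sup>2" using Lam_pos by (simp add: r0_sq field_simps)
  hence "4 * \<nu> \<le> \<Lambda> * r\<^sup>2" using nu_up by (simp add: mult.commute)
  thus ?thesis using r r0_pos by (simp add: field_simps)
qed

lemma Q_ge: "r0 \<le> r \<Longrightarrow> r \<le> sqrt \<Lambda> / 2 \<Longrightarrow> Q r \<ge> \<Lambda> / 2"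
proof -
  assume r: "r0 \<le> r" "r \<le> sqrt \<Lambda> / 2"
  have "r\<^sup>2 \<le> (sqrt \<Lambda> / 2)\<^sup>2" using r r0_pos by (intro power_mono) auto
  hence "r\<^sup>2 \<le> \<Lambda> / 4" using Lam_pos by (simp add: power_divide)
  thus ?thesis using nu_over[OF r(1)] by (simp add: Q_def)
qed

lemma energy_r0_bounds: "0 \<le> F r0" "F r0 \<le> \<Phi>0"
  using Q_ge[OF order_refl r0_le] Lam_pos init by (auto simp: F_def Q_def r0_def)

text \<open>The derivative of the energy is \<open>Q' w^2\<close>, and \<open>Q' \<le> 0\<close> as soon as \<open>r^4 \<ge> \<nu>\<close>.\<close>

lemma energy_decreasing:
  assumes "0 < r" "r \<le> s" "\<nu> \<le> r ^ 4"
  shows "F s \<le> F r"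
proof (rule DERIV_nonpos_imp_nonincreasing[OF assms(2)])
  fix x assume x: "r \<le> x" "x \<le> s"
  have "x > 0" using x assms by linarith
  moreover have "\<nu> \<le> x ^ 4" using assms x power_mono[of r x 4] by linarith
  hence "- 2 * x + 2 * \<nu> / x ^ 3 \<le> 0" using \<open>x > 0\<close> by (simp add: field_simps eval_nat_numeral)
  ultimately show "\<exists>y. (F has_real_derivative y) (at x) \<and> y \<le> 0"
    using energy_deriv[of x] by (meson mult_nonpos_nonneg zero_le_power2)
qed

text \<open>For \<open>r \<le> \<nu>^(1/4)\<close> the potential \<open>Q\<close> increases, and there \<open>w^2 + v^2 / Q\<close> is the decreasing quantity.
Since \<open>\<Lambda> / 2 \<le> Q \<le> \<Lambda>\<close> on that interval, changing from one energy to the other costs a factor \<open>2\<close>.\<close>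

lemma energy_le: "r \<ge> r0 \<Longrightarrow> F r \<le> 2 * \<Phi>0"
proof (cases "\<nu> \<le> r0 ^ 4")
  case True
  assume "r \<ge> r0"
  hence "F r \<le> F r0" by (rule energy_decreasing[OF r0_pos _ True])
  thus ?thesis using energy_r0_bounds by linarith
next
  case False
  assume r: "r \<ge> r0"
  \<comment> \<open>The point where \<open>Q\<close> is maximal.\<close>
  define q where "q = root 4 \<nu>"
  have nu: "\<nu> > 0" using False zero_le_power[of r0 4] r0_pos by linarith
  have q4: "q ^ 4 = \<nu>" using nu by (simp add: q_def)
  have qp: "q > 0" using nu by (simp add: q_def)
  have qr: "r0 < q" using False q4 qp r0_pos by (metis not_le power_mono order_less_imp_le)
  have "(2 * q\<^sup>2)\<^sup>2 \<le> K\<^sup>2" using nu_up q4 by (simp add: power_mult_distrib flip: power_mult)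
  hence "2 * q\<^sup>2 \<le> K" by (rule power2_le_imp_le) (use K in auto)
  hence "4 * q\<^sup>2 \<le> \<Lambda>" using Lam K by linarith
  hence "(2 * q)\<^sup>2 \<le> \<Lambda>" by (simp add: power_mult_distrib)
  hence q2: "q \<le> sqrt \<Lambda> / 2" using real_le_rsqrt by fastforce
  have left: "F s \<le> 2 * \<Phi>0" if s: "r0 \<le> s" "s \<le> q" for s
  proof -
    let ?E = "\<lambda>r. (w r)\<^sup>2 + (v r)\<^sup>2 / Q r"
    have Qp: "Q x \<ge> \<Lambda> / 2" if "r0 \<le> x" "x \<le> s" for x using Q_ge[of x] that s q2 by linarith
    have "?E s \<le> ?E r0"
    proof (rule DERIV_nonpos_imp_nonincreasing[OF s(1), where f = ?E])
      fix x assume x: "r0 \<le> x" "x \<le> s"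
      have x0: "x > 0" using x r0_pos by linarith
      have Qx: "Q x > 0" using Qp[OF x] Lam_pos by linarith
      have "(?E has_real_derivative - ((- 2 * x + 2 * \<nu> / x ^ 3) * (v x)\<^sup>2 / (Q x)\<^sup>2)) (at x)"
      proof (rule DERIV_cong)
        have D1: "((\<lambda>r. (w r)\<^sup>2) has_real_derivative 2 * (w x * v x)) (at x)"
          by (rule derivative_eq_intros refl dw x0 | simp)+
        have D2: "((\<lambda>r. (v r)\<^sup>2) has_real_derivative 2 * (v x * (- Q x * w x))) (at x)"
          using dv[OF x0, folded Q_def] by (rule derivative_eq_intros refl | simp)+
        show "(?E has_real_derivative 2 * (w x * v x) + (2 * (v x * (- Q x * w x)) * Q x
            - (v x)\<^sup>2 * (- 2 * x + 2 * \<nu> / x ^ 3)) / (Q x * Q x)) (at x)"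
          by (intro DERIV_add D1 DERIV_divide D2 Q_deriv x0) (use Qx in auto)
        have "2 * (w x * v x) + (2 * (v x * (- q * w x)) * q - (v x)\<^sup>2 * t) / (q * q) = - (t * (v x)\<^sup>2 / q\<^sup>2)"
          if "q \<noteq> 0" for q t using that by (simp add: field_simps power2_eq_square)
        thus "2 * (w x * v x) + (2 * (v x * (- Q x * w x)) * Q x
            - (v x)\<^sup>2 * (- 2 * x + 2 * \<nu> / x ^ 3)) / (Q x * Q x)
            = - ((- 2 * x + 2 * \<nu> / x ^ 3) * (v x)\<^sup>2 / (Q x)\<^sup>2)" using Qx by simp
      qed
      moreover have "- 2 * x + 2 * \<nu> / x ^ 3 \<ge> 0"
      proof -
        have "x ^ 4 \<le> q ^ 4" using x s x0 by (intro power_mono) auto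
        thus ?thesis using x0 q4 by (simp add: field_simps eval_nat_numeral)
      qed
      hence "- ((- 2 * x + 2 * \<nu> / x ^ 3) * (v x)\<^sup>2 / (Q x)\<^sup>2) \<le> 0" by simp
      ultimately show "\<exists>y. (?E has_real_derivative y) (at x) \<and> y \<le> 0" by blast
    qed
    have Qs: "Q s > 0" using Qp[of s] s Lam_pos by linarith
    have "\<nu> / s\<^sup>2 \<ge> 0" "s\<^sup>2 \<ge> 0" using nu by auto
    hence Qs2: "Q s \<le> \<Lambda>" unfolding Q_def by linarith
    have Q0: "Q r0 \<ge> \<Lambda> / 2" using Qp s by simp
    have "F s = Q s * ?E s" using Qs by (simp add: F_def field_simps)
    also have "\<dots> \<le> Q s * ?E r0" using \<open>?E s \<le> ?E r0\<close> Qs by simp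
    also have "\<dots> = Q s * (F r0 / Q r0)" using Q0 Lam_pos by (simp add: F_def field_simps)
    also have "\<dots> \<le> \<Lambda> * (\<Phi>0 / (\<Lambda> / 2))"
      by (intro mult_mono frac_le) (use Qs Qs2 Q0 Lam_pos energy_r0_bounds in auto)
    finally show ?thesis using Lam_pos by simp
  qed
  show ?thesis
  proof (cases "r \<le> q")
    case False
    have "F r \<le> F q" by (rule energy_decreasing) (use qp False q4 in auto)
    thus ?thesis using left[of q] qr by simp
  qed (use left r in auto)
qed

lemma amplitude_before_turning_point: "r0 \<le> r \<Longrightarrow> r \<le> sqrt \<Lambda> / 2 \<Longrightarrow> (w r)\<^sup>2 \<le> 4 * \<Phi>0 / \<Lambda>"
proof -
  assume r: "r0 \<le> r" "r \<le> sqrt \<Lambda> / 2"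
  have "\<Lambda> / 2 * (w r)\<^sup>2 \<le> Q r * (w r)\<^sup>2" by (rule mult_right_mono[OF Q_ge[OF r]]) simp
  also have "\<dots> \<le> F r" by (simp add: F_def)
  also have "\<dots> \<le> 2 * \<Phi>0" by (rule energy_le[OF r(1)])
  finally show ?thesis using Lam_pos by (simp add: field_simps)
qed

text \<open>Between \<open>s\<close> and \<open>r\<close> the term \<open>\<nu> / r^2\<close> compensates at most half of the change of \<open>r^2\<close>.\<close>

lemma Q_gap:
  assumes "sqrt \<Lambda> / 2 \<le> s" "s \<le> r"
  shows "Q s - Q r \<ge> (r - s) * sqrt \<Lambda> / 2"
proof -
  have sp: "s > 0" "r > 0" using assms Lam_pos real_sqrt_gt_zero[OF Lam_pos] by linarith+
  have "(sqrt \<Lambda> / 2)\<^sup>2 \<le> s\<^sup>2" using assms Lam_pos by (intro power_mono) auto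
  hence s2: "\<Lambda> / 4 \<le> s\<^sup>2" using Lam_pos by (simp add: power_divide)
  have r2: "s\<^sup>2 \<le> r\<^sup>2" using assms sp by (intro power_mono) auto
  have "(\<Lambda>/4) * (\<Lambda>/4) \<le> s\<^sup>2 * r\<^sup>2" using s2 r2 Lam_pos by (intro mult_mono) auto
  moreover have "(4 * K) * (4 * K) \<le> \<Lambda> * \<Lambda>" using Lam K by (intro mult_mono) auto
  ultimately have "K\<^sup>2 \<le> s\<^sup>2 * r\<^sup>2" by (simp add: power2_eq_square)
  hence "2 * \<nu> \<le> s\<^sup>2 * r\<^sup>2" using nu_up zero_le_power2[of K] by linarith
  hence frac: "\<nu> / (s\<^sup>2 * r\<^sup>2) \<le> 1/2" using sp by (simp add: field_simps)
  have "Q s - Q r = (r\<^sup>2 - s\<^sup>2) * (1 - \<nu> / (s\<^sup>2 * r\<^sup>2))"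
    using sp by (simp add: Q_def field_simps)
  also have "\<dots> \<ge> (r\<^sup>2 - s\<^sup>2) * (1/2)" using r2 frac by (intro mult_left_mono) auto
  also have "(r\<^sup>2 - s\<^sup>2) * (1/2) = (r - s) * ((r + s) / 2)" by (simp add: power2_eq_square algebra_simps)
  also have "\<dots> \<ge> (r - s) * (sqrt \<Lambda> / 2)" using assms by (intro mult_left_mono) auto
  finally (xtrans) show ?thesis by simp
qed

text \<open>The energy bounds \<open>|v|\<close>, so \<open>w\<close> cannot drop quickly: to the left of \<open>r\<close> it stays above \<open>|w r| / 2\<close> on an
interval of length \<open>h\<close> proportional to \<open>|w r|\<close>. At the left end of that interval \<open>Q\<close> exceeds a
multiple of \<open>h sqrt \<Lambda>\<close>, and the bound of the energy there gives \<open>|w r|^3 sqrt \<Lambda> \<le> C \<Phi>0^(3/2)\<close>.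
This is the size of an Airy function at its turning point.\<close>

lemma amplitude_up_to_turning_point:
  assumes r: "sqrt \<Lambda> / 2 \<le> r" and Qr: "Q r \<ge> 0"
  shows "(w r)\<^sup>2 \<le> 16 * \<Phi>0 * \<Lambda> powr (-1/3)"
proof (cases "w r = 0")
  case True
  thus ?thesis using energy_r0_bounds by simp
next
  case False
  define a where "a = sqrt \<Lambda> / 2"
  have ap: "a > 0" using Lam_pos by (simp add: a_def)
  have ra: "r0 \<le> a" using r0_le by (simp add: a_def)
  define W where "W = \<bar>w r\<bar>"
  have W: "W > 0" using False by (simp add: W_def)
  have \<Phi>: "\<Phi>0 \<ge> 0" using energy_r0_bounds by linarith
  have Qpos: "Q s \<ge> 0" if "a \<le> s" "s \<le> r" for s
  proof -
    have "0 \<le> (r - s) * sqrt \<Lambda> / 2" using that Lam_pos by simp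
    thus ?thesis using Q_gap[of s r] that Qr by (auto simp: a_def)
  qed
  have v2: "(v s)\<^sup>2 \<le> 2 * \<Phi>0" if "a \<le> s" "s \<le> r" for s
  proof -
    have "0 \<le> Q s * (w s)\<^sup>2" using Qpos[OF that] by simp
    thus ?thesis using energy_le[of s] that ra by (simp add: F_def)
  qed
  have vb: "\<bar>v s\<bar> \<le> sqrt (2 * \<Phi>0)" if "a \<le> s" "s \<le> r" for s
    using v2[OF that] by (simp add: real_le_rsqrt)
  have lip: "W - sqrt (2 * \<Phi>0) * (r - s) \<le> \<bar>w s\<bar>" if s: "a \<le> s" "s \<le> r" for s
  proof -
    have "norm (w r - w s) \<le> sqrt (2 * \<Phi>0) * norm (r - s)"
    proof (rule field_differentiable_bound[where S = "{s..r}" and f' = v])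
      fix x assume "x \<in> {s..r}"
      thus "(w has_field_derivative v x) (at x within {s..r})" "norm (v x) \<le> sqrt (2 * \<Phi>0)"
        using dw[of x] s ap vb[of x] by (auto intro: DERIV_subset)
    qed (use s in auto)
    thus ?thesis using s by (auto simp: W_def)
  qed
  have LL: "\<Lambda> powr (-1) \<le> \<Lambda> powr (-1/3)" using Lam_ge8 by (intro powr_mono) auto
  have near: "(w a)\<^sup>2 \<le> 4 * \<Phi>0 * \<Lambda> powr (-1/3)"
  proof -
    have "(w a)\<^sup>2 \<le> 4 * \<Phi>0 * \<Lambda> powr (-1)"
      using amplitude_before_turning_point[OF ra] Lam_pos by (simp add: a_def powr_minus_divide)
    also have "\<dots> \<le> 4 * \<Phi>0 * \<Lambda> powr (-1/3)" using LL \<Phi> by (intro mult_left_mono) auto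
    finally show ?thesis .
  qed
  show ?thesis
  \<comment> \<open>Either that interval reaches \<open>sqrt \<Lambda> / 2\<close>, where the amplitude is already known, or it does not.\<close>
  proof (cases "sqrt (2 * \<Phi>0) * (r - a) \<le> W / 2")
    case True
    hence "W / 2 \<le> \<bar>w a\<bar>" using lip[of a] r by (simp add: a_def)
    hence "(W/2)\<^sup>2 \<le> \<bar>w a\<bar>\<^sup>2" using W by (intro power_mono) auto
    hence "(w r)\<^sup>2 \<le> 4 * (w a)\<^sup>2" by (simp add: W_def power_divide)
    thus ?thesis using near by linarith
  next
    case f: False
    have \<Phi>p: "\<Phi>0 > 0"
    proof (rule ccontr)
      assume "\<not> \<Phi>0 > 0"
      hence "\<Phi>0 = 0" using \<Phi> by simp
      thus False using f W by simp
    qed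
    define B where "B = sqrt (2 * \<Phi>0)"
    have B: "B > 0" "B\<^sup>2 = 2 * \<Phi>0" using \<Phi>p by (auto simp: B_def)
    define h where "h = W / (2 * B)"
    have h: "h > 0" "h \<le> r - a" using W B(1) f[folded B_def] by (auto simp: h_def field_simps)
    define s where "s = r - h"
    have s: "a \<le> s" "s \<le> r" using h by (auto simp: s_def)
    have "W - B * h \<le> \<bar>w s\<bar>" using lip[OF s] by (simp add: B_def s_def)
    hence ws: "W / 2 \<le> \<bar>w s\<bar>" using B by (simp add: h_def)
    have ws2: "(W/2)\<^sup>2 \<le> (w s)\<^sup>2" using power_mono[OF ws, of 2] W by simp
    have Qs: "Q s \<ge> h * sqrt \<Lambda> / 2" using Q_gap[of s r] s Qr by (simp add: a_def s_def)
    have "h * sqrt \<Lambda> / 2 * (W/2)\<^sup>2 \<le> Q s * (w s)\<^sup>2"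
      by (intro mult_mono Qs ws2 Qpos s) auto
    also have "\<dots> \<le> F s" by (simp add: F_def)
    also have "\<dots> \<le> B\<^sup>2" using energy_le[of s] s ra B by simp
    finally have "W ^ 3 * sqrt \<Lambda> \<le> 16 * B ^ 3"
      using B(1) by (simp add: h_def field_simps power2_eq_square power3_eq_cube)
    hence "(W ^ 3 * sqrt \<Lambda>)\<^sup>2 \<le> (16 * B ^ 3)\<^sup>2" using W Lam_pos by (intro power_mono) auto
    hence "(W\<^sup>2) ^ 3 * \<Lambda> \<le> 256 * (B\<^sup>2) ^ 3"
      using Lam_pos by (simp add: power_mult_distrib power_mult[symmetric, of _ 2 3] power_mult[symmetric, of _ 3 2])
    hence "(W\<^sup>2) ^ 3 \<le> 256 * (B\<^sup>2) ^ 3 / \<Lambda>" using Lam_pos by (simp add: field_simps)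
    also have "\<dots> \<le> (8 * B\<^sup>2) ^ 3 / \<Lambda>"
      using Lam_pos \<Phi> by (intro divide_right_mono) (auto simp: power_mult_distrib)
    also have "\<dots> = (8 * B\<^sup>2 * \<Lambda> powr (-1/3)) ^ 3"
    proof -
      have "(\<Lambda> powr (-1/3)) ^ 3 = (\<Lambda> powr (-1/3)) powr real 3"
        using Lam_pos by (subst powr_realpow) auto
      also have "\<dots> = \<Lambda> powr (-1)" by (simp only: powr_powr) simp
      also have "\<dots> = 1 / \<Lambda>" using Lam_pos by (simp add: powr_minus_divide)
      finally have e: "(\<Lambda> powr (-1/3)) ^ 3 = 1 / \<Lambda>" .
      show ?thesis by (simp only: power_mult_distrib e) simp
    qed
    finally have "(W\<^sup>2) ^ Suc 2 \<le> (8 * B\<^sup>2 * \<Lambda> powr (-1/3)) ^ Suc 2" by (simp add: eval_nat_numeral)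
    hence "W\<^sup>2 \<le> 8 * B\<^sup>2 * \<Lambda> powr (-1/3)"
      by (rule power_le_imp_le_base) (use \<Phi> B in simp)
    thus ?thesis using B by (simp add: W_def)
  qed
qed

text \<open>Beyond the turning point \<open>w v\<close> is nondecreasing. If it were positive somewhere, \<open>w^2\<close> would increase
from there on and could not tend to \<open>0\<close>. So \<open>w^2\<close> decreases past the turning point, and its value
there is already bounded.\<close>

lemma amplitude_far:
  assumes r: "sqrt \<Lambda> / 2 \<le> r"
  shows "(w r)\<^sup>2 \<le> 16 * \<Phi>0 * \<Lambda> powr (-1/3)"
proof (cases "Q r \<ge> 0")
  case False
  define a where "a = sqrt \<Lambda> / 2"
  have ap: "a > 0" using Lam_pos by (simp add: a_def)
  have Qa: "Q a \<ge> 0" using Q_ge[OF r0_le] Lam_pos by (simp add: a_def)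
  have "continuous_on {a..r} Q"
    by (intro continuous_at_imp_continuous_on ballI DERIV_isCont[OF Q_deriv]) (use ap in auto)
  hence "\<exists>t\<ge>a. t \<le> r \<and> Q t = 0"
    using False Qa r by (intro IVT2') (auto simp: a_def)
  then obtain t where t: "a \<le> t" "t \<le> r" "Q t = 0" by blast
  have tp: "t > 0" using t ap by simp
  have Qneg: "Q s \<le> 0" if "t \<le> s" for s
  proof -
    have "0 \<le> (s - t) * sqrt \<Lambda> / 2" using that Lam_pos by simp
    thus ?thesis using Q_gap[of t s] that t by (simp add: a_def)
  qed
  let ?P = "\<lambda>s. w s * v s"
  have Pmono: "?P s \<le> ?P u" if "t \<le> s" "s \<le> u" for s u
  proof (rule DERIV_nonneg_imp_nondecreasing[OF that(2), where f = ?P])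
    fix x assume x: "s \<le> x" "x \<le> u"
    hence xp: "x > 0" "t \<le> x" using that tp by auto
    have "(?P has_real_derivative (v x)\<^sup>2 - Q x * (w x)\<^sup>2) (at x)"
      by (rule derivative_eq_intros refl dw dv xp(1))+ (simp add: Q_def algebra_simps power2_eq_square)
    moreover have "(v x)\<^sup>2 - Q x * (w x)\<^sup>2 \<ge> 0"
      using mult_nonpos_nonneg[OF Qneg[OF xp(2)], of "(w x)\<^sup>2"] by (smt (verit) zero_le_power2)
    ultimately show "\<exists>y. (?P has_real_derivative y) (at x) \<and> 0 \<le> y" by blast
  qed
  have dw2: "((\<lambda>s. (w s)\<^sup>2) has_real_derivative 2 * ?P x) (at x)" if "x > 0" for x
    by (rule derivative_eq_intros refl dw that | simp)+
  have Pneg: "?P s \<le> 0" if s: "t \<le> s" for s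
  proof (rule ccontr)
    assume "\<not> ?P s \<le> 0"
    hence Ps: "?P s > 0" by simp
    hence ws: "(w s)\<^sup>2 > 0" by auto
    have ev: "(w s)\<^sup>2 \<le> (w u)\<^sup>2" if "s \<le> u" for u
    proof (rule DERIV_nonneg_imp_nondecreasing[OF that, where f = "\<lambda>s. (w s)\<^sup>2"])
      fix x assume x: "s \<le> x" "x \<le> u"
      show "\<exists>y. ((\<lambda>s. (w s)\<^sup>2) has_real_derivative y) (at x) \<and> 0 \<le> y"
        using dw2[of x] Pmono[OF s x(1)] Ps x s tp by (intro exI[of _ "2 * ?P x"]) auto
    qed
    have "((\<lambda>u. (w u)\<^sup>2) \<longlongrightarrow> 0\<^sup>2) at_top" by (intro tendsto_intros lim)
    moreover have "eventually (\<lambda>u. (w s)\<^sup>2 \<le> (w u)\<^sup>2) at_top"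
      using ev by (auto simp: eventually_at_top_linorder)
    ultimately have "(w s)\<^sup>2 \<le> 0\<^sup>2" by (intro tendsto_lowerbound) auto
    thus False using ws by simp
  qed
  have "(w r)\<^sup>2 \<le> (w t)\<^sup>2"
  proof (rule DERIV_nonpos_imp_nonincreasing[OF t(2), where f = "\<lambda>s. (w s)\<^sup>2"])
    fix x assume "t \<le> x" "x \<le> r"
    thus "\<exists>y. ((\<lambda>s. (w s)\<^sup>2) has_real_derivative y) (at x) \<and> y \<le> 0"
      using dw2[of x] Pneg[of x] tp by (intro exI[of _ "2 * ?P x"]) (auto simp: mult.commute)
  qed
  also have "\<dots> \<le> 16 * \<Phi>0 * \<Lambda> powr (-1/3)"
    by (rule amplitude_up_to_turning_point) (use t in \<open>auto simp: a_def\<close>)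
  finally show ?thesis .
qed (use amplitude_up_to_turning_point r in auto)

end


section \<open>Decay of the profile\<close>

lemma profile_tendsto_0: "((\<lambda>r. r powr b * profile a n r) \<longlongrightarrow> 0) at_top"
proof -
  have "((\<lambda>r. \<Sum>k\<le>n. coeff (kummer a n) k * (r powr b * r ^ (2 * k) * exp (- r\<^sup>2 / 2))) \<longlongrightarrow> (\<Sum>k\<le>n. coeff (kummer a n) k * 0)) at_top"
  proof (intro tendsto_sum tendsto_mult tendsto_const)
    fix k :: nat
    show "((\<lambda>r. r powr b * r ^ (2 * k) * exp (- r\<^sup>2 / 2)) \<longlongrightarrow> 0) at_top"
      by real_asymp
  qed
  moreover have "profile a n r = (\<Sum>k\<le>n. coeff (kummer a n) k * r ^ (2 * k) * exp (- r\<^sup>2 / 2))" for r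
    by (simp add: profile_def kummer_def coeff_kummer[unfolded kummer_def] poly_sum poly_monom sum_distrib_right power_mult)
  ultimately show ?thesis by (simp add: sum_distrib_left mult_ac)
qed

lemma profile_energy:
  assumes "a \<ge> 1" "r \<ge> 0"
  shows "(profile' a n r)\<^sup>2 + ((4 * real n + 2 * a) - r\<^sup>2) * (profile a n r)\<^sup>2 \<le> 4 * real n + 2 * a"
proof (rule radial_energy_le[where \<mu> = "2 * a - 1"])
  show "continuous_on {0..} (profile' a n)"
    unfolding profile'_def[abs_def] by (intro continuous_intros) auto
next
  show "(profile' a n has_real_derivative - ((2 * a - 1) / r) * profile' a n r - (4 * real n + 2 * a - r\<^sup>2) * profile a n r) (at r)"
    if "r > 0" for r using profile'_deriv[of a r n] assms that by simp
qed (use assms in \<open>auto intro!: profile_deriv\<close>)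

lemma profile_sq_le_2:
  assumes "a \<ge> 1" "r \<ge> 0" "2 * r\<^sup>2 \<le> 4 * real n + 2 * a"
  shows "(profile a n r)\<^sup>2 \<le> 2"
proof -
  let ?L = "4 * real n + 2 * a"
  have "?L / 2 * (profile a n r)\<^sup>2 \<le> (?L - r\<^sup>2) * (profile a n r)\<^sup>2"
    using assms by (intro mult_right_mono) auto
  also have "\<dots> \<le> ?L" using profile_energy[OF assms(1,2), of n] zero_le_power2[of "profile' a n r"] by linarith
  finally have "?L * (profile a n r)\<^sup>2 \<le> ?L * 2" by simp
  moreover have "?L > 0" using assms by linarith
  ultimately show ?thesis by (simp only: mult_le_cancel_left_pos)
qed

text \<open>A bound for the energy at the starting point \<open>r = 2 a / sqrt \<Lambda>\<close>, where \<open>r^(2a-1)\<close> is the Liouville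
weight.\<close>

definition osc_const :: "real \<Rightarrow> real \<Rightarrow> real" where
  "osc_const a \<Lambda> = 6 * \<Lambda> * (2 * a / sqrt \<Lambda>) powr (2 * a - 1)"

text \<open>At distance \<open>2 a / sqrt \<Lambda>\<close> from the origin the energy of \<open>w\<close> is at most \<open>6\<close> times the Liouville weight
times \<open>\<Lambda>\<close>, because the damped energy of the profile never exceeds \<open>\<Lambda>\<close>.\<close>

lemma profile_oscillation:
  assumes a: "a \<ge> 1" and n: "real n \<ge> 2 * a"
  defines "\<Lambda> \<equiv> 4 * real n + 2 * a" and "\<mu> \<equiv> 2 * a - 1"
  shows "oscillation (\<lambda>r. r powr (\<mu>/2) * profile a n r)
     (\<lambda>r. r powr (\<mu>/2) * (profile' a n r + \<mu> / (2 * r) * profile a n r))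
     (\<mu> * (\<mu> - 2) / 4) \<Lambda> (2 * a) (osc_const a \<Lambda>)"
proof -
  let ?\<nu> = "\<mu> * (\<mu> - 2) / 4"
  let ?r = "2 * a / sqrt \<Lambda>"
  have d: "(profile' a n has_real_derivative - (\<mu> / r) * profile' a n r - (\<Lambda> - r\<^sup>2) * profile a n r) (at r)"
    if "r > 0" for r
    using profile'_deriv[of a r n] a that by (simp add: \<mu>_def \<Lambda>_def)
  have Lp: "\<Lambda> > 0" "\<Lambda> \<ge> 4 * (2 * a)" using a n by (auto simp: \<Lambda>_def)
  have nu: "?\<nu> = (\<mu> - 1)\<^sup>2 / 4 - 1/4" by (simp add: power2_eq_square field_simps)
  have m1: "\<mu> \<ge> 1" using a by (simp add: \<mu>_def)
  have nl: "- 1/4 \<le> ?\<nu>" unfolding nu by simp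
  have nup: "4 * ?\<nu> \<le> (2 * a)\<^sup>2"
  proof -
    have "(\<mu> - 1)\<^sup>2 \<le> (2 * a)\<^sup>2" using m1 by (intro power_mono) (auto simp: \<mu>_def)
    thus ?thesis unfolding nu by simp
  qed
  have rp: "?r > 0" using a Lp by simp
  have r2: "?r\<^sup>2 = (2*a)\<^sup>2 / \<Lambda>" using Lp by (simp add: power_divide)
  have r2le: "?r\<^sup>2 \<le> \<Lambda> / 4"
  proof -
    have "(2*a)\<^sup>2 \<le> (\<Lambda>/2)\<^sup>2" using a Lp by (intro power_mono) auto
    hence "(2*a)\<^sup>2 * 4 \<le> \<Lambda> * \<Lambda>" by (simp add: power2_eq_square)
    thus ?thesis using Lp(1) unfolding r2 by (simp add: field_simps)
  qed
  let ?f = "profile a n ?r" and ?g = "profile' a n ?r"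
  have f2: "?f\<^sup>2 \<le> 2" using a rp r2le Lp by (intro profile_sq_le_2) (auto simp: \<Lambda>_def)
  have g2: "?g\<^sup>2 \<le> \<Lambda>"
  proof -
    have "?g\<^sup>2 + (\<Lambda> - ?r\<^sup>2) * ?f\<^sup>2 \<le> \<Lambda>" using profile_energy[OF a, of ?r n] rp by (simp add: \<Lambda>_def)
    moreover have "(\<Lambda> - ?r\<^sup>2) * ?f\<^sup>2 \<ge> 0" using r2le Lp(1) by (intro mult_nonneg_nonneg) auto
    ultimately show ?thesis by linarith
  qed
  have "(\<mu> / (2 * ?r))\<^sup>2 = \<mu>\<^sup>2 / (2*a)\<^sup>2 * \<Lambda> / 4" 
    using Lp by (simp add: power_divide power_mult_distrib)
  also have "\<dots> \<le> 1 * \<Lambda> / 4"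
  proof (intro divide_right_mono mult_right_mono)
    have "\<mu>\<^sup>2 \<le> (2 * a)\<^sup>2" using m1 by (intro power_mono) (auto simp: \<mu>_def)
    thus "\<mu>\<^sup>2 / (2 * a)\<^sup>2 \<le> 1" using a by (simp only: divide_le_eq_1) auto
  qed (use Lp in auto)
  finally have mr: "(\<mu> / (2 * ?r))\<^sup>2 \<le> \<Lambda> / 4" by simp
  have "(?g + \<mu> / (2 * ?r) * ?f)\<^sup>2 \<le> 2 * ?g\<^sup>2 + 2 * (\<mu> / (2 * ?r) * ?f)\<^sup>2"
    using sum_squares_bound[of ?g "\<mu> / (2 * ?r) * ?f"] by (simp add: power2_sum)
  also have "(\<mu> / (2 * ?r) * ?f)\<^sup>2 = (\<mu> / (2 * ?r))\<^sup>2 * ?f\<^sup>2" by (rule power_mult_distrib)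
  also have "\<dots> \<le> \<Lambda> / 4 * 2" using mr f2 Lp by (intro mult_mono) auto
  finally have v2: "(?g + \<mu> / (2 * ?r) * ?f)\<^sup>2 \<le> 3 * \<Lambda>" using g2 by simp
  have Qle: "\<Lambda> - ?r\<^sup>2 - ?\<nu> / ?r\<^sup>2 \<le> 3/2 * \<Lambda>"
  proof -
    have "- ?\<nu> / ?r\<^sup>2 \<le> (1/4) / ?r\<^sup>2" using nl by (intro divide_right_mono) auto
    also have "\<dots> = \<Lambda> / (4 * (2 * a)\<^sup>2)" using Lp(1) by (simp add: r2)
    also have "\<dots> \<le> \<Lambda> / 4"
      using Lp(1) a one_le_power[of "2*a" 2] by (intro divide_left_mono) auto
    finally have "- (?\<nu> / ?r\<^sup>2) \<le> \<Lambda> / 4" by (simp only: minus_divide_left)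
    thus ?thesis using Lp(1) zero_le_power2[of ?r] by linarith
  qed
  have "(\<Lambda> - ?r\<^sup>2 - ?\<nu> / ?r\<^sup>2) * ?f\<^sup>2 \<le> 3/2 * \<Lambda> * ?f\<^sup>2" by (rule mult_right_mono[OF Qle]) simp
  also have "\<dots> \<le> 3/2 * \<Lambda> * 2" using f2 Lp by (intro mult_left_mono) auto
  finally have w2: "(\<Lambda> - ?r\<^sup>2 - ?\<nu> / ?r\<^sup>2) * ?f\<^sup>2 \<le> 3 * \<Lambda>" by simp
  have pw: "(?r powr (\<mu>/2))\<^sup>2 = ?r powr \<mu>" using rp by (simp flip: powr_numeral add: powr_powr)
  have "(?r powr (\<mu>/2) * (?g + \<mu> / (2 * ?r) * ?f))\<^sup>2 +
      (\<Lambda> - ?r\<^sup>2 - ?\<nu> / ?r\<^sup>2) * (?r powr (\<mu>/2) * ?f)\<^sup>2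
      = ?r powr \<mu> * ((?g + \<mu> / (2 * ?r) * ?f)\<^sup>2 + (\<Lambda> - ?r\<^sup>2 - ?\<nu> / ?r\<^sup>2) * ?f\<^sup>2)"
    by (simp only: power_mult_distrib pw) (simp add: algebra_simps)
  also have "\<dots> \<le> ?r powr \<mu> * (6 * \<Lambda>)" using v2 w2 by (intro mult_left_mono) auto
  finally have init: "(?r powr (\<mu>/2) * (?g + \<mu> / (2 * ?r) * ?f))\<^sup>2 +
      (\<Lambda> - ?r\<^sup>2 - ?\<nu> / ?r\<^sup>2) * (?r powr (\<mu>/2) * ?f)\<^sup>2 \<le> osc_const a \<Lambda>"
    by (simp add: osc_const_def \<mu>_def mult_ac)
  show ?thesis
    by unfold_locales
       (use nl nup a Lp init profile_tendsto_0 liouville_derivs[OF profile_deriv d] in auto)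
qed

lemma osc_const_eq:
  assumes "a \<ge> 1" "\<Lambda> > 0"
  shows "osc_const a \<Lambda> = 6 * (2 * a) powr (2 * a - 1) * \<Lambda> * \<Lambda> powr (- (2 * a - 1) / 2)"
proof -
  have "(2 * a / sqrt \<Lambda>) powr (2 * a - 1) = (2 * a) powr (2 * a - 1) / sqrt \<Lambda> powr (2 * a - 1)"
    using assms by (simp add: powr_divide)
  also have "sqrt \<Lambda> powr (2 * a - 1) = \<Lambda> powr ((2 * a - 1) / 2)"
    using assms by (simp add: powr_half_sqrt[symmetric] powr_powr)
  also have "(2 * a) powr (2 * a - 1) / \<Lambda> powr ((2 * a - 1) / 2)
     = (2 * a) powr (2 * a - 1) * \<Lambda> powr (- (2 * a - 1) / 2)"
    using powr_minus_divide[of \<Lambda> "(2 * a - 1) / 2"] by (simp only: minus_divide_left[symmetric]) simp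
  finally show ?thesis by (simp add: osc_const_def mult_ac)
qed

text \<open>Before the starting point the right-hand side exceeds \<open>2\<close>, which bounds the profile by its damped
energy; after it the bound is the constant amplitude of \<open>w\<close>.\<close>

lemma profile_sq_le_near:
  assumes a: "a \<ge> 1" and n: "real n \<ge> 2 * a" and r: "0 < r" "r \<le> sqrt (4 * real n + 2 * a) / 2"
  shows "(profile a n r)\<^sup>2 \<le> 24 * (2 * a) powr (2 * a - 1) * (r * sqrt (4 * real n + 2 * a)) powr (- (2 * a - 1))"
proof -
  define \<Lambda> where "\<Lambda> = 4 * real n + 2 * a"
  define \<mu> where "\<mu> = 2 * a - 1"
  have m1: "\<mu> \<ge> 1" using a by (simp add: \<mu>_def)
  interpret oscillation "\<lambda>r. r powr (\<mu>/2) * profile a n r"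
     "\<lambda>r. r powr (\<mu>/2) * (profile' a n r + \<mu> / (2 * r) * profile a n r)"
     "\<mu> * (\<mu> - 2) / 4" \<Lambda> "2 * a" "osc_const a \<Lambda>"
    using profile_oscillation[OF a n] by (simp only: \<mu>_def \<Lambda>_def)
  have rl: "r \<le> sqrt \<Lambda> / 2" using r by (simp add: \<Lambda>_def)
  have L0: "sqrt \<Lambda> > 0" using Lam_pos by simp
  have e: "(2 * a / (r * sqrt \<Lambda>)) powr \<mu> = (2 * a) powr \<mu> * (r * sqrt \<Lambda>) powr (- \<mu>)"
    using a r L0 by (simp add: powr_divide powr_minus_divide)
  have "(profile a n r)\<^sup>2 \<le> 24 * (2 * a / (r * sqrt \<Lambda>)) powr \<mu>"
  proof (cases "r0 \<le> r")
    case True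
    have pw: "(r powr (\<mu>/2))\<^sup>2 = r powr \<mu>" using r by (simp flip: powr_numeral add: powr_powr)
    have "r powr \<mu> * (profile a n r)\<^sup>2 \<le> 4 * osc_const a \<Lambda> / \<Lambda>"
      using amplitude_before_turning_point[OF True rl] by (simp add: power_mult_distrib pw)
    also have "\<dots> = 24 * (2 * a / sqrt \<Lambda>) powr \<mu>"
      using Lam_pos by (simp add: osc_const_def \<mu>_def)
    also have "2 * a / sqrt \<Lambda> = r * (2 * a / (r * sqrt \<Lambda>))" using r by simp
    also have "24 * (r * (2 * a / (r * sqrt \<Lambda>))) powr \<mu> = r powr \<mu> * (24 * (2 * a / (r * sqrt \<Lambda>)) powr \<mu>)"
      using r a L0 by (subst powr_mult) (auto simp: mult_ac)
    finally show ?thesis using r by (subst (asm) mult_le_cancel_left_pos) auto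
  next
    case False
    have "r < 2 * a / sqrt \<Lambda>" using False by (simp only: r0_def not_le)
    hence "r * sqrt \<Lambda> \<le> 2 * a" using L0 by (simp add: field_simps)
    hence "1 \<le> 2 * a / (r * sqrt \<Lambda>)" using r L0 by simp
    hence "1 \<le> (2 * a / (r * sqrt \<Lambda>)) powr \<mu>" using m1 by (intro ge_one_powr_ge_zero) auto
    moreover have "(profile a n r)\<^sup>2 \<le> 2"
    proof (rule profile_sq_le_2)
      have "r\<^sup>2 \<le> (sqrt \<Lambda> / 2)\<^sup>2" using rl r by (intro power_mono) auto
      thus "2 * r\<^sup>2 \<le> 4 * real n + 2 * a" using Lam_pos by (simp add: power_divide \<Lambda>_def)
    qed (use a r in auto)
    ultimately show ?thesis by simp
  qed
  thus ?thesis unfolding e by (simp add: \<mu>_def \<Lambda>_def mult_ac)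
qed

text \<open>Up to \<open>sqrt \<Lambda> / 2\<close> the near bound gives the power \<open>-(2a-1)/2\<close> of \<open>\<Lambda>\<close>. Beyond, the amplitude of \<open>w\<close> and the
decay of the weight \<open>r^(1-2a)\<close> give the power \<open>2/3 - (2a-1)\<close>. Since \<open>a \<ge> 1\<close>, both are at most the
stated power, with equality in the second case for \<open>a = 1\<close>.\<close>

lemma profile_sq_le_far:
  assumes a: "a \<ge> 1" and n: "real n \<ge> 2 * a" and r: "1 \<le> r"
  shows "(profile a n r)\<^sup>2 \<le> 96 * (4 * a) powr (2 * a - 1) * (4 * real n + 2 * a) powr (1/6 - (2 * a - 1) / 2)"
proof -
  define \<Lambda> where "\<Lambda> = 4 * real n + 2 * a"
  define \<mu> where "\<mu> = 2 * a - 1"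
  have m1: "\<mu> \<ge> 1" using a by (simp add: \<mu>_def)
  interpret oscillation "\<lambda>r. r powr (\<mu>/2) * profile a n r"
     "\<lambda>r. r powr (\<mu>/2) * (profile' a n r + \<mu> / (2 * r) * profile a n r)"
     "\<mu> * (\<mu> - 2) / 4" \<Lambda> "2 * a" "osc_const a \<Lambda>"
    using profile_oscillation[OF a n] by (simp only: \<mu>_def \<Lambda>_def)
  have L1: "\<Lambda> \<ge> 1" using Lam_ge8 by simp
  have L0: "sqrt \<Lambda> > 0" using Lam_pos by simp
  have a2: "(4 * a) powr \<mu> = 2 powr \<mu> * (2 * a) powr \<mu>"
    using a by (simp flip: powr_mult)
  have twop: "2 powr \<mu> \<ge> (1::real)" using m1 by (intro ge_one_powr_ge_zero) auto
  have sq: "sqrt \<Lambda> powr (- \<mu>) = \<Lambda> powr (- \<mu> / 2)"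
    using Lam_pos by (simp add: powr_half_sqrt[symmetric] powr_powr)
  have oc: "osc_const a \<Lambda> = 6 * (2 * a) powr \<mu> * \<Lambda> * \<Lambda> powr (- \<mu> / 2)"
    using osc_const_eq[OF a Lam_pos] by (simp add: \<mu>_def)
  have "(profile a n r)\<^sup>2 \<le> 96 * (4 * a) powr \<mu> * \<Lambda> powr (1/6 - \<mu> / 2)"
  proof (cases "r \<le> sqrt \<Lambda> / 2")
    case True
    have "(r * sqrt \<Lambda>) powr (- \<mu>) \<le> sqrt \<Lambda> powr (- \<mu>)"
      using r L0 m1 by (intro powr_mono2') auto
    also have "\<dots> \<le> \<Lambda> powr (1/6 - \<mu> / 2)" unfolding sq using L1 by (intro powr_mono) auto
    finally have pl: "(r * sqrt \<Lambda>) powr (- \<mu>) \<le> \<Lambda> powr (1/6 - \<mu> / 2)" .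
    have "(profile a n r)\<^sup>2 \<le> 24 * (2 * a) powr \<mu> * (r * sqrt \<Lambda>) powr (- \<mu>)"
      using profile_sq_le_near[OF a n] r True by (simp add: \<mu>_def \<Lambda>_def)
    also have "\<dots> \<le> 24 * (2 * a) powr \<mu> * \<Lambda> powr (1/6 - \<mu> / 2)"
      by (rule mult_left_mono[OF pl]) simp
    also have "24 * (2 * a) powr \<mu> * \<Lambda> powr (1/6 - \<mu> / 2) \<le> 96 * (4 * a) powr \<mu> * \<Lambda> powr (1/6 - \<mu> / 2)"
    proof (rule mult_right_mono)
      have "1 * (2 * a) powr \<mu> \<le> 2 powr \<mu> * (2 * a) powr \<mu>" by (rule mult_right_mono[OF twop]) simp
      thus "24 * (2 * a) powr \<mu> \<le> 96 * (4 * a) powr \<mu>" unfolding a2 by (smt (verit) powr_ge_zero)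
    qed simp
    finally show ?thesis by simp
  next
    case False
    have rp: "r > 0" using r by simp
    have pw: "(r powr (\<mu>/2))\<^sup>2 = r powr \<mu>" using r by (simp flip: powr_numeral add: powr_powr)
    have "r powr \<mu> * (profile a n r)\<^sup>2 \<le> 16 * osc_const a \<Lambda> * \<Lambda> powr (-1/3)"
      using amplitude_far[of r] False by (simp add: power_mult_distrib pw)
    hence "r powr (- \<mu>) * (r powr \<mu> * (profile a n r)\<^sup>2) \<le> r powr (- \<mu>) * (16 * osc_const a \<Lambda> * \<Lambda> powr (-1/3))"
      by (intro mult_left_mono) auto
    moreover have "r powr (- \<mu>) * (r powr \<mu> * (profile a n r)\<^sup>2) = (profile a n r)\<^sup>2"
      using rp by (simp add: powr_minus)
    ultimately have "(profile a n r)\<^sup>2 \<le> r powr (- \<mu>) * (16 * osc_const a \<Lambda> * \<Lambda> powr (-1/3))"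
      by (simp only:)
    also have "\<dots> = 16 * osc_const a \<Lambda> * \<Lambda> powr (-1/3) * r powr (- \<mu>)" by (rule mult.commute)
    also have "\<dots> \<le> 16 * osc_const a \<Lambda> * \<Lambda> powr (-1/3) * (sqrt \<Lambda> / 2) powr (- \<mu>)"
      using False L0 m1 energy_r0_bounds by (intro mult_left_mono powr_mono2') auto
    also have "(sqrt \<Lambda> / 2) powr (- \<mu>) = \<Lambda> powr (- \<mu> / 2) * 2 powr \<mu>"
    proof -
      have "(sqrt \<Lambda> / 2) powr (- \<mu>) = sqrt \<Lambda> powr (- \<mu>) / 2 powr (- \<mu>)"
        by (rule powr_divide)
      also have "2 powr (- \<mu>) = 1 / (2::real) powr \<mu>" by (rule powr_minus_divide)
      finally show ?thesis by (simp add: sq)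
    qed
    also have "16 * osc_const a \<Lambda> * \<Lambda> powr (-1/3) * (\<Lambda> powr (- \<mu> / 2) * 2 powr \<mu>)
       = 96 * (4 * a) powr \<mu> * (\<Lambda> powr 1 * \<Lambda> powr (- \<mu> / 2) * \<Lambda> powr (-1/3) * \<Lambda> powr (- \<mu> / 2))"
      unfolding oc a2 using Lam_pos by simp
    also have "\<Lambda> powr 1 * \<Lambda> powr (- \<mu> / 2) * \<Lambda> powr (-1/3) * \<Lambda> powr (- \<mu> / 2) = \<Lambda> powr (2/3 - \<mu>)"
      by (simp only: powr_add[symmetric], rule arg_cong[where f = "\<lambda>x. \<Lambda> powr x"]) simp
    also have "96 * (4 * a) powr \<mu> * \<Lambda> powr (2/3 - \<mu>) \<le> 96 * (4 * a) powr \<mu> * \<Lambda> powr (1/6 - \<mu>/2)"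
      using m1 L1 by (intro mult_left_mono powr_mono) auto
    finally show ?thesis .
  qed
  thus ?thesis by (simp add: \<mu>_def \<Lambda>_def)
qed


section \<open>Eigenfunctions are multiples of their profile\<close>

text \<open>Uniqueness for the singular initial value problem: the term \<open>\<mu> / r\<close> is dissipative, so \<open>f^2 + g^2\<close>
obeys a Gronwall inequality on \<open>{0..R}\<close> in spite of the singularity at \<open>0\<close>.\<close>

lemma radial_ode_zero:
  fixes f g :: "real \<Rightarrow> real"
  assumes df: "\<And>r. (f has_real_derivative g r) (at r)"
    and dg: "\<And>r. r > 0 \<Longrightarrow> (g has_real_derivative - (\<mu> / r) * g r - (\<Lambda> - r\<^sup>2) * f r) (at r)"
    and cg: "continuous_on {0..} g"
    and "f 0 = 0" "g 0 = 0" "\<mu> \<ge> 0" "R \<ge> 0"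
  shows "f R = 0"
proof -
  define C where "C = 1 + \<bar>\<Lambda>\<bar> + R\<^sup>2"
  let ?e = "\<lambda>r. ((g r)\<^sup>2 + (f r)\<^sup>2) * exp (- C * r)"
  have "?e R \<le> ?e 0"
  proof (rule DERIV_nonpos_imp_decreasing_open[where f = ?e])
    fix x assume x: "0 < x" "x < R"
    let ?d = "(- 2 * (\<mu> / x) * (g x)\<^sup>2 + (1 - \<Lambda> + x\<^sup>2) * (2 * f x * g x) - C * ((g x)\<^sup>2 + (f x)\<^sup>2)) * exp (- C * x)"
    have "(?e has_real_derivative ?d) (at x)"
      by (rule derivative_eq_intros df dg x refl | simp)+
         (simp add: algebra_simps power2_eq_square)
    moreover have "?d \<le> 0"
    proof -
      have "x\<^sup>2 \<le> R\<^sup>2" using x by (intro power_mono) auto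
      hence c: "\<bar>1 - \<Lambda> + x\<^sup>2\<bar> \<le> C" unfolding C_def using zero_le_power2[of x] by linarith
      have "\<bar>2 * f x * g x\<bar> \<le> (g x)\<^sup>2 + (f x)\<^sup>2"
        using sum_squares_bound[of "\<bar>f x\<bar>" "\<bar>g x\<bar>"] by (simp add: abs_mult)
      hence "\<bar>(1 - \<Lambda> + x\<^sup>2) * (2 * f x * g x)\<bar> \<le> C * ((g x)\<^sup>2 + (f x)\<^sup>2)"
        unfolding abs_mult[of "1 - \<Lambda> + x\<^sup>2"] using c by (intro mult_mono) auto
      moreover have "0 \<le> 2 * (\<mu> / x) * (g x)\<^sup>2" using x assms(6) by simp
      ultimately have "- 2 * (\<mu> / x) * (g x)\<^sup>2 + (1 - \<Lambda> + x\<^sup>2) * (2 * f x * g x) - C * ((g x)\<^sup>2 + (f x)\<^sup>2) \<le> 0"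
        by linarith
      thus ?thesis by (simp add: mult_nonpos_nonneg)
    qed
    ultimately show "\<exists>y. (?e has_real_derivative y) (at x) \<and> y \<le> 0" by blast
  next
    have "continuous_on {0..R} f"
      by (intro continuous_at_imp_continuous_on ballI DERIV_isCont[OF df])
    moreover have "continuous_on {0..R} g" by (rule continuous_on_subset[OF cg]) auto
    ultimately show "continuous_on {0..R} ?e" by (intro continuous_intros)
  qed (use assms in auto)
  hence "(g R)\<^sup>2 + (f R)\<^sup>2 \<le> 0" using assms(4,5) by (simp add: mult_le_0_iff)
  thus ?thesis using zero_le_power2[of "g R"] by (simp add: sum_power2_le_zero_iff)
qed

lemma continuous_AE_eq:
  fixes f g :: "real^'d \<Rightarrow> complex"
  assumes "continuous_on UNIV f" "continuous_on UNIV g" "AE x in lborel. f x = g x"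
  shows "f x = g x"
proof -
  have op: "open {x. f x \<noteq> g x}" using assms(1,2) by (rule open_Collect_neq)
  have "{x. f x \<noteq> g x} \<in> null_sets lborel"
    by (subst AE_iff_null_sets) (use op assms(3) in auto)
  hence "negligible {x. f x \<noteq> g x}"
    by (simp add: negligible_iff_null_sets null_sets_completionI)
  hence "{x. f x \<noteq> g x} = {}" using open_not_negligible[OF op] by blast
  thus ?thesis by auto
qed

text \<open>Rotations act transitively on spheres because \<open>d \<ge> 2\<close>, and continuity turns invariance almost
everywhere into invariance everywhere.\<close>

lemma radial_norm_cong:
  fixes f :: "real^'d \<Rightarrow> complex"
  assumes d: "CARD('d) \<ge> 2" and rad: "L2_rad f" and cont: "continuous_on UNIV f" and eq: "norm x = norm y"
  shows "f x = f y"
proof -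
  obtain h where h: "orthogonal_transformation h" "det (matrix h) = 1" "h x = y"
    using rotation_exists[OF d eq] by blast
  have lin: "linear h" using h(1) by (simp add: orthogonal_transformation_def)
  have "orthogonal_matrix (matrix h)" using h(1) orthogonal_transformation_matrix by blast
  hence "rotation_matrix (matrix h)" using h(2) by (simp add: rotation_matrix_def)
  hence "AE x in lborel. f (matrix h *v x) = f x" using rad by (simp add: L2_rad_def)
  moreover have mh: "matrix h *v x = h x" for x using lin by (simp add: matrix_works)
  ultimately have ae: "AE x in lborel. f (h x) = f x" by simp
  have ch: "continuous_on UNIV h" using lin by (simp add: linear_continuous_on linear_conv_bounded_linear)
  have "continuous_on UNIV (\<lambda>x. f (h x))"
    by (rule continuous_on_compose2[OF cont ch]) auto
  from continuous_AE_eq[OF this cont ae] show ?thesis using h(3) by metis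
qed

lemma partial_line_deriv:
  fixes f :: "real^'d \<Rightarrow> complex"
  assumes "f differentiable_on UNIV"
  shows "((\<lambda>t. f (a + t *\<^sub>R axis i 1)) has_vector_derivative partial i f (a + t *\<^sub>R axis i 1)) (at t)"
proof -
  have "f differentiable (at (a + t *\<^sub>R axis i 1))" using assms by (simp add: differentiable_on_def)
  hence D: "(f has_derivative frechet_derivative f (at (a + t *\<^sub>R axis i 1))) (at (a + t *\<^sub>R axis i 1))"
    by (simp add: frechet_derivative_works)
  have L: "((\<lambda>t. a + t *\<^sub>R axis i 1) has_vector_derivative axis i 1) (at t)"
    by (rule derivative_eq_intros refl | simp)+
  from vector_derivative_diff_chain_within[OF L, of f] D show ?thesis
    by (auto simp: o_def partial_def intro: has_derivative_at_withinI)
qed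

context
  fixes f :: "real^'d \<Rightarrow> complex" and k :: 'd
  assumes d: "CARD('d) \<ge> 2" and rad: "L2_rad f" and c2: "C2 f"
begin

lemma radial_continuous: "continuous_on UNIV f"
  using c2 by (auto simp: C2_def intro: differentiable_imp_continuous_on)

lemma radial_line: "f x = f (norm x *\<^sub>R axis k 1)"
  by (rule radial_norm_cong[OF d rad radial_continuous]) (simp add: norm_axis_1)

lemma radial_first_deriv:
  "((\<lambda>r. f (r *\<^sub>R axis k 1)) has_vector_derivative partial k f (r *\<^sub>R axis k 1)) (at r)"
  using partial_line_deriv[of f 0 k r] c2 by (simp add: C2_def)

lemma radial_second_deriv:
  "((\<lambda>r. partial k f (r *\<^sub>R axis k 1)) has_vector_derivative partial k (partial k f) (r *\<^sub>R axis k 1)) (at r)"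
  using partial_line_deriv[of "partial k f" 0 k r] c2 by (simp add: C2_def)

lemma radial_deriv_0: "partial k f 0 = 0"
proof -
  let ?f = "\<lambda>r. f (r *\<^sub>R axis k 1)"
  have 1: "(?f has_vector_derivative partial k f 0) (at 0)" using radial_first_deriv[of 0] by simp
  have "((?f \<circ> uminus) has_vector_derivative (-1) *\<^sub>R partial k f 0) (at 0)"
    by (rule vector_diff_chain_at) (use 1 in \<open>auto intro!: derivative_eq_intros\<close>)
  moreover have "?f \<circ> uminus = ?f"
    by (auto simp: fun_eq_iff intro!: radial_norm_cong[OF d rad radial_continuous])
  ultimately have "(-1) *\<^sub>R partial k f 0 = partial k f 0"
    using 1 vector_derivative_unique_at by metis
  thus ?thesis by simp
qed

text \<open>Restricted to the line through \<open>r e\<^sub>k\<close> in direction \<open>e\<^sub>i\<close>, a radial function is \<open>f(sqrt (r^2 + t^2))\<close>, whose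
second derivative at \<open>t = 0\<close> is \<open>f'(r) / r\<close>. Summed over the \<open>d - 1\<close> directions this is the first-order
term of the radial Laplacian.\<close>

lemma radial_transverse:
  assumes r: "r > 0" and i: "i \<noteq> k"
  shows "partial i (partial i f) (r *\<^sub>R axis k 1) = partial k f (r *\<^sub>R axis k 1) /\<^sub>R r"
proof -
  let ?s = "\<lambda>t. sqrt (r\<^sup>2 + t\<^sup>2)"
  let ?g = "\<lambda>s. partial k f (s *\<^sub>R axis k 1)"
  have sp: "r\<^sup>2 + t\<^sup>2 > 0" for t using r by (intro add_pos_nonneg) auto
  have ds: "(?s has_real_derivative t / ?s t) (at t)" for t
  proof -
    have "((\<lambda>t. r\<^sup>2 + t\<^sup>2) has_real_derivative 2 * t) (at t)"
      by (rule derivative_eq_intros refl | simp)+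
    from DERIV_chain2[OF DERIV_real_sqrt[OF sp[of t]] this] show ?thesis by (simp add: inverse_eq_divide)
  qed
  have nrm: "norm (r *\<^sub>R axis k 1 + t *\<^sub>R axis i 1 :: real^'d) = ?s t" for t
    using i by (simp add: norm_eq_sqrt_inner inner_add_left inner_add_right inner_axis_axis power2_eq_square)
  have h: "f (r *\<^sub>R axis k 1 + t *\<^sub>R axis i 1) = f (?s t *\<^sub>R axis k 1)" for t
    by (subst radial_line) (simp only: nrm)
  have P: "partial i f (r *\<^sub>R axis k 1 + t *\<^sub>R axis i 1) = (t / ?s t) *\<^sub>R ?g (?s t)" for t
  proof -
    have "((\<lambda>t. f (r *\<^sub>R axis k 1 + t *\<^sub>R axis i 1)) has_vector_derivative partial i f (r *\<^sub>R axis k 1 + t *\<^sub>R axis i 1)) (at t)"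
      by (rule partial_line_deriv) (use c2 in \<open>simp add: C2_def\<close>)
    moreover have "((\<lambda>r. f (r *\<^sub>R axis k 1)) \<circ> ?s has_vector_derivative (t / ?s t) *\<^sub>R ?g (?s t)) (at t)"
      by (rule vector_diff_chain_at) (use ds radial_first_deriv in \<open>auto simp: has_real_derivative_iff_has_vector_derivative\<close>)
    ultimately show ?thesis unfolding h o_def by (rule vector_derivative_unique_at)
  qed
  have "((\<lambda>t. partial i f (r *\<^sub>R axis k 1 + t *\<^sub>R axis i 1)) has_vector_derivative partial i (partial i f) (r *\<^sub>R axis k 1 + 0 *\<^sub>R axis i 1)) (at 0)"
    by (rule partial_line_deriv) (use c2 in \<open>simp add: C2_def\<close>)
  moreover have "((\<lambda>t. (t / ?s t) *\<^sub>R ?g (?s t)) has_vector_derivative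
      (0 / ?s 0) *\<^sub>R ((0 / ?s 0) *\<^sub>R partial k (partial k f) (?s 0 *\<^sub>R axis k 1)) + (1 / r) *\<^sub>R ?g (?s 0)) (at 0)"
  proof (rule has_vector_derivative_scaleR)
    have "((\<lambda>t. t / ?s t) has_real_derivative (1 * ?s 0 - 0 * (0 / ?s 0)) / (?s 0 * ?s 0)) (at 0)"
      by (rule DERIV_divide[OF DERIV_ident ds]) (use r in simp)
    thus "((\<lambda>t. t / ?s t) has_real_derivative 1 / r) (at 0)" using r by simp
    have "(?g \<circ> ?s has_vector_derivative (0 / ?s 0) *\<^sub>R partial k (partial k f) (?s 0 *\<^sub>R axis k 1)) (at 0)"
      by (rule vector_diff_chain_at)
         (use ds[of 0] radial_second_deriv in \<open>simp_all only: has_real_derivative_iff_has_vector_derivative\<close>)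
    thus "((\<lambda>t. ?g (?s t)) has_vector_derivative (0 / ?s 0) *\<^sub>R partial k (partial k f) (?s 0 *\<^sub>R axis k 1)) (at 0)"
      by (simp add: o_def)
  qed
  ultimately have "partial i (partial i f) (r *\<^sub>R axis k 1 + 0 *\<^sub>R axis i 1) =
      (0 / ?s 0) *\<^sub>R ((0 / ?s 0) *\<^sub>R partial k (partial k f) (?s 0 *\<^sub>R axis k 1)) + (1 / r) *\<^sub>R ?g (?s 0)"
    unfolding P by (rule vector_derivative_unique_at)
  thus ?thesis using r by (simp add: inverse_eq_divide)
qed

lemma radial_ode:
  assumes eig: "\<And>x. harmonic_oscillator f x = of_real \<Lambda> * f x" and r: "r > 0"
  shows "((\<lambda>r. partial k f (r *\<^sub>R axis k 1)) has_vector_derivative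
      - ((real CARD('d) - 1) / r) *\<^sub>R partial k f (r *\<^sub>R axis k 1) - (\<Lambda> - r\<^sup>2) *\<^sub>R f (r *\<^sub>R axis k 1)) (at r)"
proof -
  let ?x = "r *\<^sub>R axis k 1 :: real^'d"
  have "laplacian f ?x = partial k (partial k f) ?x + (\<Sum>i\<in>UNIV - {k}. partial i (partial i f) ?x)"
    unfolding laplacian_def by (simp add: sum.remove[of UNIV k])
  also have "(\<Sum>i\<in>UNIV - {k}. partial i (partial i f) ?x) = (\<Sum>i\<in>UNIV - {k}. partial k f ?x /\<^sub>R r)"
    by (rule sum.cong) (use radial_transverse[OF r] in auto)
  also have "\<dots> = ((real CARD('d) - 1) / r) *\<^sub>R partial k f ?x"
    by (simp add: card_Diff_singleton scaleR_conv_of_real inverse_eq_divide of_nat_diff)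
  finally have lap: "laplacian f ?x = partial k (partial k f) ?x + ((real CARD('d) - 1) / r) *\<^sub>R partial k f ?x" .
  have "norm ?x = r" using r by (simp add: norm_axis_1)
  hence "- laplacian f ?x + of_real (r\<^sup>2) * f ?x = of_real \<Lambda> * f ?x"
    using eig[of ?x] by (simp add: harmonic_oscillator_def)
  hence "partial k (partial k f) ?x = - ((real CARD('d) - 1) / r) *\<^sub>R partial k f ?x - (\<Lambda> - r\<^sup>2) *\<^sub>R f ?x"
    unfolding lap by (simp add: scaleR_conv_of_real algebra_simps)
  thus ?thesis using radial_second_deriv[of r] by simp
qed

text \<open>Applied to the real and to the imaginary part; the difference between the function and its candidate
solves the radial equation with zero data at the origin.\<close>

lemma radial_eigenfunction_component:
  assumes eig: "\<And>x. harmonic_oscillator f x = of_real (4 * real n + real CARD('d)) * f x"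
    and h: "bounded_linear (h :: complex \<Rightarrow> real)" and R: "R \<ge> 0"
  shows "h (f (R *\<^sub>R axis k 1)) = h (f 0) * profile (real CARD('d) / 2) n R"
proof -
  interpret h: bounded_linear h by (rule h)
  let ?a = "real CARD('d) / 2"
  let ?F = "\<lambda>r. h (f (r *\<^sub>R axis k 1)) - h (f 0) * profile ?a n r"
  let ?G = "\<lambda>r. h (partial k f (r *\<^sub>R axis k 1)) - h (f 0) * profile' ?a n r"
  have "?F R = 0"
  proof (rule radial_ode_zero[where f = ?F and g = ?G and \<mu> = "real CARD('d) - 1" and \<Lambda> = "4 * real n + real CARD('d)"])
    fix r
    have "((\<lambda>r. h (f (r *\<^sub>R axis k 1))) has_vector_derivative h (partial k f (r *\<^sub>R axis k 1))) (at r)"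
      by (rule h.has_vector_derivative[OF radial_first_deriv])
    hence "((\<lambda>r. h (f (r *\<^sub>R axis k 1))) has_real_derivative h (partial k f (r *\<^sub>R axis k 1))) (at r)"
      by (simp add: has_real_derivative_iff_has_vector_derivative)
    thus "(?F has_real_derivative ?G r) (at r)"
      by (intro DERIV_diff DERIV_cmult profile_deriv)
  next
    fix r :: real assume r: "r > 0"
    let ?D = "- ((real CARD('d) - 1) / r) *\<^sub>R partial k f (r *\<^sub>R axis k 1) - (4 * real n + real CARD('d) - r\<^sup>2) *\<^sub>R f (r *\<^sub>R axis k 1)"
    have "((\<lambda>r. h (partial k f (r *\<^sub>R axis k 1))) has_vector_derivative h ?D) (at r)"
      by (rule h.has_vector_derivative[OF radial_ode[OF eig r]])
    hence 1: "((\<lambda>r. h (partial k f (r *\<^sub>R axis k 1))) has_real_derivative h ?D) (at r)"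
      by (simp add: has_real_derivative_iff_has_vector_derivative)
    have 2: "(profile' ?a n has_real_derivative - ((2 * ?a - 1) / r) * profile' ?a n r - (4 * real n + 2 * ?a - r\<^sup>2) * profile ?a n r) (at r)"
      by (rule profile'_deriv) (use r in auto)
    have "(?G has_real_derivative h ?D - h (f 0) * (- ((2 * ?a - 1) / r) * profile' ?a n r - (4 * real n + 2 * ?a - r\<^sup>2) * profile ?a n r)) (at r)"
      by (intro DERIV_diff DERIV_cmult 1 2)
    moreover have "h ?D = - ((real CARD('d) - 1) / r) * h (partial k f (r *\<^sub>R axis k 1)) - (4 * real n + real CARD('d) - r\<^sup>2) * h (f (r *\<^sub>R axis k 1))"
      by (simp only: h.diff h.scaleR real_scaleR_def)
    moreover have "(- c * P - L * F) - h0 * (- c * p' - L * p) = - c * (P - h0 * p') - L * (F - h0 * p)"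
      for c P L F h0 p' p :: real by (simp add: algebra_simps)
    moreover have "2 * ?a = real CARD('d)" by simp
    ultimately show "(?G has_real_derivative - ((real CARD('d) - 1) / r) * ?G r - (4 * real n + real CARD('d) - r\<^sup>2) * ?F r) (at r)"
      by (simp only:)
  next
    have "continuous_on UNIV (\<lambda>r. partial k f (r *\<^sub>R axis k 1))"
      by (intro continuous_at_imp_continuous_on ballI has_vector_derivative_continuous[OF radial_second_deriv])
    hence "continuous_on UNIV (\<lambda>r. h (partial k f (r *\<^sub>R axis k 1)))" by (rule h.continuous_on)
    hence "continuous_on {0..} (\<lambda>r. h (partial k f (r *\<^sub>R axis k 1)))" by (rule continuous_on_subset) auto
    moreover have "continuous_on {0..} (profile' ?a n)"
      unfolding profile'_def[abs_def] by (intro continuous_intros) auto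
    ultimately show "continuous_on {0..} ?G" by (intro continuous_intros)
  qed (use R d in \<open>auto simp: radial_deriv_0 h.zero\<close>)
  thus ?thesis by simp
qed

lemma radial_eigenfunction_eq_profile:
  assumes eig: "\<And>x. harmonic_oscillator f x = of_nat (4 * n + CARD('d)) * f x"
  shows "f x = f 0 * of_real (profile (real CARD('d) / 2) n (norm x))"
proof -
  have e: "\<And>x. harmonic_oscillator f x = of_real (4 * real n + real CARD('d)) * f x"
    using eig by simp
  have "f x = f (norm x *\<^sub>R axis k 1)" by (rule radial_line)
  also have "\<dots> = f 0 * of_real (profile (real CARD('d) / 2) n (norm x))"
    using radial_eigenfunction_component[OF e bounded_linear_Re, of "norm x"]
      radial_eigenfunction_component[OF e bounded_linear_Im, of "norm x"]
    by (simp add: complex_eq_iff)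
  finally show ?thesis .
qed

end


section \<open>Radial integrals and Gaussian moments\<close>

text \<open>Polar coordinates in the variable \<open>y = |x|^2\<close>: the image of Lebesgue measure has this density because
the two measures agree on half-lines, by the volume of balls. Using \<open>|x|^2\<close> instead of \<open>|x|\<close>
turns the constant into \<open>\<pi>^a / \<Gamma>(a)\<close>.\<close>

lemma nn_integral_norm_sq:
  fixes h :: "real \<Rightarrow> ennreal"
  assumes [measurable]: "h \<in> borel_measurable borel"
  defines "a \<equiv> real DIM('a::euclidean_space) / 2"
  shows "(\<integral>\<^sup>+(x::'a). h ((norm x)\<^sup>2) \<partial>lborel)
     = (\<integral>\<^sup>+y. ennreal (indicator {0..} y * (pi powr a / Gamma a * y powr (a - 1))) * h y \<partial>lborel)"
proof -
  define c where "c = pi powr a / Gamma a"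
  have a: "a > 0" using DIM_positive[where 'a = 'a] by (simp add: a_def)
  have c: "c \<ge> 0" using a Gamma_real_pos[OF a] by (simp add: c_def)
  let ?\<rho> = "\<lambda>y. ennreal (indicator {0..} y * (c * y powr (a - 1)))"
  let ?M = "distr (lborel :: 'a measure) borel (\<lambda>x. (norm x)\<^sup>2)" and ?N = "density lborel ?\<rho>"
  have M: "emeasure ?M {..y} = ennreal (c / a * max 0 y powr a)" for y
  proof -
    have "emeasure ?M {..y} = emeasure (lborel :: 'a measure) {x. (norm x)\<^sup>2 \<le> y}"
      by (subst emeasure_distr) (auto intro!: arg_cong2[where f = emeasure])
    also have "\<dots> = ennreal (c / a * max 0 y powr a)"
    proof (cases "y < 0")
      case True
      hence "{x :: 'a. (norm x)\<^sup>2 \<le> y} = {}" by (auto simp: not_le intro: less_le_trans)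
      thus ?thesis using True a by simp
    next
      case False
      hence y: "y \<ge> 0" by simp
      have "{x :: 'a. (norm x)\<^sup>2 \<le> y} = cball 0 (sqrt y)"
      proof -
        have "(norm x)\<^sup>2 \<le> y \<longleftrightarrow> norm x \<le> sqrt y" for x :: 'a
          by (metis abs_norm_cancel real_sqrt_abs real_sqrt_le_iff)
        hence "{x :: 'a. (norm x)\<^sup>2 \<le> y} = {x. norm x \<le> sqrt y}" by (simp only:)
        thus ?thesis by (simp add: cball_def)
      qed
      moreover have "emeasure lborel (cball (0 :: 'a) (sqrt y)) = ennreal (unit_ball_vol (DIM('a)) * sqrt y ^ DIM('a))"
        by (rule emeasure_cball) (use y in simp)
      moreover have "unit_ball_vol (DIM('a)) = c / a"
        using a Gamma_plus1[of a] by (simp add: unit_ball_vol_def c_def a_def[symmetric] nonpos_Ints_def)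
      moreover have "sqrt y ^ DIM('a) = y powr a"
        using y a by (cases "y = 0") (auto simp: powr_realpow[symmetric] powr_half_sqrt[symmetric] powr_powr a_def)
      ultimately show ?thesis using y by (simp add: max_def)
    qed
    finally show ?thesis .
  qed
  have N: "emeasure ?N {..y} = ennreal (c / a * max 0 y powr a)" for y
  proof -
    have "emeasure ?N {..y} = (\<integral>\<^sup>+x. ?\<rho> x * indicator {..y} x \<partial>lborel)"
      by (rule emeasure_density) auto
    also have "\<dots> = (\<integral>\<^sup>+x. ennreal (indicator {0..max 0 y} x * (c * x powr (a - 1))) \<partial>lborel)"
      by (intro nn_integral_cong) (use a in \<open>auto simp: indicator_def not_le max_def split: if_splits\<close>)
    also have "\<dots> = ennreal (c * (max 0 y powr (a - 1 + 1) / (a - 1 + 1)))"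
    proof (rule nn_integral_has_integral_lebesgue)
      show "((\<lambda>x. c * x powr (a - 1)) has_integral c * (max 0 y powr (a - 1 + 1) / (a - 1 + 1))) {0..max 0 y}"
        by (intro has_integral_mult_right has_integral_powr_from_0) (use a in auto)
    qed (use c in auto)
    finally show ?thesis by simp
  qed
  have "?M = ?N"
  proof (rule measure_eqI_generator_eq[where E = "range (\<lambda>a::real. {..a})" and \<Omega> = UNIV and A = "\<lambda>n::nat. {..real n}"])
    show "Int_stable (range (\<lambda>a::real. {..a}))"
      by (auto simp: Int_stable_def intro!: exI[of _ "min _ _"])
    show "sets ?M = sigma_sets UNIV (range (\<lambda>a::real. {..a}))"
      "sets ?N = sigma_sets UNIV (range (\<lambda>a::real. {..a}))"
      by (simp_all add: borel_eq_atMost)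
    show "(\<Union>i. {..real i}) = UNIV" by (auto intro: real_arch_simple)
  qed (auto simp: M N)
  hence "integral\<^sup>N ?M h = integral\<^sup>N ?N h" by simp
  thus ?thesis by (simp add: nn_integral_distr nn_integral_density c_def)
qed

lemma nn_integral_powr_exp:
  assumes b: "b > 0" and s: "s > 0"
  shows "(\<integral>\<^sup>+y. ennreal (indicator {0..} y * (y powr (b - 1) * exp (- s * y))) \<partial>lborel) = ennreal (Gamma b * s powr (- b))"
proof -
  let ?f = "\<lambda>t. ennreal (indicator {0..} t * t powr (b - 1) / exp t)"
  have "ennreal (Gamma b) = (\<integral>\<^sup>+t. ?f t \<partial>lborel)"
    using Gamma_conv_nn_integral_real[OF b] by simp
  also have "\<dots> = ennreal \<bar>s\<bar> * (\<integral>\<^sup>+y. ?f (0 + s * y) \<partial>lborel)"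
    by (rule nn_integral_real_affine) (use s in auto)
  also have "(\<integral>\<^sup>+y. ?f (0 + s * y) \<partial>lborel) =
     (\<integral>\<^sup>+y. ennreal (s powr (b - 1)) * ennreal (indicator {0..} y * (y powr (b - 1) * exp (- s * y))) \<partial>lborel)"
  proof (intro nn_integral_cong)
    fix y
    show "?f (0 + s * y) = ennreal (s powr (b - 1)) * ennreal (indicator {0..} y * (y powr (b - 1) * exp (- s * y)))"
      using s by (auto simp: indicator_def zero_le_mult_iff powr_mult exp_minus divide_inverse mult.assoc ennreal_mult[symmetric])
  qed
  also have "\<dots> = ennreal (s powr (b - 1)) * (\<integral>\<^sup>+y. ennreal (indicator {0..} y * (y powr (b - 1) * exp (- s * y))) \<partial>lborel)"
    by (rule nn_integral_cmult) simp
  finally have "ennreal (Gamma b) = ennreal (s powr b) * (\<integral>\<^sup>+y. ennreal (indicator {0..} y * (y powr (b - 1) * exp (- s * y))) \<partial>lborel)"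
    (is "_ = _ * ?I") using s by (simp add: mult.assoc[symmetric] ennreal_mult[symmetric] powr_diff)
  hence "ennreal (s powr (- b)) * ennreal (Gamma b) = (ennreal (s powr (- b)) * ennreal (s powr b)) * ?I"
    by (simp add: mult.assoc)
  also have "ennreal (s powr (- b)) * ennreal (s powr b) = 1"
    using s by (simp add: ennreal_mult[symmetric] powr_add[symmetric])
  finally show ?thesis using b by (simp add: ennreal_mult'[symmetric] Gamma_real_pos mult.commute less_imp_le)
qed

lemma gaussian_moment:
  fixes s :: real and k :: nat
  assumes s: "s > 0"
  defines "a \<equiv> real DIM('a::euclidean_space) / 2"
  shows "integrable lborel (\<lambda>x::'a. (norm x) ^ (2 * k) * exp (- s * (norm x)\<^sup>2))"
    and "(\<integral>(x::'a). (norm x) ^ (2 * k) * exp (- s * (norm x)\<^sup>2) \<partial>lborel) = pi powr a * pochhammer a k * s powr (- a - k)"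
proof -
  have a: "a > 0" using DIM_positive[where 'a = 'a] by (simp add: a_def)
  have G: "Gamma a > 0" using a by (rule Gamma_real_pos)
  have "(\<integral>\<^sup>+(x::'a). ennreal ((norm x) ^ (2 * k) * exp (- s * (norm x)\<^sup>2)) \<partial>lborel)
     = (\<integral>\<^sup>+(x::'a). (\<lambda>y. ennreal (y ^ k * exp (- s * y))) ((norm x)\<^sup>2) \<partial>lborel)"
    by (simp add: power_mult)
  also have "\<dots> = (\<integral>\<^sup>+y. ennreal (indicator {0..} y * (pi powr a / Gamma a * y powr (a - 1))) * ennreal (y ^ k * exp (- s * y)) \<partial>lborel)"
    unfolding a_def by (rule nn_integral_norm_sq) measurable
  also have "\<dots> = (\<integral>\<^sup>+y. ennreal (pi powr a / Gamma a) * ennreal (indicator {0..} y * (y powr (a + k - 1) * exp (- s * y))) \<partial>lborel)"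
  proof (rule nn_integral_cong_AE)
    have "AE y in lborel. y \<noteq> (0::real)" by (rule AE_lborel_singleton)
    thus "AE y in lborel. ennreal (indicator {0..} y * (pi powr a / Gamma a * y powr (a - 1))) * ennreal (y ^ k * exp (- s * y))
       = ennreal (pi powr a / Gamma a) * ennreal (indicator {0..} y * (y powr (a + k - 1) * exp (- s * y)))"
    proof eventually_elim
      case (elim y)
      show ?case
      proof (cases "y > 0")
        case True
        have "y powr (a + k - 1) = y powr (a - 1) * y ^ k"
          using True by (simp add: powr_realpow[symmetric] powr_add[symmetric] algebra_simps)
        thus ?thesis using True G by (simp add: ennreal_mult[symmetric] mult_ac)
      qed (use elim in simp)
    qed
  qed
  also have "\<dots> = ennreal (pi powr a / Gamma a) * (\<integral>\<^sup>+y. ennreal (indicator {0..} y * (y powr (a + k - 1) * exp (- s * y))) \<partial>lborel)"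
    by (rule nn_integral_cmult) simp
  also have "\<dots> = ennreal (pi powr a / Gamma a) * ennreal (Gamma (a + k) * s powr (- (a + k)))"
    by (subst nn_integral_powr_exp) (use a s in auto)
  also have "\<dots> = ennreal (pi powr a * pochhammer a k * s powr (- a - k))"
  proof -
    have "pochhammer a k = Gamma (a + k) / Gamma a"
      by (rule pochhammer_Gamma) (use a in \<open>auto simp: nonpos_Ints_def\<close>)
    moreover have "Gamma (a + k) > 0" using a by (intro Gamma_real_pos) auto
    ultimately show ?thesis using G by (simp add: ennreal_mult[symmetric] algebra_simps)
  qed
  finally have "(\<integral>\<^sup>+(x::'a). ennreal ((norm x) ^ (2 * k) * exp (- s * (norm x)\<^sup>2)) \<partial>lborel)
     = ennreal (pi powr a * pochhammer a k * s powr (- a - k))" .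
  moreover have "pochhammer a k > 0" using a by (rule pochhammer_pos)
  ultimately show "integrable lborel (\<lambda>x::'a. (norm x) ^ (2 * k) * exp (- s * (norm x)\<^sup>2))"
    and "(\<integral>(x::'a). (norm x) ^ (2 * k) * exp (- s * (norm x)\<^sup>2) \<partial>lborel) = pi powr a * pochhammer a k * s powr (- a - k)"
    by (subst (asm) nn_integral_eq_integrable; simp)+
qed

text \<open>Integrating the profile term by term, the Pochhammer symbols of the Gaussian moments cancel those in
the coefficients, and the binomial theorem sums what is left.\<close>

lemma integral_gaussian_profile:
  fixes t :: real
  assumes t: "t > - (1 / 2)"
  defines "a \<equiv> real DIM('a::euclidean_space) / 2" and "s \<equiv> t + 1 / 2"
  shows "(\<integral>(x::'a). exp (- t * (norm x)\<^sup>2) * profile a n (norm x) \<partial>lborel) = pi powr a * s powr (- a) * (1 - 1 / s) ^ n"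
proof -
  have s: "s > 0" using t by (simp add: s_def)
  have a: "a > 0" using DIM_positive[where 'a = 'a] by (simp add: a_def)
  let ?m = "\<lambda>k x. (norm (x::'a)) ^ (2 * k) * exp (- s * (norm x)\<^sup>2)"
  have eq: "exp (- t * (norm x)\<^sup>2) * profile a n (norm x) = (\<Sum>k\<le>n. ((-1) ^ k * real (n choose k) / pochhammer a k) * ?m k x)" for x :: 'a
  proof -
    have "exp (- t * (norm x)\<^sup>2) * exp (- (norm x)\<^sup>2 / 2) = exp (- s * (norm x)\<^sup>2)"
      by (simp add: s_def exp_add[symmetric] algebra_simps)
    hence e: "exp (- (norm x)\<^sup>2 / 2) * exp (- t * (norm x)\<^sup>2) = exp (- s * (norm x)\<^sup>2)" by (simp only: mult.commute)
    have "exp (- t * (norm x)\<^sup>2) * profile a n (norm x)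
      = poly (kummer a n) ((norm x)\<^sup>2) * (exp (- (norm x)\<^sup>2 / 2) * exp (- t * (norm x)\<^sup>2))"
      by (simp add: profile_def)
    also have "\<dots> = (\<Sum>k\<le>n. ((-1) ^ k * real (n choose k) / pochhammer a k) * ?m k x)"
      unfolding e by (simp add: kummer_def poly_sum poly_monom sum_distrib_right power_mult mult.assoc)
    finally show ?thesis .
  qed
  have "(\<integral>(x::'a). exp (- t * (norm x)\<^sup>2) * profile a n (norm x) \<partial>lborel)
     = (\<Sum>k\<le>n. \<integral>x. ((-1) ^ k * real (n choose k) / pochhammer a k) * ?m k x \<partial>lborel)"
    unfolding eq by (intro Bochner_Integration.integral_sum integrable_mult_right gaussian_moment(1) s)
  also have "\<dots> = (\<Sum>k\<le>n. ((-1) ^ k * real (n choose k) / pochhammer a k) * (pi powr a * pochhammer a k * s powr (- a - k)))"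
  proof (rule sum.cong)
    fix k
    show "(\<integral>x. ((-1) ^ k * real (n choose k) / pochhammer a k) * ?m k x \<partial>lborel)
       = ((-1) ^ k * real (n choose k) / pochhammer a k) * (pi powr a * pochhammer a k * s powr (- a - k))"
      unfolding gaussian_moment(2)[OF s, where 'a = 'a, of k, folded a_def, symmetric] by simp
  qed simp
  also have "\<dots> = (\<Sum>k\<le>n. pi powr a * s powr (- a) * (real (n choose k) * (- 1 / s) ^ k * 1 ^ (n - k)))"
  proof (rule sum.cong)
    fix k
    have p: "pochhammer a k \<noteq> 0" using pochhammer_pos[OF a, of k] by simp
    have "s powr (- a - k) = s powr (- a) * (1 / s) ^ k"
      using s by (simp add: powr_diff powr_realpow power_one_over)
    moreover have "(- 1 / s) ^ k = (-1) ^ k * (1 / s) ^ k" by (metis mult_minus1 power_mult_distrib minus_divide_left)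
    ultimately show "((-1) ^ k * real (n choose k) / pochhammer a k) * (pi powr a * pochhammer a k * s powr (- a - k))
       = pi powr a * s powr (- a) * (real (n choose k) * (- 1 / s) ^ k * 1 ^ (n - k))"
      using p by simp
  qed simp
  also have "\<dots> = pi powr a * s powr (- a) * (\<Sum>k\<le>n. real (n choose k) * (- 1 / s) ^ k * 1 ^ (n - k))"
    by (simp only: sum_distrib_left)
  also have "(\<Sum>k\<le>n. real (n choose k) * (- 1 / s) ^ k * 1 ^ (n - k)) = (- 1 / s + 1) ^ n"
    by (rule binomial_ring[symmetric])
  finally show "(\<integral>(x::'a). exp (- t * (norm x)\<^sup>2) * profile a n (norm x) \<partial>lborel) = pi powr a * s powr (- a) * (1 - 1 / s) ^ n"
    by simp
qed

text \<open>Euler's limit for the Gamma function says that the ratio of the two sides tends to \<open>\<Gamma>(a)\<close>, a positive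
number; so the ratio and its inverse are bounded.\<close>

lemma pochhammer_fact_bounds:
  assumes a: "a > (0::real)"
  shows "\<exists>C>0. \<forall>n\<ge>1. pochhammer a n / fact n \<le> C * real n powr (a - 1) \<and>
            real n powr (a - 1) \<le> C * (pochhammer a n / fact n)"
proof -
  define g where "g n = Gamma_series' a n" for n
  have G: "Gamma a > 0" using a by (rule Gamma_real_pos)
  have g: "g \<longlonglongrightarrow> Gamma a" unfolding g_def by (rule Gamma_series'_LIMSEQ)
  have ig: "(\<lambda>n. inverse (g n)) \<longlonglongrightarrow> inverse (Gamma a)"
    using g G by (intro tendsto_inverse) auto
  obtain A where A: "A > 0" "\<And>n. norm (g n) \<le> A" using convergent_imp_Bseq[of g] g by (auto simp: convergent_def Bseq_def)
  obtain B where B: "B > 0" "\<And>n. norm (inverse (g n)) \<le> B"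
    using convergent_imp_Bseq[of "\<lambda>n. inverse (g n)"] ig by (auto simp: convergent_def Bseq_def)
  have eq: "g n = real n powr (a - 1) / (pochhammer a n / fact n)" if "n \<ge> 1" for n
  proof -
    have "exp (a * ln (real n)) = real n powr a" using that by (simp add: powr_def)
    hence "g n = fact (n - 1) * real n powr a / pochhammer a n" by (simp add: g_def Gamma_series'_def)
    moreover have "fact n = real n * fact (n - 1)" using that by (simp add: fact_reduce)
    moreover have "real n powr a = real n powr (a - 1) * real n" using that by (simp add: powr_diff)
    ultimately show ?thesis by simp
  qed
  show ?thesis
  proof (intro exI[of _ "max A B"] conjI allI impI)
    fix n :: nat assume n: "n \<ge> 1"
    let ?p = "pochhammer a n / fact n" and ?x = "real n powr (a - 1)"
    have p: "?p > 0" using pochhammer_pos[OF a, of n] by simp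
    have x: "?x > 0" using n by simp
    have "?x / ?p \<le> A" "?p / ?x \<le> B" using A(2)[of n] B(2)[of n] p x unfolding eq[OF n] by (simp_all only: real_norm_def abs_of_pos zero_less_divide_iff inverse_divide divide_pos_pos)
    hence "?x \<le> A * ?p" "?p \<le> B * ?x" using p x by (simp_all only: pos_divide_le_eq)
    moreover have "A * ?p \<le> max A B * ?p" "B * ?x \<le> max A B * ?x" using p x by (intro mult_right_mono; simp)+
    ultimately show "?p \<le> max A B * ?x" "?x \<le> max A B * ?p" by linarith+
  qed (use A in auto)
qed


section \<open>Parseval's identity and the value at the origin\<close>

lemma in_Lp2_iff: "in_Lp 2 u \<longleftrightarrow> u \<in> borel_measurable lborel \<and> integrable lborel (\<lambda>x. (norm (u x))\<^sup>2)"
  by (simp add: in_Lp_def)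

lemma integrable_mult_cnj:
  assumes "in_Lp 2 u" "in_Lp 2 v"
  shows "integrable lborel (\<lambda>x. u x * cnj (v x))"
proof (rule Bochner_Integration.integrable_bound)
  show "integrable lborel (\<lambda>x. (norm (u x))\<^sup>2 + (norm (v x))\<^sup>2)"
    using assms by (simp add: in_Lp2_iff)
  have m: "u \<in> borel_measurable borel" "v \<in> borel_measurable borel" using assms by (simp_all add: in_Lp2_iff)
  have "(\<lambda>x. cnj (v x)) \<in> borel_measurable borel"
    by (rule borel_measurable_continuous_on[OF _ m(2)]) (intro continuous_intros)
  thus "(\<lambda>x. u x * cnj (v x)) \<in> borel_measurable lborel" using m by simp
  show "AE x in lborel. norm (u x * cnj (v x)) \<le> norm ((norm (u x))\<^sup>2 + (norm (v x))\<^sup>2)"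
  proof (intro AE_I2)
    fix x
    have "norm (u x) * norm (v x) \<le> (norm (u x))\<^sup>2 + (norm (v x))\<^sup>2"
    proof -
      have "2 * norm (u x) * norm (v x) \<le> (norm (u x))\<^sup>2 + (norm (v x))\<^sup>2" by (rule sum_squares_bound)
      moreover have "0 \<le> norm (u x) * norm (v x)" by simp
      ultimately show ?thesis unfolding mult.assoc by linarith
    qed
    thus "norm (u x * cnj (v x)) \<le> norm ((norm (u x))\<^sup>2 + (norm (v x))\<^sup>2)" by (simp add: norm_mult)
  qed
qed

lemma in_Lp2_add_mult:
  assumes "in_Lp 2 u" "in_Lp 2 v"
  shows "in_Lp 2 (\<lambda>x. u x + a * v x)"
proof -
  have m: "u \<in> borel_measurable borel" "v \<in> borel_measurable borel" using assms by (simp_all add: in_Lp2_iff)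
  have "integrable lborel (\<lambda>x. 2 * ((norm (u x))\<^sup>2 + (norm a)\<^sup>2 * (norm (v x))\<^sup>2))"
    using assms by (simp add: in_Lp2_iff)
  hence "integrable lborel (\<lambda>x. (norm (u x + a * v x))\<^sup>2)"
  proof (rule Bochner_Integration.integrable_bound)
    show "AE x in lborel. norm ((norm (u x + a * v x))\<^sup>2) \<le> norm (2 * ((norm (u x))\<^sup>2 + (norm a)\<^sup>2 * (norm (v x))\<^sup>2))"
    proof (intro AE_I2)
      fix x
      have "(norm (u x + a * v x))\<^sup>2 \<le> (norm (u x) + norm (a * v x))\<^sup>2" by (intro power_mono norm_triangle_ineq) auto
      also have "\<dots> \<le> 2 * ((norm (u x))\<^sup>2 + (norm (a * v x))\<^sup>2)"
        using sum_squares_bound[of "norm (u x)" "norm (a * v x)"] by (simp add: power2_sum)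
      finally show "norm ((norm (u x + a * v x))\<^sup>2) \<le> norm (2 * ((norm (u x))\<^sup>2 + (norm a)\<^sup>2 * (norm (v x))\<^sup>2))"
        by (simp add: norm_mult power_mult_distrib)
    qed
  qed (use m in simp)
  thus ?thesis using m by (simp add: in_Lp2_iff)
qed

lemma in_Lp2_diff_sum:
  assumes "in_Lp 2 f" "\<And>n. in_Lp 2 (v n)"
  shows "in_Lp 2 (\<lambda>x. f x - (\<Sum>n\<le>(N::nat). a n * v n x))"
proof (induction N)
  case 0
  then show ?case using in_Lp2_add_mult[OF assms, of "- a 0" 0] by simp
next
  case (Suc N)
  then show ?case using in_Lp2_add_mult[OF Suc assms(2), of "- a (Suc N)" "Suc N"] by (simp add: algebra_simps)
qed

lemma L2_inner_cnj: "L2_inner g f = cnj (L2_inner f g)"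
  unfolding L2_inner_def by (subst Bochner_Integration.integral_cnj[symmetric]) (simp add: mult.commute)

lemma L2_inner_diff_sum_left:
  assumes "in_Lp 2 f" "\<And>n. in_Lp 2 (v n)" "in_Lp 2 g"
  shows "L2_inner (\<lambda>x. f x - (\<Sum>n\<le>(N::nat). a n * v n x)) g = L2_inner f g - (\<Sum>n\<le>N. a n * L2_inner (v n) g)"
proof -
  have i: "integrable lborel (\<lambda>x. a n * (v n x * cnj (g x)))" for n
    by (intro integrable_mult_right integrable_mult_cnj assms)
  have "L2_inner (\<lambda>x. f x - (\<Sum>n\<le>N. a n * v n x)) g = (\<integral>x. f x * cnj (g x) - (\<Sum>n\<le>N. a n * (v n x * cnj (g x))) \<partial>lborel)"
    unfolding L2_inner_def by (simp add: left_diff_distrib sum_distrib_right mult.assoc)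
  also have "\<dots> = L2_inner f g - (\<integral>x. (\<Sum>n\<le>N. a n * (v n x * cnj (g x))) \<partial>lborel)"
    unfolding L2_inner_def
    by (intro Bochner_Integration.integral_diff integrable_mult_cnj assms Bochner_Integration.integrable_sum i)
  also have "(\<integral>x. (\<Sum>n\<le>N. a n * (v n x * cnj (g x))) \<partial>lborel) = (\<Sum>n\<le>N. \<integral>x. a n * (v n x * cnj (g x)) \<partial>lborel)"
    by (intro Bochner_Integration.integral_sum i)
  also have "\<dots> = (\<Sum>n\<le>N. a n * L2_inner (v n) g)" unfolding L2_inner_def by simp
  finally show ?thesis .
qed

lemma L2_inner_self: "L2_inner g g = of_real (\<integral>x. (norm (g x))\<^sup>2 \<partial>lborel)"
proof -
  have "L2_inner g g = (\<integral>x. of_real ((norm (g x))\<^sup>2) \<partial>lborel)"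
    unfolding L2_inner_def by (simp only: complex_norm_square)
  also have "\<dots> = of_real (\<integral>x. (norm (g x))\<^sup>2 \<partial>lborel)" by (rule integral_complex_of_real)
  finally show ?thesis .
qed

text \<open>The remainder of an orthonormal expansion is orthogonal to the terms already taken, so its squared
norm is the defect in Parseval's identity; completeness sends it to zero.\<close>

lemma radial_parseval:
  assumes B: "radial_eigenbasis \<psi>" and f: "L2_rad f"
  shows "(\<lambda>n. (norm (L2_inner f (\<psi> n)))\<^sup>2) sums (\<integral>x. (norm (f x))\<^sup>2 \<partial>lborel)"
proof -
  have psi: "in_Lp 2 (\<psi> n)" for n using B by (simp add: radial_eigenbasis_def L2_rad_def)
  have on: "L2_inner (\<psi> m) (\<psi> n) = (if m = n then 1 else 0)" for m n using B by (simp add: radial_eigenbasis_def)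
  have f2: "in_Lp 2 f" using f by (simp add: L2_rad_def)
  define a where "a n = L2_inner f (\<psi> n)" for n
  define g where "g N x = f x - (\<Sum>n\<le>N. a n * \<psi> n x)" for N :: nat and x
  have g2: "in_Lp 2 (g N)" for N unfolding g_def by (rule in_Lp2_diff_sum[OF f2 psi])
  have "(\<lambda>N. Lp_norm 2 (\<lambda>x. (\<Sum>n\<le>N. L2_inner f (\<psi> n) * \<psi> n x) - f x)) \<longlonglongrightarrow> 0"
    using B f by (simp add: radial_eigenbasis_def Lp_tendsto_def)
  hence "(\<lambda>N. (Lp_norm 2 (\<lambda>x. (\<Sum>n\<le>N. L2_inner f (\<psi> n) * \<psi> n x) - f x))\<^sup>2) \<longlonglongrightarrow> 0\<^sup>2"
    by (intro tendsto_power)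
  moreover have "(Lp_norm 2 (\<lambda>x. (\<Sum>n\<le>N. L2_inner f (\<psi> n) * \<psi> n x) - f x))\<^sup>2 = (\<integral>x. (norm (g N x))\<^sup>2 \<partial>lborel)" for N
    by (simp add: Lp_norm_def powr_half_sqrt g_def a_def norm_minus_commute)
  ultimately have lim: "(\<lambda>N. \<integral>x. (norm (g N x))\<^sup>2 \<partial>lborel) \<longlonglongrightarrow> 0" by simp
  have eq: "(\<integral>x. (norm (g N x))\<^sup>2 \<partial>lborel) = (\<integral>x. (norm (f x))\<^sup>2 \<partial>lborel) - (\<Sum>n\<le>N. (norm (a n))\<^sup>2)" for N
  proof -
    have orth: "L2_inner (g N) (\<psi> m) = 0" if "m \<le> N" for m
    proof -
      have "L2_inner (g N) (\<psi> m) = a m - (\<Sum>n\<le>N. a n * (if n = m then 1 else 0))"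
        unfolding g_def L2_inner_diff_sum_left[OF f2 psi psi] on by (simp add: a_def)
      also have "\<dots> = 0" using that by (simp add: if_distrib[of "\<lambda>x. a _ * x"] cong: if_cong)
      finally show ?thesis .
    qed
    have "L2_inner (g N) (g N) = L2_inner f (g N) - (\<Sum>n\<le>N. a n * L2_inner (\<psi> n) (g N))"
      by (subst (1) g_def[abs_def]) (rule L2_inner_diff_sum_left[OF f2 psi g2])
    also have "(\<Sum>n\<le>N. a n * L2_inner (\<psi> n) (g N)) = 0"
      by (rule sum.neutral) (use orth in \<open>auto simp: L2_inner_cnj[of "\<psi> _" "g N"]\<close>)
    also have "L2_inner f (g N) = cnj (L2_inner (g N) f)" by (rule L2_inner_cnj)
    also have "L2_inner (g N) f = L2_inner f f - (\<Sum>n\<le>N. a n * L2_inner (\<psi> n) f)"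
      unfolding g_def by (rule L2_inner_diff_sum_left[OF f2 psi f2])
    also have "(\<Sum>n\<le>N. a n * L2_inner (\<psi> n) f) = (\<Sum>n\<le>N. of_real ((norm (a n))\<^sup>2))"
      by (intro sum.cong refl) (simp only: L2_inner_cnj[of "\<psi> _" f] a_def complex_norm_square)
    finally have "of_real (\<integral>x. (norm (g N x))\<^sup>2 \<partial>lborel) = (of_real ((\<integral>x. (norm (f x))\<^sup>2 \<partial>lborel) - (\<Sum>n\<le>N. (norm (a n))\<^sup>2)) :: complex)"
      unfolding L2_inner_self by simp
    thus ?thesis by (simp only: of_real_eq_iff)
  qed
  have "(\<lambda>N. (\<integral>x. (norm (f x))\<^sup>2 \<partial>lborel) - (\<integral>x. (norm (g N x))\<^sup>2 \<partial>lborel)) \<longlonglongrightarrow> (\<integral>x. (norm (f x))\<^sup>2 \<partial>lborel) - 0"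
    by (intro tendsto_intros lim)
  hence "(\<lambda>N. \<Sum>n\<le>N. (norm (a n))\<^sup>2) \<longlonglongrightarrow> (\<integral>x. (norm (f x))\<^sup>2 \<partial>lborel)"
    unfolding eq by simp
  thus ?thesis by (simp add: sums_def_le a_def)
qed

text \<open>The difference of the two series vanishes on an interval that accumulates at \<open>0\<close>, while a nonzero
power series has an isolated zero there.\<close>

lemma power_series_unique:
  fixes b p :: "nat \<Rightarrow> real"
  assumes eq: "\<And>z. 0 \<le> z \<Longrightarrow> z < 1 \<Longrightarrow> \<exists>s. (\<lambda>n. b n * z ^ n) sums s \<and> (\<lambda>n. p n * z ^ n) sums s"
  shows "b n = p n"
proof (rule ccontr)
  assume ne: "b n \<noteq> p n"
  define c where "c n = b n - p n" for n
  have s0: "(\<lambda>n. c n * z ^ n) sums 0" if z: "0 \<le> z" "z < 1" for z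
  proof -
    obtain s where "(\<lambda>n. b n * z ^ n) sums s" "(\<lambda>n. p n * z ^ n) sums s" using eq[OF z] by blast
    from sums_diff[OF this] show ?thesis by (simp add: c_def left_diff_distrib)
  qed
  have c0: "c 0 = 0"
    using s0[of 0] by (simp add: powser_sums_zero_iff)
  have "summable (\<lambda>n. c n * x ^ n)" if nx: "norm (x - 0) < 1" for x :: real
  proof -
    obtain z where z: "norm x < z" "z < 1" using nx dense[of "norm x" 1] unfolding diff_0_right by blast
    have "0 \<le> z" using z norm_ge_zero[of x] by linarith
    hence "summable (\<lambda>n. c n * z ^ n)" using s0[of z] z by (auto simp: sums_iff)
    thus ?thesis by (rule powser_inside) (use z \<open>0 \<le> z\<close> in simp)
  qed
  hence sm: "(\<lambda>n. c n * (x - 0) ^ n) sums (\<Sum>n. c n * x ^ n)" if "norm (x - 0) < 1" for x :: real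
    using that by (simp add: summable_sums)
  have "n > 0" using ne c0 by (cases n) (auto simp: c_def)
  then obtain s where s: "0 < s" "\<And>z. z \<in> cball 0 s - {0} \<Longrightarrow> (\<Sum>n. c n * z ^ n) \<noteq> 0"
    using powser_0_nonzero[OF zero_less_one sm, of n] c0 ne by (auto simp: c_def)
  define z where "z = min s (1/2)"
  have "(\<Sum>n. c n * z ^ n) \<noteq> 0" using s(1) by (intro s(2)) (auto simp: z_def)
  moreover have "(\<lambda>n. c n * z ^ n) sums 0" using s(1) by (intro s0) (auto simp: z_def)
  ultimately show False by (simp add: sums_iff)
qed

lemma negative_binomial_sums:
  fixes a z :: real
  assumes "0 \<le> z" "z < 1"
  shows "(\<lambda>n. pochhammer a n / fact n * z ^ n) sums (1 - z) powr (- a)"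
proof -
  have "(\<lambda>n. ((- a) gchoose n) * (- z) ^ n) sums (1 + (- z)) powr (- a)"
    by (rule gen_binomial_real) (use assms in auto)
  moreover have "((- a) gchoose n) * (- z) ^ n = pochhammer a n / fact n * z ^ n" for n
  proof -
    have "(- z) ^ n = (-1) ^ n * z ^ n" by (rule power_minus)
    thus ?thesis by (simp add: gbinomial_pochhammer power_mult_distrib[symmetric])
  qed
  ultimately show ?thesis by simp
qed

text \<open>Expand the Gaussian \<open>exp (-t |x|^2)\<close> in the eigenbasis. Its coefficients are \<open>\<psi>\<^sub>n(0)\<close>, up to
conjugation, times \<open>\<pi>^a s^(-a) (1 - 1/s)^n\<close> with \<open>s = t + 1/2\<close>, so Parseval's identity
becomes a power series identity in \<open>z = (1 - 1/s)^2\<close> with sum \<open>(1 - z)^(-a)\<close>. The binomial series identifies its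
coefficients.\<close>

lemma eigenfunction_value_at_0:
  fixes \<psi> :: "nat \<Rightarrow> real^'d \<Rightarrow> complex"
  assumes d: "CARD('d) \<ge> 2" and B: "radial_eigenbasis \<psi>"
  defines "a \<equiv> real CARD('d) / 2"
  shows "(norm (\<psi> n 0))\<^sup>2 = pi powr (- a) * (pochhammer a n / fact n)"
proof -
  have a: "a \<ge> 1" using d by (simp add: a_def)
  have form: "\<psi> n x = \<psi> n 0 * of_real (profile a n (norm x))" for n x
    unfolding a_def
    by (rule radial_eigenfunction_eq_profile[OF d]) (use B in \<open>auto simp: radial_eigenbasis_def\<close>)
  have key: "(\<lambda>n. ((norm (\<psi> n 0))\<^sup>2 * pi powr a) * z ^ n) sums (1 - z) powr (- a)" if z: "0 \<le> z" "z < 1" for z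
  proof -
    \<comment> \<open>Solves \<open>(1 - 1 / s)^2 = z\<close> with \<open>s \<ge> 1\<close>.\<close>
    define s where "s = 1 / (1 - sqrt z)"
    have sz: "sqrt z < 1" "sqrt z \<ge> 0" using z by auto
    have s1: "s \<ge> 1" using sz by (simp add: s_def)
    have zs: "(1 - 1 / s)\<^sup>2 = z" using z by (simp add: s_def)
    define t where "t = s - 1 / 2"
    have t: "t \<ge> 1/2" using s1 by (simp add: t_def)
    have ts: "t + 1/2 = s" by (simp add: t_def)
    define f where "f x = complex_of_real (exp (- t * (norm x)\<^sup>2))" for x :: "real^'d"
    have fm: "f \<in> borel_measurable borel" unfolding f_def[abs_def] by measurable
    have "0 < 2 * t" using t by simp
    note gm = gaussian_moment[OF this, where 'a = "real^'d" and k = 0]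
    have ff: "(norm (f x))\<^sup>2 = exp (- (2 * t) * (norm x)\<^sup>2)" for x
      by (simp add: f_def power2_eq_square exp_add[symmetric])
    have fL: "in_Lp 2 f" unfolding in_Lp2_iff using fm gm(1) by (simp add: ff)
    have fi: "(\<integral>x. (norm (f x))\<^sup>2 \<partial>lborel) = pi powr a * (2 * t) powr (- a)"
      using gm(2) by (simp add: ff a_def)
    have fr: "L2_rad f"
    proof -
      have "norm (A *v x) = norm x" if "rotation_matrix A" for A and x :: "real^'d"
      proof -
        have "orthogonal_transformation (\<lambda>x. A *v x)"
          using that orthogonal_transformation_matrix[of "\<lambda>x. A *v x"] by (simp add: rotation_matrix_def)
        thus ?thesis by (rule orthogonal_transformation_norm)
      qed
      thus ?thesis using fL by (auto simp: L2_rad_def f_def)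
    qed
    have inn: "(norm (L2_inner f (\<psi> n)))\<^sup>2 = (norm (\<psi> n 0))\<^sup>2 * (pi powr a * s powr (- a))\<^sup>2 * z ^ n" for n
    proof -
      have "L2_inner f (\<psi> n) = (\<integral>(x::real^'d). cnj (\<psi> n 0) * of_real (exp (- t * (norm x)\<^sup>2) * profile a n (norm x)) \<partial>lborel)"
        unfolding L2_inner_def by (subst form) (simp add: f_def mult_ac)
      also have "\<dots> = cnj (\<psi> n 0) * of_real (\<integral>(x::real^'d). exp (- t * (norm x)\<^sup>2) * profile a n (norm x) \<partial>lborel)"
        by (simp only: integral_mult_right_zero integral_complex_of_real)
      also have "(\<integral>(x::real^'d). exp (- t * (norm x)\<^sup>2) * profile a n (norm x) \<partial>lborel) = pi powr a * s powr (- a) * (1 - 1 / s) ^ n"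
        using integral_gaussian_profile[of t n, where 'a = "real^'d"] t ts by (simp add: a_def)
      finally have "norm (L2_inner f (\<psi> n)) = norm (cnj (\<psi> n 0) * of_real (pi powr a * s powr (- a) * (1 - 1 / s) ^ n))"
        by (rule arg_cong)
      hence "norm (L2_inner f (\<psi> n)) = norm (\<psi> n 0) * \<bar>pi powr a * s powr (- a) * (1 - 1 / s) ^ n\<bar>"
        by (simp only: norm_mult norm_of_real complex_mod_cnj)
      hence "(norm (L2_inner f (\<psi> n)))\<^sup>2 = (norm (\<psi> n 0))\<^sup>2 * (pi powr a * s powr (- a))\<^sup>2 * ((1 - 1 / s) ^ n)\<^sup>2"
        by (simp add: power_mult_distrib)
      also have "((1 - 1 / s) ^ n)\<^sup>2 = z ^ n" by (metis zs power_mult mult.commute)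
      finally show ?thesis .
    qed
    have "(\<lambda>n. (norm (\<psi> n 0))\<^sup>2 * (pi powr a * s powr (- a))\<^sup>2 * z ^ n) sums (pi powr a * (2 * t) powr (- a))"
      using radial_parseval[OF B fr] unfolding inn fi .
    hence "(\<lambda>n. (pi powr (- a) * (s powr a)\<^sup>2) * ((norm (\<psi> n 0))\<^sup>2 * (pi powr a * s powr (- a))\<^sup>2 * z ^ n)) sums
       ((pi powr (- a) * (s powr a)\<^sup>2) * (pi powr a * (2 * t) powr (- a)))" by (rule sums_mult)
    moreover have "(pi powr (- a) * (s powr a)\<^sup>2) * ((norm (\<psi> n 0))\<^sup>2 * (pi powr a * s powr (- a))\<^sup>2 * z ^ n)
       = ((norm (\<psi> n 0))\<^sup>2 * pi powr a) * z ^ n" for n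
    proof -
      have "pi powr (- a) * pi powr a = 1" "s powr a * s powr (- a) = 1"
        using s1 by (simp_all add: powr_add[symmetric])
      note e = this
      have ring: "(P' * S\<^sup>2) * (c * (P * S')\<^sup>2 * y) = (P' * P) * (S * S')\<^sup>2 * (c * P) * y" for P' S c P S' y :: real
        by (simp add: power2_eq_square mult_ac)
      show ?thesis unfolding ring e by simp
    qed
    moreover have "(pi powr (- a) * (s powr a)\<^sup>2) * (pi powr a * (2 * t) powr (- a)) = (1 - z) powr (- a)"
    proof -
      have "1 - z = 2 * t / s\<^sup>2" using s1 unfolding zs[symmetric] t_def by (simp add: field_simps power2_eq_square)
      hence "(1 - z) powr (- a) = (2 * t) powr (- a) / (s\<^sup>2) powr (- a)" by (simp add: powr_divide)
      also have "(s\<^sup>2) powr (- a) = 1 / (s powr a)\<^sup>2"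
        using s1 by (simp add: powr_minus_divide power2_eq_square powr_mult)
      finally have 1: "(1 - z) powr (- a) = (2 * t) powr (- a) * (s powr a)\<^sup>2" by simp
      have "pi powr (- a) * pi powr a = 1" by (simp add: powr_add[symmetric])
      thus ?thesis unfolding 1 by (simp add: mult_ac)
    qed
    ultimately show ?thesis by simp
  qed
  have "(norm (\<psi> n 0))\<^sup>2 * pi powr a = pochhammer a n / fact n"
    by (rule power_series_unique) (use key negative_binomial_sums in blast)
  note e = this
  have p1: "pi powr (- a) * pi powr a = 1" by (simp add: powr_add[symmetric])
  have "(norm (\<psi> n 0))\<^sup>2 = (pi powr (- a) * pi powr a) * (norm (\<psi> n 0))\<^sup>2" unfolding p1 by simp
  also have "\<dots> = pi powr (- a) * ((norm (\<psi> n 0))\<^sup>2 * pi powr a)" by (simp only: mult_ac)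
  finally show ?thesis unfolding e .
qed


section \<open>Moments of weighted sums of independent variables\<close>

text \<open>In every term of order at least two in \<open>t\<close>, the product \<open>|t|^k |s|^(2m+2-k)\<close> is at most \<open>s^(2m) t^2\<close> if
\<open>|t| \<le> |s|\<close> and at most \<open>t^(2m+2)\<close> otherwise. The linear term is kept exact because its expectation
vanishes when \<open>t\<close> is centred and independent of \<open>s\<close>.\<close>

lemma binomial_remainder_bound:
  fixes s t :: real
  shows "(s + t) ^ (2 * Suc m) \<le> s ^ (2 * Suc m) + real (2 * Suc m) * (t * s ^ (2 * m + 1))
     + 4 ^ Suc m * (s ^ (2 * m) * t\<^sup>2 + t ^ (2 * Suc m))"
proof -
  define N where "N = 2 * Suc m"
  have N2: "N = Suc (Suc (2 * m))" by (simp add: N_def)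
  have tm: "\<bar>t ^ k * s ^ (N - k)\<bar> \<le> s ^ (2 * m) * t\<^sup>2 + t ^ N" if k: "2 \<le> k" "k \<le> N" for k
  proof (cases "\<bar>t\<bar> \<le> \<bar>s\<bar>")
    case True
    have "\<bar>t\<bar> ^ k = \<bar>t\<bar>\<^sup>2 * \<bar>t\<bar> ^ (k - 2)" using k by (metis le_add_diff_inverse power_add)
    hence "\<bar>t ^ k * s ^ (N - k)\<bar> = \<bar>t\<bar>\<^sup>2 * (\<bar>t\<bar> ^ (k - 2) * \<bar>s\<bar> ^ (N - k))"
      by (simp add: abs_mult power_abs)
    also have "\<dots> \<le> \<bar>t\<bar>\<^sup>2 * (\<bar>s\<bar> ^ (k - 2) * \<bar>s\<bar> ^ (N - k))"
      using True by (intro mult_left_mono mult_right_mono power_mono) auto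
    also have "\<bar>s\<bar> ^ (k - 2) * \<bar>s\<bar> ^ (N - k) = \<bar>s\<bar> ^ (2 * m)"
      using k by (subst power_add[symmetric], intro arg_cong[where f = "\<lambda>n. \<bar>s\<bar> ^ n"]) (auto simp: N2)
    also have "\<dots> = s ^ (2 * m)" by (simp add: power_even_abs)
    finally have "\<bar>t ^ k * s ^ (N - k)\<bar> \<le> s ^ (2 * m) * t\<^sup>2" by (simp add: mult.commute)
    moreover have "t ^ N \<ge> 0" unfolding N_def by (rule zero_le_even_power) simp
    ultimately show ?thesis by linarith
  next
    case False
    have "\<bar>t ^ k * s ^ (N - k)\<bar> = \<bar>t\<bar> ^ k * \<bar>s\<bar> ^ (N - k)" by (simp add: abs_mult power_abs)
    also have "\<dots> \<le> \<bar>t\<bar> ^ k * \<bar>t\<bar> ^ (N - k)" using False by (intro mult_left_mono power_mono) auto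
    also have "\<dots> = t ^ N" using k by (simp add: N_def power_even_abs flip: power_add)
    finally have "\<bar>t ^ k * s ^ (N - k)\<bar> \<le> t ^ N" .
    moreover have "s ^ (2 * m) * t\<^sup>2 \<ge> 0" by (simp add: zero_le_even_power)
    ultimately show ?thesis by linarith
  qed
  have "(s + t) ^ N = (\<Sum>k\<le>N. real (N choose k) * t ^ k * s ^ (N - k))"
    by (subst add.commute) (rule binomial_ring)
  also have "\<dots> = s ^ N + real N * (t * s ^ (2 * m + 1)) + (\<Sum>k\<in>{2..N}. real (N choose k) * t ^ k * s ^ (N - k))"
  proof -
    have "{..N} = insert 0 (insert 1 {2..N})" unfolding N2 by auto
    thus ?thesis by (simp add: N2)
  qed
  also have "(\<Sum>k\<in>{2..N}. real (N choose k) * t ^ k * s ^ (N - k))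
      \<le> (\<Sum>k\<in>{2..N}. real (N choose k) * (s ^ (2 * m) * t\<^sup>2 + t ^ N))"
  proof (rule sum_mono)
    fix k assume "k \<in> {2..N}"
    hence "t ^ k * s ^ (N - k) \<le> s ^ (2 * m) * t\<^sup>2 + t ^ N" using tm[of k] by auto
    thus "real (N choose k) * t ^ k * s ^ (N - k) \<le> real (N choose k) * (s ^ (2 * m) * t\<^sup>2 + t ^ N)"
      by (simp add: mult.assoc mult_left_mono)
  qed
  also have "\<dots> = (\<Sum>k\<in>{2..N}. real (N choose k)) * (s ^ (2 * m) * t\<^sup>2 + t ^ N)"
    by (rule sum_distrib_right[symmetric])
  also have "\<dots> \<le> 4 ^ Suc m * (s ^ (2 * m) * t\<^sup>2 + t ^ N)"
  proof (rule mult_right_mono)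
    have "(\<Sum>k\<in>{2..N}. real (N choose k)) \<le> (\<Sum>k\<le>N. real (N choose k))" by (intro sum_mono2) auto
    also have "\<dots> = 2 ^ N" by (metis choose_row_sum of_nat_sum of_nat_power of_nat_numeral)
    also have "\<dots> = 4 ^ Suc m" by (simp add: N_def power_mult power2_eq_square)
    finally show "(\<Sum>k\<in>{2..N}. real (N choose k)) \<le> 4 ^ Suc m" .
  next
    have "t ^ N \<ge> 0" unfolding N_def by (rule zero_le_even_power) simp
    moreover have "s ^ (2 * m) * t\<^sup>2 \<ge> 0" by (simp add: zero_le_even_power)
    ultimately show "0 \<le> s ^ (2 * m) * t\<^sup>2 + t ^ N" by linarith
  qed
  finally show ?thesis by (simp add: N_def)
qed

lemma power_sum_increment:
  fixes x y :: real
  assumes "x \<ge> 0" "y \<ge> 0"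
  shows "x ^ Suc m + y * (x + y) ^ m \<le> (x + y) ^ Suc m"
proof -
  have "x * x ^ m \<le> x * (x + y) ^ m" using assms by (intro mult_left_mono power_mono) auto
  thus ?thesis by (simp add: algebra_simps)
qed

context prob_space begin

lemma integrable_power_sum:
  fixes Y :: "'i \<Rightarrow> 'a \<Rightarrow> real"
  assumes "finite I" "\<And>i. i \<in> I \<Longrightarrow> Y i \<in> borel_measurable M"
    and "\<And>i k. i \<in> I \<Longrightarrow> integrable M (\<lambda>\<omega>. \<bar>Y i \<omega>\<bar> ^ k)"
  shows "integrable M (\<lambda>\<omega>. (\<Sum>i\<in>I. Y i \<omega>) ^ k)"
proof (cases "I = {}")
  case True
  thus ?thesis by simp
next
  case False
  have "integrable M (\<lambda>\<omega>. \<Sum>i\<in>I. real (card I) ^ k * \<bar>Y i \<omega>\<bar> ^ k)"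
    using assms by auto
  thus ?thesis
  proof (rule Bochner_Integration.integrable_bound)
    show "AE \<omega> in M. norm ((\<Sum>i\<in>I. Y i \<omega>) ^ k) \<le> norm (\<Sum>i\<in>I. real (card I) ^ k * \<bar>Y i \<omega>\<bar> ^ k)"
    proof (intro AE_I2)
      fix \<omega>
      show "norm ((\<Sum>i\<in>I. Y i \<omega>) ^ k) \<le> norm (\<Sum>i\<in>I. real (card I) ^ k * \<bar>Y i \<omega>\<bar> ^ k)"
      proof -
        define m where "m = Max ((\<lambda>i. \<bar>Y i \<omega>\<bar>) ` I)"
        have "m \<in> (\<lambda>i. \<bar>Y i \<omega>\<bar>) ` I" unfolding m_def using assms False by (intro Max_in) auto
        then obtain i where i: "i \<in> I" "m = \<bar>Y i \<omega>\<bar>" by auto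
        have le: "\<bar>Y j \<omega>\<bar> \<le> m" if "j \<in> I" for j unfolding m_def using assms that by (intro Max_ge) auto
        have "\<bar>\<Sum>i\<in>I. Y i \<omega>\<bar> \<le> (\<Sum>i\<in>I. \<bar>Y i \<omega>\<bar>)" by (rule sum_abs)
        also have "\<dots> \<le> real (card I) * m" using le by (rule sum_bounded_above)
        finally have "\<bar>\<Sum>i\<in>I. Y i \<omega>\<bar> ^ k \<le> (real (card I) * m) ^ k" by (intro power_mono) auto
        also have "\<dots> = real (card I) ^ k * \<bar>Y i \<omega>\<bar> ^ k" by (simp add: i power_mult_distrib)
        also have "\<dots> \<le> (\<Sum>i\<in>I. real (card I) ^ k * \<bar>Y i \<omega>\<bar> ^ k)"
          by (rule member_le_sum[OF i(1)]) (use assms in auto)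
        finally show ?thesis by (simp add: power_abs)
      qed
    qed
  qed (use assms in measurable)
qed

text \<open>Adding one variable at a time, the linear term has expectation zero, and the two remainder terms are
bounded by the increment of \<open>(\<Sum> a\<^sub>i^2)^(q+1)\<close>. The constant for one exponent depends on the
constant for the previous one, hence the outer induction on \<open>q\<close>.\<close>

lemma even_moment_bound:
  assumes indep: "indep_vars (\<lambda>_. borel) (X :: 'i \<Rightarrow> 'a \<Rightarrow> real) UNIV"
    and int: "\<And>i k. integrable M (\<lambda>\<omega>. \<bar>X i \<omega>\<bar> ^ k)"
    and mom: "\<And>i k. expectation (\<lambda>\<omega>. \<bar>X i \<omega>\<bar> ^ k) \<le> m k"
    and mean: "\<And>i. expectation (X i) = 0"
  shows "\<exists>C\<ge>0. \<forall>I (a :: 'i \<Rightarrow> real). finite I \<longrightarrow>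
     expectation (\<lambda>\<omega>. (\<Sum>i\<in>I. a i * X i \<omega>) ^ (2 * q)) \<le> C * (\<Sum>i\<in>I. (a i)\<^sup>2) ^ q"
proof (induction q)
  case 0
  show ?case by (rule exI[of _ 1]) (simp add: prob_space)
next
  case (Suc q)
  then obtain B where B: "B \<ge> 0" and IH: "\<And>I (a :: 'i \<Rightarrow> real). finite I \<Longrightarrow>
     expectation (\<lambda>\<omega>. (\<Sum>i\<in>I. a i * X i \<omega>) ^ (2 * q)) \<le> B * (\<Sum>i\<in>I. (a i)\<^sup>2) ^ q" by blast
  have Xm [measurable]: "X i \<in> borel_measurable M" for i using indep by (auto simp: indep_vars_def)
  have m0: "m k \<ge> 0" for k
    by (rule order_trans[OF _ mom[of undefined k]]) simp
  \<comment> \<open>Chosen so that the induction over the index set closes.\<close>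
  define C where "C = 4 ^ Suc q * (B * m 2 + m (2 * Suc q))"
  have C0: "C \<ge> 0" using B m0 by (simp add: C_def)
  show ?case
  proof (intro exI[of _ C] conjI allI impI C0)
    fix I :: "'i set" and a :: "'i \<Rightarrow> real"
    assume "finite I"
    thus "expectation (\<lambda>\<omega>. (\<Sum>i\<in>I. a i * X i \<omega>) ^ (2 * Suc q)) \<le> C * (\<Sum>i\<in>I. (a i)\<^sup>2) ^ Suc q"
    proof (induction I)
      case empty
      then show ?case by simp
    next
      case (insert i I)
      define S where "S \<omega> = (\<Sum>j\<in>I. a j * X j \<omega>)" for \<omega>
      define T where "T \<omega> = a i * X i \<omega>" for \<omega>
      have [measurable]: "S \<in> borel_measurable M" "T \<in> borel_measurable M"
        unfolding S_def[abs_def] T_def[abs_def] by auto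
      have iS: "integrable M (\<lambda>\<omega>. S \<omega> ^ k)" for k
        unfolding S_def by (intro integrable_power_sum insert) (use int in \<open>auto simp: abs_mult power_mult_distrib\<close>)
      have iT: "integrable M (\<lambda>\<omega>. T \<omega> ^ k)" for k
        using integrable_power_sum[of "{i}" "\<lambda>_. T" k] int[of i] by (auto simp: T_def abs_mult power_mult_distrib)
      have iST: "integrable M (\<lambda>\<omega>. (S \<omega> + T \<omega>) ^ k)" for k
        using integrable_power_sum[of "insert i I" "\<lambda>j \<omega>. a j * X j \<omega>" k] insert int
        by (auto simp: abs_mult power_mult_distrib S_def T_def add.commute)
      have ind: "indep_var borel T borel S"
      proof -
        have "indep_vars (\<lambda>_. borel) (\<lambda>j \<omega>. a j * X j \<omega>) (insert i I)"
          using indep_vars_compose2[OF indep_vars_subset[OF indep, of "insert i I"], of "\<lambda>j x. a j * x" "\<lambda>_. borel"] by simp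
        from indep_vars_sum[OF insert(1,2) this] show ?thesis by (simp add: S_def[abs_def] T_def[abs_def])
      qed
      have indp: "indep_var borel (\<lambda>\<omega>. T \<omega> ^ k) borel (\<lambda>\<omega>. S \<omega> ^ l)" for k l
        using indep_var_compose[OF ind, of "\<lambda>x. x ^ k" borel "\<lambda>x. x ^ l" borel] by (simp add: comp_def)
      have iP: "integrable M (\<lambda>\<omega>. T \<omega> ^ k * S \<omega> ^ l)"
        and eP: "expectation (\<lambda>\<omega>. T \<omega> ^ k * S \<omega> ^ l) = expectation (\<lambda>\<omega>. T \<omega> ^ k) * expectation (\<lambda>\<omega>. S \<omega> ^ l)" for k l
        using indep_var_integrable[OF indp iT iS] indep_var_lebesgue_integral[OF indp iT iS] by auto
      have ET: "expectation T = 0" unfolding T_def[abs_def] using mean[of i] by simp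
      define \<sigma> where "\<sigma> = (\<Sum>j\<in>I. (a j)\<^sup>2)"
      have s0: "\<sigma> \<ge> 0" by (simp add: \<sigma>_def sum_nonneg)
      have sI: "(\<Sum>j\<in>insert i I. (a j)\<^sup>2) = \<sigma> + (a i)\<^sup>2" using insert by (simp add: \<sigma>_def)
      have eT: "expectation (\<lambda>\<omega>. T \<omega> ^ (2 * k)) \<le> (a i)\<^sup>2 ^ k * m (2 * k)" for k
      proof -
        have "expectation (\<lambda>\<omega>. T \<omega> ^ (2 * k)) = (a i)\<^sup>2 ^ k * expectation (\<lambda>\<omega>. \<bar>X i \<omega>\<bar> ^ (2 * k))"
          by (simp add: T_def power_mult_distrib power_even_abs power_mult)
        also have "\<dots> \<le> (a i)\<^sup>2 ^ k * m (2 * k)" by (intro mult_left_mono mom) auto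
        finally show ?thesis .
      qed
      have "expectation (\<lambda>\<omega>. (\<Sum>j\<in>insert i I. a j * X j \<omega>) ^ (2 * Suc q)) = expectation (\<lambda>\<omega>. (S \<omega> + T \<omega>) ^ (2 * Suc q))"
        using insert by (simp add: S_def T_def add.commute)
      also have "\<dots> \<le> expectation (\<lambda>\<omega>. S \<omega> ^ (2 * Suc q) + real (2 * Suc q) * (T \<omega> ^ 1 * S \<omega> ^ (2 * q + 1))
          + 4 ^ Suc q * (T \<omega> ^ 2 * S \<omega> ^ (2 * q) + T \<omega> ^ (2 * Suc q)))"
        by (intro integral_mono Bochner_Integration.integrable_add integrable_mult_right iST iS iP iT)
           (use binomial_remainder_bound in \<open>simp add: mult.commute\<close>)
      also have "\<dots> = expectation (\<lambda>\<omega>. S \<omega> ^ (2 * Suc q)) + real (2 * Suc q) * (expectation T * expectation (\<lambda>\<omega>. S \<omega> ^ (2 * q + 1)))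
          + 4 ^ Suc q * (expectation (\<lambda>\<omega>. T \<omega> ^ 2) * expectation (\<lambda>\<omega>. S \<omega> ^ (2 * q)) + expectation (\<lambda>\<omega>. T \<omega> ^ (2 * Suc q)))"
      proof -
        have *: "expectation (\<lambda>\<omega>. f \<omega> + c * g \<omega> + d * (h \<omega> + l \<omega>))
            = expectation f + c * expectation g + d * (expectation h + expectation l)"
          if "integrable M f" "integrable M g" "integrable M h" "integrable M l"
          for f g h l :: "'a \<Rightarrow> real" and c d
          using that by simp
        show ?thesis by (subst *[OF iS iP iP iT], simp only: eP) simp
      qed
      also have "\<dots> \<le> C * \<sigma> ^ Suc q + 4 ^ Suc q * (((a i)\<^sup>2 * m 2) * (B * \<sigma> ^ q) + (a i)\<^sup>2 ^ Suc q * m (2 * Suc q))"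
      proof -
        have 1: "expectation (\<lambda>\<omega>. S \<omega> ^ (2 * Suc q)) \<le> C * \<sigma> ^ Suc q" using insert.IH by (simp add: S_def \<sigma>_def)
        have 2: "expectation (\<lambda>\<omega>. S \<omega> ^ (2 * q)) \<le> B * \<sigma> ^ q" using IH[OF insert(1)] by (simp add: S_def \<sigma>_def)
        have 3: "expectation (\<lambda>\<omega>. T \<omega> ^ 2) * expectation (\<lambda>\<omega>. S \<omega> ^ (2 * q)) \<le> ((a i)\<^sup>2 * m 2) * (B * \<sigma> ^ q)"
          using eT[of 1] 2 m0 by (intro mult_mono) (auto intro!: integral_nonneg_AE simp: zero_le_even_power)
        have 4: "4 ^ Suc q * (expectation (\<lambda>\<omega>. T \<omega> ^ 2) * expectation (\<lambda>\<omega>. S \<omega> ^ (2 * q)) + expectation (\<lambda>\<omega>. T \<omega> ^ (2 * Suc q)))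
           \<le> 4 ^ Suc q * (((a i)\<^sup>2 * m 2) * (B * \<sigma> ^ q) + (a i)\<^sup>2 ^ Suc q * m (2 * Suc q))"
          by (intro mult_left_mono add_mono 3 eT) auto
        show ?thesis unfolding ET mult_zero_left mult_zero_right add_0_right by (rule add_mono[OF 1 4])
      qed
      also have "\<dots> \<le> C * \<sigma> ^ Suc q + C * ((a i)\<^sup>2 * (\<sigma> + (a i)\<^sup>2) ^ q)"
      proof -
        have p1: "(a i)\<^sup>2 * \<sigma> ^ q \<le> (a i)\<^sup>2 * (\<sigma> + (a i)\<^sup>2) ^ q"
          using s0 by (intro mult_left_mono power_mono) auto
        have p2: "(a i)\<^sup>2 * (a i)\<^sup>2 ^ q \<le> (a i)\<^sup>2 * (\<sigma> + (a i)\<^sup>2) ^ q"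
          using s0 by (intro mult_left_mono power_mono) auto
        have "((a i)\<^sup>2 * m 2) * (B * \<sigma> ^ q) + (a i)\<^sup>2 ^ Suc q * m (2 * Suc q)
           = (B * m 2) * ((a i)\<^sup>2 * \<sigma> ^ q) + m (2 * Suc q) * ((a i)\<^sup>2 * (a i)\<^sup>2 ^ q)" by (simp add: mult_ac)
        also have "\<dots> \<le> (B * m 2) * ((a i)\<^sup>2 * (\<sigma> + (a i)\<^sup>2) ^ q) + m (2 * Suc q) * ((a i)\<^sup>2 * (\<sigma> + (a i)\<^sup>2) ^ q)"
          by (intro add_mono mult_left_mono p1 p2) (use B m0 in auto)
        also have "\<dots> = (B * m 2 + m (2 * Suc q)) * ((a i)\<^sup>2 * (\<sigma> + (a i)\<^sup>2) ^ q)" by (simp only: distrib_right)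
        finally have "4 ^ Suc q * (((a i)\<^sup>2 * m 2) * (B * \<sigma> ^ q) + (a i)\<^sup>2 ^ Suc q * m (2 * Suc q))
            \<le> 4 ^ Suc q * ((B * m 2 + m (2 * Suc q)) * ((a i)\<^sup>2 * (\<sigma> + (a i)\<^sup>2) ^ q))"
          by (intro mult_left_mono) auto
        thus ?thesis by (simp only: C_def mult.assoc add_left_mono)
      qed
      also have "\<dots> = C * (\<sigma> ^ Suc q + (a i)\<^sup>2 * (\<sigma> + (a i)\<^sup>2) ^ q)" by (simp only: distrib_left)
      also have "\<dots> \<le> C * (\<sigma> + (a i)\<^sup>2) ^ Suc q"
        by (intro mult_left_mono power_sum_increment C0 s0) auto
      finally show ?case unfolding sI .
    qed
  qed
qed

lemma even_moment_bound_complex: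
  assumes indep: "indep_vars (\<lambda>_. borel) (X :: 'i \<Rightarrow> 'a \<Rightarrow> real) UNIV"
    and int: "\<And>i k. integrable M (\<lambda>\<omega>. \<bar>X i \<omega>\<bar> ^ k)"
    and mom: "\<And>i k. expectation (\<lambda>\<omega>. \<bar>X i \<omega>\<bar> ^ k) \<le> m k"
    and mean: "\<And>i. expectation (X i) = 0"
  shows "\<exists>C\<ge>0. \<forall>I (a :: 'i \<Rightarrow> complex). finite I \<longrightarrow>
     integrable M (\<lambda>\<omega>. norm (\<Sum>i\<in>I. of_real (X i \<omega>) * a i) ^ (2 * q)) \<and>
     expectation (\<lambda>\<omega>. norm (\<Sum>i\<in>I. of_real (X i \<omega>) * a i) ^ (2 * q)) \<le> C * (\<Sum>i\<in>I. (norm (a i))\<^sup>2) ^ q"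
proof -
  obtain B where B: "B \<ge> 0" and IH: "\<And>I (a :: 'i \<Rightarrow> real). finite I \<Longrightarrow>
     expectation (\<lambda>\<omega>. (\<Sum>i\<in>I. a i * X i \<omega>) ^ (2 * q)) \<le> B * (\<Sum>i\<in>I. (a i)\<^sup>2) ^ q"
    using even_moment_bound[OF indep int mom mean] by blast
  have Xm [measurable]: "X i \<in> borel_measurable M" for i using indep by (auto simp: indep_vars_def)
  show ?thesis
  proof (intro exI[of _ "2 ^ q * (B + B)"] conjI allI impI)
    fix I :: "'i set" and a :: "'i \<Rightarrow> complex"
    assume I: "finite I"
    define R where "R \<omega> = (\<Sum>i\<in>I. Re (a i) * X i \<omega>)" for \<omega>
    define J where "J \<omega> = (\<Sum>i\<in>I. Im (a i) * X i \<omega>)" for \<omega>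
    have [measurable]: "R \<in> borel_measurable M" "J \<in> borel_measurable M"
      unfolding R_def[abs_def] J_def[abs_def] by auto
    have iR: "integrable M (\<lambda>\<omega>. R \<omega> ^ (2 * q))" "integrable M (\<lambda>\<omega>. J \<omega> ^ (2 * q))"
      unfolding R_def J_def by (intro integrable_power_sum I; use int in \<open>auto simp: abs_mult power_mult_distrib\<close>)+
    have nrm: "norm (\<Sum>i\<in>I. of_real (X i \<omega>) * a i) ^ (2 * q) = ((R \<omega>)\<^sup>2 + (J \<omega>)\<^sup>2) ^ q" for \<omega>
      unfolding power_mult cmod_power2 by (simp add: R_def J_def mult.commute)
    have le: "((R \<omega>)\<^sup>2 + (J \<omega>)\<^sup>2) ^ q \<le> 2 ^ q * (R \<omega> ^ (2 * q) + J \<omega> ^ (2 * q))" for \<omega>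
    proof -
      have *: "(x + y) ^ q \<le> 2 ^ q * (x ^ q + y ^ q)" if "0 \<le> x" "x \<le> y" for x y :: real
      proof -
        have "(x + y) ^ q \<le> (2 * y) ^ q" using that by (intro power_mono) auto
        also have "\<dots> \<le> 2 ^ q * (x ^ q + y ^ q)" using that by (simp add: power_mult_distrib)
        finally show ?thesis .
      qed
      show ?thesis
        using *[of "(R \<omega>)\<^sup>2" "(J \<omega>)\<^sup>2"] *[of "(J \<omega>)\<^sup>2" "(R \<omega>)\<^sup>2"]
        by (cases "(R \<omega>)\<^sup>2 \<le> (J \<omega>)\<^sup>2") (auto simp: power_mult add.commute)
    qed
    have ib: "integrable M (\<lambda>\<omega>. 2 ^ q * (R \<omega> ^ (2 * q) + J \<omega> ^ (2 * q)))" using iR by auto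
    show i: "integrable M (\<lambda>\<omega>. norm (\<Sum>i\<in>I. of_real (X i \<omega>) * a i) ^ (2 * q))"
      unfolding nrm
      by (rule Bochner_Integration.integrable_bound[OF ib]) (use le in \<open>auto simp: zero_le_even_power\<close>)
    have "expectation (\<lambda>\<omega>. norm (\<Sum>i\<in>I. of_real (X i \<omega>) * a i) ^ (2 * q))
       \<le> expectation (\<lambda>\<omega>. 2 ^ q * (R \<omega> ^ (2 * q) + J \<omega> ^ (2 * q)))"
      using i by (intro integral_mono ib) (auto simp: nrm le)
    also have "\<dots> = 2 ^ q * (expectation (\<lambda>\<omega>. R \<omega> ^ (2 * q)) + expectation (\<lambda>\<omega>. J \<omega> ^ (2 * q)))"
      using iR by simp
    also have "\<dots> \<le> 2 ^ q * (B * (\<Sum>i\<in>I. (norm (a i))\<^sup>2) ^ q + B * (\<Sum>i\<in>I. (norm (a i))\<^sup>2) ^ q)"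
    proof (intro mult_left_mono add_mono)
      show "expectation (\<lambda>\<omega>. R \<omega> ^ (2 * q)) \<le> B * (\<Sum>i\<in>I. (norm (a i))\<^sup>2) ^ q"
        unfolding R_def
        by (rule order_trans[OF IH[OF I]], intro mult_left_mono power_mono[OF sum_mono] B sum_nonneg)
           (auto simp: cmod_power2)
      show "expectation (\<lambda>\<omega>. J \<omega> ^ (2 * q)) \<le> B * (\<Sum>i\<in>I. (norm (a i))\<^sup>2) ^ q"
        unfolding J_def
        by (rule order_trans[OF IH[OF I]], intro mult_left_mono power_mono[OF sum_mono] B sum_nonneg)
           (auto simp: cmod_power2)
    qed auto
    finally show "expectation (\<lambda>\<omega>. norm (\<Sum>i\<in>I. of_real (X i \<omega>) * a i) ^ (2 * q)) \<le> 2 ^ q * (B + B) * (\<Sum>i\<in>I. (norm (a i))\<^sup>2) ^ q"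
      by (simp add: algebra_simps)
  qed (use B in auto)
qed

end

text \<open>Jensen's inequality for the concave power \<open>\<theta>\<close>, in the form of the tangent inequality at \<open>A\<close>.\<close>

lemma (in prob_space) nn_expectation_powr_le:
  fixes Y :: "'a \<Rightarrow> real" and \<theta> :: real
  assumes \<theta>: "0 < \<theta>" "\<theta> \<le> 1" and Y [measurable]: "Y \<in> borel_measurable M" and Y0: "\<And>\<omega>. Y \<omega> \<ge> 0"
    and A: "A \<ge> 0" "(\<integral>\<^sup>+\<omega>. ennreal (Y \<omega>) \<partial>M) \<le> ennreal A"
  shows "(\<integral>\<^sup>+\<omega>. ennreal (Y \<omega> powr \<theta>) \<partial>M) \<le> ennreal (A powr \<theta>)"
proof (cases "A = 0")
  case True
  hence "(\<integral>\<^sup>+\<omega>. ennreal (Y \<omega>) \<partial>M) = 0" using A by simp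
  hence "AE \<omega> in M. ennreal (Y \<omega>) = 0" by (subst (asm) nn_integral_0_iff_AE) auto
  hence "AE \<omega> in M. ennreal (Y \<omega> powr \<theta>) = 0"
    by eventually_elim (use Y0 in \<open>auto simp: ennreal_eq_0_iff order_antisym\<close>)
  hence "(\<integral>\<^sup>+\<omega>. ennreal (Y \<omega> powr \<theta>) \<partial>M) = (\<integral>\<^sup>+\<omega>. 0 \<partial>M)" by (rule nn_integral_cong_AE)
  thus ?thesis by simp
next
  case False
  hence Ap: "A > 0" using A by simp
  have young: "Y \<omega> powr \<theta> \<le> A powr \<theta> * (1 - \<theta>) + A powr \<theta> * \<theta> / A * Y \<omega>" for \<omega>
  proof (cases "Y \<omega> = 0")
    case True
    thus ?thesis using \<theta> by simp
  next
    case False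
    hence Yp: "Y \<omega> > 0" using Y0[of \<omega>] by simp
    have "(Y \<omega> / A) powr \<theta> * 1 powr (1 - \<theta>) \<le> \<theta> * (Y \<omega> / A) + (1 - \<theta>) * 1"
      by (rule Youngs_inequality_0) (use \<theta> Yp Ap in auto)
    hence "A powr \<theta> * (Y \<omega> / A) powr \<theta> \<le> A powr \<theta> * (\<theta> * (Y \<omega> / A) + (1 - \<theta>))"
      by (intro mult_left_mono) auto
    moreover have "A powr \<theta> * (Y \<omega> / A) powr \<theta> = Y \<omega> powr \<theta>"
      using Ap Yp by (simp add: powr_mult[symmetric])
    ultimately show ?thesis by (simp add: algebra_simps)
  qed
  have "(\<integral>\<^sup>+\<omega>. ennreal (Y \<omega> powr \<theta>) \<partial>M) \<le> (\<integral>\<^sup>+\<omega>. ennreal (A powr \<theta> * (1 - \<theta>)) + ennreal (A powr \<theta> * \<theta> / A) * ennreal (Y \<omega>) \<partial>M)"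
  proof (rule nn_integral_mono)
    fix \<omega>
    show "ennreal (Y \<omega> powr \<theta>) \<le> ennreal (A powr \<theta> * (1 - \<theta>)) + ennreal (A powr \<theta> * \<theta> / A) * ennreal (Y \<omega>)"
      using young[of \<omega>] Y0[of \<omega>] \<theta> Ap by (simp add: ennreal_mult[symmetric] ennreal_plus[symmetric] ennreal_leI del: ennreal_plus)
  qed
  also have "\<dots> = ennreal (A powr \<theta> * (1 - \<theta>)) + ennreal (A powr \<theta> * \<theta> / A) * (\<integral>\<^sup>+\<omega>. ennreal (Y \<omega>) \<partial>M)"
    by (simp add: nn_integral_add nn_integral_cmult emeasure_space_1)
  also have "\<dots> \<le> ennreal (A powr \<theta> * (1 - \<theta>)) + ennreal (A powr \<theta> * \<theta> / A) * ennreal A"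
    by (intro add_left_mono mult_left_mono A) auto
  also have "\<dots> = ennreal (A powr \<theta>)"
    using \<theta> Ap by (simp add: ennreal_mult[symmetric] ennreal_plus[symmetric] del: ennreal_plus) (simp add: algebra_simps)
  finally show ?thesis .
qed


section \<open>Convergence along dyadic blocks\<close>

text \<open>Block boundaries; the offset \<open>j0\<close> discards the first indices, for which the bounds on the
eigenfunctions are not claimed.\<close>

definition dyadic :: "nat \<Rightarrow> nat \<Rightarrow> nat" where "dyadic j0 j = 2 ^ (j + j0)"

lemma dyadic_mono: "i \<le> j \<Longrightarrow> dyadic j0 i \<le> dyadic j0 j"
  by (simp add: dyadic_def)

lemma dyadic_block:
  assumes "dyadic j0 j \<le> k"
  shows "\<exists>i\<ge>j. dyadic j0 i \<le> k \<and> k \<le> dyadic j0 (Suc i)"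
proof -
  define i where "i = (GREATEST i. dyadic j0 i \<le> k)"
  have bd: "i \<le> k" if "dyadic j0 i \<le> k" for i
  proof -
    have "i < 2 ^ i" by (rule less_exp)
    also have "(2::nat) ^ i \<le> dyadic j0 i" by (simp add: dyadic_def)
    finally show ?thesis using that by simp
  qed
  have 1: "dyadic j0 i \<le> k" unfolding i_def by (rule GreatestI_nat[where P = "\<lambda>i. dyadic j0 i \<le> k", OF assms bd])
  have 2: "j \<le> i" unfolding i_def by (rule Greatest_le_nat[where P = "\<lambda>i. dyadic j0 i \<le> k", OF assms bd])
  have 3: "k \<le> dyadic j0 (Suc i)"
  proof (rule ccontr)
    assume "\<not> k \<le> dyadic j0 (Suc i)"
    hence "Suc i \<le> i" unfolding i_def by (intro Greatest_le_nat[where P = "\<lambda>i. dyadic j0 i \<le> k", OF _ bd]) auto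
    thus False by simp
  qed
  show ?thesis using 1 2 3 by blast
qed

lemma norm_diff_chain: "norm (x - z) \<le> norm (x - y) + norm (y - z)" for x y z :: complex
  using norm_triangle_ineq[of "x - y" "y - z"] by simp

text \<open>Chain the boundaries of the successive blocks and sum the geometric series.\<close>

lemma norm_lim_le_of_dyadic_blocks:
  fixes u :: "nat \<Rightarrow> complex"
  assumes q: "0 < q" "q < 1" and V: "V \<ge> 0"
    and blk: "\<And>j k. dyadic j0 j \<le> k \<Longrightarrow> k \<le> dyadic j0 (Suc j) \<Longrightarrow> norm (u k - u (dyadic j0 j)) \<le> q ^ j * V"
    and jk: "dyadic j0 j \<le> k"
  shows "norm (lim u - u k) \<le> 2 * V / (1 - q) * q ^ j"
proof -
  have chain: "norm (u (dyadic j0 (j + m)) - u (dyadic j0 j)) \<le> (\<Sum>i<m. q ^ (j + i)) * V" for j m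
  proof (induction m)
    case (Suc m)
    have "norm (u (dyadic j0 (Suc (j + m))) - u (dyadic j0 j)) \<le>
      norm (u (dyadic j0 (Suc (j + m))) - u (dyadic j0 (j + m))) + norm (u (dyadic j0 (j + m)) - u (dyadic j0 j))"
      by (rule norm_diff_chain)
    also have "\<dots> \<le> q ^ (j + m) * V + (\<Sum>i<m. q ^ (j + i)) * V"
      by (intro add_mono Suc blk dyadic_mono) auto
    finally show ?case by (simp add: algebra_simps)
  qed simp
  have geo: "(\<Sum>i<m. q ^ (j + i)) + q ^ (j + m) \<le> q ^ j / (1 - q)" for j m
  proof -
    have "(\<Sum>i<m. q ^ (j + i)) + q ^ (j + m) = q ^ j * (\<Sum>i<Suc m. q ^ i)"
      by (simp add: power_add sum_distrib_left distrib_left)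
    also have "(\<Sum>i<Suc m. q ^ i) = (1 - q ^ Suc m) / (1 - q)" using q by (subst sum_gp_strict) auto
    also have "\<dots> \<le> 1 / (1 - q)" using q by (intro divide_right_mono) auto
    finally show ?thesis using q by (simp add: mult_left_mono)
  qed
  have tail: "norm (u k - u (dyadic j0 j)) \<le> q ^ j / (1 - q) * V" if "dyadic j0 j \<le> k" for j k
  proof -
    note k_ge = that
    obtain i where i: "j \<le> i" "dyadic j0 i \<le> k" "k \<le> dyadic j0 (Suc i)" using dyadic_block[OF k_ge] by blast
    define m where "m = i - j"
    have im: "i = j + m" using i by (simp add: m_def)
    have "norm (u k - u (dyadic j0 j)) \<le> norm (u k - u (dyadic j0 i)) + norm (u (dyadic j0 i) - u (dyadic j0 j))"
      by (rule norm_diff_chain)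
    also have "\<dots> \<le> q ^ i * V + (\<Sum>i<m. q ^ (j + i)) * V"
      unfolding im by (intro add_mono chain blk) (use i im in auto)
    also have "\<dots> = ((\<Sum>i<m. q ^ (j + i)) + q ^ (j + m)) * V" by (simp add: im algebra_simps)
    also have "\<dots> \<le> q ^ j / (1 - q) * V" by (intro mult_right_mono geo V)
    finally show ?thesis .
  qed
  have two: "norm (u l - u k) \<le> 2 * V / (1 - q) * q ^ j" if "dyadic j0 j \<le> k" "dyadic j0 j \<le> l" for j k l
  proof -
    have "norm (u l - u k) \<le> norm (u l - u (dyadic j0 j)) + norm (u k - u (dyadic j0 j))"
      using norm_diff_chain[of "u l" "u k" "u (dyadic j0 j)"] by (simp add: norm_minus_commute)
    also have "\<dots> \<le> q ^ j / (1 - q) * V + q ^ j / (1 - q) * V" by (intro add_mono tail that)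
    finally show ?thesis by (simp add: mult_ac)
  qed
  have "Cauchy u"
  proof (rule CauchyI)
    fix e :: real assume e: "e > 0"
    have "(\<lambda>j. 2 * V / (1 - q) * q ^ j) \<longlonglongrightarrow> 2 * V / (1 - q) * 0"
      using q by (intro tendsto_mult tendsto_const LIMSEQ_realpow_zero) auto
    hence "eventually (\<lambda>j. 2 * V / (1 - q) * q ^ j < e) sequentially"
      using e by (intro order_tendstoD) auto
    then obtain j where "2 * V / (1 - q) * q ^ j < e" by (auto simp: eventually_sequentially)
    thus "\<exists>M. \<forall>m\<ge>M. \<forall>n\<ge>M. norm (u m - u n) < e"
      using two by (intro exI[of _ "dyadic j0 j"]) (meson le_less_trans)
  qed
  hence conv: "convergent u" by (simp add: Cauchy_convergent_iff)
  have "(\<lambda>l. norm (u l - u k)) \<longlonglongrightarrow> norm (lim u - u k)"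
    by (intro tendsto_intros) (use conv in \<open>simp add: convergent_LIMSEQ_iff\<close>)
  moreover have "eventually (\<lambda>l. norm (u l - u k) \<le> 2 * V / (1 - q) * q ^ j) sequentially"
    using two[OF jk] by (auto simp: eventually_sequentially)
  ultimately show "norm (lim u - u k) \<le> 2 * V / (1 - q) * q ^ j"
    by (intro tendsto_upperbound) auto
qed

lemma norm_add_powr_le:
  fixes p :: real
  assumes "p \<ge> 0"
  shows "norm (x + y :: complex) powr p \<le> 2 powr p * (norm x powr p + norm y powr p)"
proof -
  define m where "m = max (norm x) (norm y)"
  have "norm (x + y) \<le> norm x + norm y" by (rule norm_triangle_ineq)
  also have "\<dots> \<le> 2 * m" by (simp add: m_def)
  finally have "norm (x + y) powr p \<le> (2 * m) powr p" using assms by (intro powr_mono2) auto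
  also have "\<dots> = 2 powr p * m powr p" by (simp add: m_def powr_mult)
  also have "\<dots> \<le> 2 powr p * (norm x powr p + norm y powr p)" by (intro mult_left_mono) (simp_all add: m_def max_def)
  finally show ?thesis .
qed

text \<open>Let \<open>W = \<Sum>\<^sub>j 2^(\<eta> j) D\<^sub>j\<close>. It is integrable, hence finite almost everywhere, and bounds each block maximum
by \<open>2^(-\<eta> j / p) W^(1/p)\<close>. So the sequence converges pointwise almost everywhere, at a geometric
rate with the same dominating function \<open>W\<close>, and the rate survives integration.\<close>

lemma Lp_tendsto_of_dyadic_blocks:
  fixes u :: "nat \<Rightarrow> 'a::euclidean_space \<Rightarrow> complex" and D :: "nat \<Rightarrow> 'a \<Rightarrow> real" and p \<eta> :: real
  assumes p: "p > 0" and \<eta>: "\<eta> > 0"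
    and u: "\<And>N. in_Lp p (u N)"
    and D: "\<And>j. D j \<in> borel_measurable borel" "\<And>j x. D j x \<ge> 0"
    and blk: "\<And>j k x. dyadic j0 j \<le> k \<Longrightarrow> k \<le> dyadic j0 (Suc j) \<Longrightarrow>
         norm (u k x - u (dyadic j0 j) x) powr p \<le> D j x"
    and fin: "(\<Sum>j. \<integral>\<^sup>+x. ennreal (2 powr (\<eta> * j) * D j x) \<partial>lborel) < \<infinity>"
  shows "\<exists>f. Lp_tendsto p u f"
proof -
  have um [measurable]: "u N \<in> borel_measurable borel" for N using u[of N] by (simp add: in_Lp_def)
  note D(1) [measurable]
  define W where "W x = (\<Sum>j. ennreal (2 powr (\<eta> * j) * D j x))" for x
  have [measurable]: "W \<in> borel_measurable borel" unfolding W_def[abs_def] by measurable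
  have intW: "(\<integral>\<^sup>+x. W x \<partial>lborel) < \<infinity>"
    unfolding W_def by (subst nn_integral_suminf) (use fin in auto)
  have AEW: "AE x in lborel. W x < \<infinity>"
    using nn_integral_noteq_infinite[of W lborel] intW by (auto simp: less_top)
  define f where "f x = lim (\<lambda>k. u k x)" for x
  have [measurable]: "f \<in> borel_measurable borel" unfolding f_def[abs_def] by measurable
  define q where "q = 2 powr (- \<eta> / p)"
  have q: "0 < q" "q < 1" using p \<eta> by (auto simp: q_def powr_less_one)
  have qp: "(q ^ j) powr p = 2 powr (- \<eta> * j)" for j
    using p by (simp add: q_def powr_powr powr_realpow[symmetric])
  define C where "C = (2 / (1 - q)) powr p"
  have est: "norm (f x - u k x) powr p \<le> C * 2 powr (- \<eta> * j) * enn2real (W x)"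
    if W: "W x < \<infinity>" and jk: "dyadic j0 j \<le> k" for x j k
  proof -
    define V where "V = enn2real (W x) powr (1 / p)"
    have V: "V \<ge> 0" by (simp add: V_def)
    have Vp: "V powr p = enn2real (W x)" using p by (simp add: V_def powr_powr)
    have bl: "norm (u k x - u (dyadic j0 j) x) \<le> q ^ j * V"
      if "dyadic j0 j \<le> k" "k \<le> dyadic j0 (Suc j)" for j k
    proof -
      have "ennreal (2 powr (\<eta> * j) * D j x) \<le> W x"
        unfolding W_def using sum_le_suminf[of "\<lambda>j. ennreal (2 powr (\<eta> * j) * D j x)" "{j}"] by simp
      also have "W x = ennreal (enn2real (W x))" using W by simp
      finally have "2 powr (\<eta> * j) * D j x \<le> enn2real (W x)" by (simp add: ennreal_le_iff)
      hence "2 powr (- \<eta> * j) * (2 powr (\<eta> * j) * D j x) \<le> 2 powr (- \<eta> * j) * enn2real (W x)"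
        by (intro mult_left_mono) auto
      hence "D j x \<le> 2 powr (- \<eta> * j) * enn2real (W x)"
        by (simp add: mult.assoc[symmetric] powr_add[symmetric])
      hence le: "norm (u k x - u (dyadic j0 j) x) powr p \<le> (q ^ j * V) powr p"
        using blk[OF that, of x] q V by (simp add: powr_mult qp Vp)
      show ?thesis
      proof (rule ccontr)
        assume "\<not> ?thesis"
        hence "(q ^ j * V) powr p < norm (u k x - u (dyadic j0 j) x) powr p"
          using p q V by (intro powr_less_mono2) auto
        thus False using le by simp
      qed
    qed
    have "norm (f x - u k x) \<le> 2 * V / (1 - q) * q ^ j"
      unfolding f_def by (rule norm_lim_le_of_dyadic_blocks[OF q V bl jk])
    hence "norm (f x - u k x) powr p \<le> (2 / (1 - q) * (q ^ j * V)) powr p"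
      using p by (intro powr_mono2) (auto simp: mult_ac)
    also have "\<dots> = C * ((q ^ j) powr p * V powr p)"
      using q V by (subst powr_mult; simp add: powr_mult C_def)
    finally show ?thesis by (simp add: qp Vp mult.assoc)
  qed
  have intWr: "integrable lborel (\<lambda>x. enn2real (W x))"
  proof (rule integrableI_nonneg)
    have "ennreal (enn2real y) \<le> y" for y by (cases y) auto
    hence "(\<integral>\<^sup>+x. ennreal (enn2real (W x)) \<partial>lborel) \<le> (\<integral>\<^sup>+x. W x \<partial>lborel)" by (intro nn_integral_mono)
    thus "(\<integral>\<^sup>+x. ennreal (enn2real (W x)) \<partial>lborel) < \<infinity>" using intW by (rule le_less_trans)
  qed auto
  have bnd: "integrable lborel (\<lambda>x. norm (f x - u k x) powr p) \<and>
      (\<integral>x. norm (f x - u k x) powr p \<partial>lborel) \<le> C * 2 powr (- \<eta> * j) * (\<integral>x. enn2real (W x) \<partial>lborel)"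
    if jk: "dyadic j0 j \<le> k" for j k
  proof
    have ae: "AE x in lborel. norm (f x - u k x) powr p \<le> C * 2 powr (- \<eta> * j) * enn2real (W x)"
      using AEW by eventually_elim (rule est[OF _ jk])
    show i: "integrable lborel (\<lambda>x. norm (f x - u k x) powr p)"
      by (rule Bochner_Integration.integrable_bound[OF integrable_mult_right[OF intWr, of "C * 2 powr (- \<eta> * j)"]])
         (use ae in \<open>auto elim!: eventually_mono\<close>)
    have "(\<integral>x. norm (f x - u k x) powr p \<partial>lborel) \<le> (\<integral>x. C * 2 powr (- \<eta> * j) * enn2real (W x) \<partial>lborel)"
      by (intro integral_mono_AE i integrable_mult_right intWr ae)
    thus "(\<integral>x. norm (f x - u k x) powr p \<partial>lborel) \<le> C * 2 powr (- \<eta> * j) * (\<integral>x. enn2real (W x) \<partial>lborel)"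
      by simp
  qed
  have flp: "in_Lp p f"
  proof -
    let ?N = "dyadic j0 0"
    have "norm (f x) powr p \<le> 2 powr p * (norm (f x - u ?N x) powr p + norm (u ?N x) powr p)" for x
      using norm_add_powr_le[of p "f x - u ?N x" "u ?N x"] p by simp
    hence "AE x in lborel. norm (norm (f x) powr p) \<le> norm (2 powr p * (norm (f x - u ?N x) powr p + norm (u ?N x) powr p))"
      by (intro AE_I2) simp
    moreover have "integrable lborel (\<lambda>x. 2 powr p * (norm (f x - u ?N x) powr p + norm (u ?N x) powr p))"
      using bnd[of 0 ?N] u[of ?N] by (intro integrable_mult_right Bochner_Integration.integrable_add) (auto simp: in_Lp_def)
    ultimately have "integrable lborel (\<lambda>x. norm (f x) powr p)"
      by (rule Bochner_Integration.integrable_bound[rotated 2]) measurable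
    thus ?thesis unfolding in_Lp_def by auto
  qed
  have lim: "(\<lambda>N. Lp_norm p (\<lambda>x. u N x - f x)) \<longlonglongrightarrow> 0"
  proof -
    define I where "I N = (\<integral>x. norm (u N x - f x) powr p \<partial>lborel)" for N
    have "I \<longlonglongrightarrow> 0"
    proof (rule LIMSEQ_I)
      fix e :: real assume e: "e > 0"
      let ?K = "C * (\<integral>x. enn2real (W x) \<partial>lborel)"
      have "(\<lambda>j::nat. (2 powr (- \<eta>)) ^ j) \<longlonglongrightarrow> 0" using \<eta> by (intro LIMSEQ_realpow_zero) (auto simp: powr_less_one)
      hence "(\<lambda>j::nat. ?K * (2 powr (- \<eta>)) ^ j) \<longlonglongrightarrow> ?K * 0"
        by (rule tendsto_mult[OF tendsto_const])
      hence "eventually (\<lambda>j. ?K * (2 powr (- \<eta>)) ^ j < e) sequentially" using e by (intro order_tendstoD) auto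
      then obtain j where "?K * (2 powr (- \<eta>)) ^ j < e" by (auto simp: eventually_sequentially)
      moreover have "(2 powr (- \<eta>)) ^ j = 2 powr (- \<eta> * j)" by (simp add: powr_realpow[symmetric] powr_powr)
      ultimately have j: "C * 2 powr (- \<eta> * j) * (\<integral>x. enn2real (W x) \<partial>lborel) < e" by (simp add: mult_ac)
      have "norm (I n - 0) < e" if "dyadic j0 j \<le> n" for n
      proof -
        have "I n \<ge> 0" by (simp add: I_def)
        moreover have "I n < e" using bnd[OF that] j by (simp add: I_def norm_minus_commute)
        ultimately show ?thesis by simp
      qed
      thus "\<exists>no. \<forall>n\<ge>no. norm (I n - 0) < e" by blast
    qed
    moreover have "I N \<ge> 0" for N by (simp add: I_def)
    ultimately have "(\<lambda>N. I N powr (1 / p)) \<longlonglongrightarrow> 0 powr (1 / p)"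
      using p by (intro tendsto_powr2[OF _ tendsto_const]) auto
    thus ?thesis by (simp add: Lp_norm_def I_def)
  qed
  show ?thesis using u flp lim by (auto simp: Lp_tendsto_def)
qed


section \<open>The eigenfunctions and the square function on dyadic blocks\<close>

lemma profile_bounded: "\<exists>K. \<forall>r\<ge>0. \<bar>profile a n r\<bar> \<le> K"
proof -
  have "((\<lambda>r. r powr 0 * profile a n r) \<longlongrightarrow> 0) at_top" by (rule profile_tendsto_0)
  hence "eventually (\<lambda>r. \<bar>r powr 0 * profile a n r\<bar> < 1) at_top"
    by (intro order_tendstoD(2)[OF tendsto_rabs_zero]) auto
  then obtain R where R: "\<And>r. r \<ge> R \<Longrightarrow> \<bar>r powr 0 * profile a n r\<bar> < 1" by (auto simp: eventually_at_top_linorder)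
  define R' where "R' = max R 1"
  have far: "\<bar>profile a n r\<bar> \<le> 1" if "r \<ge> R'" for r using R[of r] that by (simp add: R'_def)
  have "compact (profile a n ` {0..R'})"
    by (intro compact_continuous_image continuous_at_imp_continuous_on ballI DERIV_isCont[OF profile_deriv]) auto
  hence "bounded (profile a n ` {0..R'})" by (rule compact_imp_bounded)
  then obtain K where "\<forall>y\<in>profile a n ` {0..R'}. norm y \<le> K" unfolding bounded_iff by blast
  hence K: "\<bar>profile a n r\<bar> \<le> K" if "r \<in> {0..R'}" for r using that by auto
  show ?thesis
  proof (intro exI[of _ "max K 1"] allI impI)
    fix r :: real assume "r \<ge> 0"
    thus "\<bar>profile a n r\<bar> \<le> max K 1" using far[of r] K[of r] by (cases "r \<le> R'") auto
  qed
qed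

lemma in_Lp_of_bounded_L2:
  fixes p :: real
  assumes u: "in_Lp 2 u" and bd: "\<And>x. norm (u x) \<le> K" and p: "p \<ge> 2"
  shows "in_Lp p u"
proof -
  have m: "u \<in> borel_measurable borel" using u by (simp add: in_Lp2_iff)
  have "integrable lborel (\<lambda>x. K powr (p - 2) * (norm (u x))\<^sup>2)" using u by (simp add: in_Lp2_iff)
  hence "integrable lborel (\<lambda>x. norm (u x) powr p)"
  proof (rule Bochner_Integration.integrable_bound)
    show "AE x in lborel. norm (norm (u x) powr p) \<le> norm (K powr (p - 2) * (norm (u x))\<^sup>2)"
    proof (intro AE_I2)
      fix x
      have "norm (u x) powr p = norm (u x) powr (p - 2) * norm (u x) powr 2" by (simp only: powr_add[symmetric]) simp
      also have "\<dots> \<le> K powr (p - 2) * norm (u x) powr 2"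
        using bd[of x] p by (intro mult_right_mono powr_mono2) auto
      finally show "norm (norm (u x) powr p) \<le> norm (K powr (p - 2) * (norm (u x))\<^sup>2)" by simp
    qed
  qed (use m in simp)
  thus ?thesis using m by (simp add: in_Lp_def)
qed

abbreviation weighted_sum :: "real \<Rightarrow> (nat \<Rightarrow> complex) \<Rightarrow> nat \<Rightarrow> real" where
  "weighted_sum a c \<equiv> \<lambda>N. \<Sum>n\<le>N. real n powr (a - 1) * (norm (c n))\<^sup>2"

locale radial_setup =
  fixes \<psi> :: "nat \<Rightarrow> real^'d \<Rightarrow> complex"
  assumes d: "CARD('d) \<ge> 2" and basis: "radial_eigenbasis \<psi>"
begin

definition a :: real where "a = real CARD('d) / 2"

lemma a_ge1: "a \<ge> 1" using d by (simp add: a_def)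

lemma dim: "real CARD('d) = 2 * a" by (simp add: a_def)

lemma psi_form: "\<psi> n x = \<psi> n 0 * of_real (profile a n (norm x))"
proof -
  have "L2_rad (\<psi> n)" "C2 (\<psi> n)" "\<And>x. harmonic_oscillator (\<psi> n) x = of_nat (4 * n + CARD('d)) * \<psi> n x"
    using basis unfolding radial_eigenbasis_def by blast+
  thus ?thesis unfolding a_def by (rule radial_eigenfunction_eq_profile[OF d])
qed

lemma psi_sq: "(norm (\<psi> n x))\<^sup>2 = (norm (\<psi> n 0))\<^sup>2 * (profile a n (norm x))\<^sup>2"
  unfolding psi_form[of n x] by (simp add: norm_mult power_mult_distrib)

lemma psi_L2: "in_Lp 2 (\<psi> n)" using basis by (simp add: radial_eigenbasis_def L2_rad_def)

lemma psi_measurable [measurable]: "\<psi> n \<in> borel_measurable borel"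
  using psi_L2[of n] by (simp add: in_Lp2_iff)

lemma psi_unit: "integrable lborel (\<lambda>x. (norm (\<psi> n x))\<^sup>2)" "(\<integral>x. (norm (\<psi> n x))\<^sup>2 \<partial>lborel) = 1"
proof -
  show "integrable lborel (\<lambda>x. (norm (\<psi> n x))\<^sup>2)" using psi_L2[of n] by (simp add: in_Lp2_iff)
  have "complex_of_real (\<integral>x. (norm (\<psi> n x))\<^sup>2 \<partial>lborel) = of_real 1"
    unfolding L2_inner_self[symmetric] using basis by (simp add: radial_eigenbasis_def)
  thus "(\<integral>x. (norm (\<psi> n x))\<^sup>2 \<partial>lborel) = 1" by (simp only: of_real_eq_iff)
qed

lemma psi_bounded: "\<exists>K. \<forall>x. norm (\<psi> n x) \<le> K"
proof -
  obtain K where "\<And>r. r \<ge> 0 \<Longrightarrow> \<bar>profile a n r\<bar> \<le> K" using profile_bounded by blast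
  hence "norm (\<psi> n x) \<le> norm (\<psi> n 0) * K" for x
    by (subst psi_form) (auto simp: norm_mult intro!: mult_left_mono)
  thus ?thesis by blast
qed

lemma partial_sum_in_Lp:
  fixes p :: real
  assumes "p \<ge> 2"
  shows "in_Lp p (\<lambda>x. \<Sum>n\<le>(N::nat). b n * \<psi> n x)"
proof -
  obtain K where K: "\<And>n x. norm (\<psi> n x) \<le> K n" using psi_bounded by metis
  have "in_Lp 2 (\<lambda>x. 0 - (\<Sum>n\<le>N. (- b n) * \<psi> n x))"
    by (rule in_Lp2_diff_sum[OF _ psi_L2]) (simp add: in_Lp2_iff)
  hence "in_Lp 2 (\<lambda>x. \<Sum>n\<le>N. b n * \<psi> n x)" by (simp add: sum_negf)
  moreover have "norm (\<Sum>n\<le>N. b n * \<psi> n x) \<le> (\<Sum>n\<le>N. norm (b n) * K n)" for x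
    by (rule sum_norm_le) (auto simp: norm_mult intro!: mult_left_mono K)
  ultimately show ?thesis using assms by (rule in_Lp_of_bounded_L2)
qed

lemma psi_0_bounds:
  obtains C where "C > 0"
    "\<And>n. n \<ge> 1 \<Longrightarrow> (norm (\<psi> n 0))\<^sup>2 \<le> C * real n powr (a - 1)"
    "\<And>n. n \<ge> 1 \<Longrightarrow> real n powr (a - 1) \<le> C * (norm (\<psi> n 0))\<^sup>2"
proof -
  have "a > 0" using a_ge1 by simp
  then obtain C where C: "C > 0" "\<And>n. n \<ge> 1 \<Longrightarrow> pochhammer a n / fact n \<le> C * real n powr (a - 1)"
    "\<And>n. n \<ge> 1 \<Longrightarrow> real n powr (a - 1) \<le> C * (pochhammer a n / fact n)"
    using pochhammer_fact_bounds by blast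
  have e: "(norm (\<psi> n 0))\<^sup>2 = pi powr (- a) * (pochhammer a n / fact n)" for n
    unfolding a_def by (rule eigenfunction_value_at_0[OF d basis])
  have p1: "pi powr (- a) * pi powr a = 1" by (simp add: powr_add[symmetric])
  have le1: "pi powr (- a) \<le> 1"
  proof -
    have "pi powr (- a) \<le> pi powr 0" using \<open>a > 0\<close> pi_gt3 by (intro powr_mono) auto
    thus ?thesis by simp
  qed
  have ge1: "pi powr a \<ge> 1" using \<open>a > 0\<close> pi_gt3 by (intro ge_one_powr_ge_zero) auto
  show ?thesis
  proof (rule that[of "C * pi powr a"])
    fix n :: nat assume n: "n \<ge> 1"
    have "(norm (\<psi> n 0))\<^sup>2 \<le> 1 * (C * real n powr (a - 1))"
      unfolding e using le1 C(2)[OF n] pochhammer_pos[OF \<open>a > 0\<close>, of n] by (intro mult_mono) auto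
    also have "\<dots> \<le> pi powr a * (C * real n powr (a - 1))" using ge1 C(1) by (intro mult_right_mono) auto
    finally show "(norm (\<psi> n 0))\<^sup>2 \<le> C * pi powr a * real n powr (a - 1)" by (simp add: mult_ac)
    have "C * pi powr a * (norm (\<psi> n 0))\<^sup>2 = (pi powr (- a) * pi powr a) * (C * (pochhammer a n / fact n))"
      unfolding e by (simp add: mult_ac)
    thus "real n powr (a - 1) \<le> C * pi powr a * (norm (\<psi> n 0))\<^sup>2" unfolding p1 using C(3)[OF n] by simp
  qed (use C in simp)
qed

text \<open>Near the origin the exponent \<open>\<beta>\<close> may be anything up to \<open>d - 1\<close>: with \<open>y = |x| sqrt n\<close>, both \<open>1\<close> for \<open>y \<le> 1\<close>
and \<open>y^(1-d)\<close> for \<open>y > 1\<close> are at most \<open>y^(-\<beta>)\<close>. Far away, \<open>n^(a-1)\<close> times the decay of the profile is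
\<open>n^(-1/3)\<close> in every dimension.\<close>

lemma psi_upper_bounds:
  obtains C where "C > 0"
    "\<And>n x \<beta>. n \<ge> CARD('d) \<Longrightarrow> 0 < norm x \<Longrightarrow> norm x \<le> 1 \<Longrightarrow> 0 \<le> \<beta> \<Longrightarrow> \<beta> \<le> 2 * a - 1 \<Longrightarrow>
        (norm (\<psi> n x))\<^sup>2 \<le> C * real n powr (a - 1) * (norm x * sqrt n) powr (- \<beta>)"
    "\<And>n x. n \<ge> CARD('d) \<Longrightarrow> 1 \<le> norm x \<Longrightarrow> (norm (\<psi> n x))\<^sup>2 \<le> C * real n powr (- 1/3)"
proof -
  obtain C0 where C0: "C0 > 0" "\<And>n. n \<ge> 1 \<Longrightarrow> (norm (\<psi> n 0))\<^sup>2 \<le> C0 * real n powr (a - 1)"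
    "\<And>n. n \<ge> 1 \<Longrightarrow> real n powr (a - 1) \<le> C0 * (norm (\<psi> n 0))\<^sup>2"
    by (rule psi_0_bounds) (rule that)
  define K where "K = 2 + 24 * (2 * a) powr (2 * a - 1) + 96 * (4 * a) powr (2 * a - 1)"
  have K: "K \<ge> 2" "K \<ge> 24 * (2 * a) powr (2 * a - 1)" "K \<ge> 96 * (4 * a) powr (2 * a - 1)"
    by (simp_all add: K_def add_nonneg_nonneg)
  show ?thesis
  proof (rule that[of "C0 * K"])
    fix n :: nat and x :: "real^'d" and \<beta> :: real
    assume n: "n \<ge> CARD('d)" and x: "0 < norm x" "norm x \<le> 1" and \<beta>: "0 \<le> \<beta>" "\<beta> \<le> 2 * a - 1"
    have n2: "real n \<ge> 2 * a" "n \<ge> 2" using n d by (simp_all add: a_def)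
    let ?r = "norm x" and ?\<Lambda> = "4 * real n + 2 * a"
    have L: "?\<Lambda> \<ge> 4" "?\<Lambda> \<ge> real n" using n2 a_ge1 by linarith+
    have "sqrt 4 \<le> sqrt ?\<Lambda>" using L by (intro real_sqrt_le_mono)
    hence rl: "?r \<le> sqrt ?\<Lambda> / 2" using x by simp
    have sn: "sqrt n > 0" using n2 by simp
    let ?y = "?r * sqrt n"
    have y: "?y > 0" using x sn by simp
    have r2: "?r\<^sup>2 \<le> 1" using x power_le_one[of ?r 2] by simp
    have p2: "(profile a n ?r)\<^sup>2 \<le> 2" using a_ge1 L r2 by (intro profile_sq_le_2) auto
    have "(profile a n ?r)\<^sup>2 \<le> 24 * (2 * a) powr (2 * a - 1) * (?r * sqrt ?\<Lambda>) powr (- (2 * a - 1))"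
      by (rule profile_sq_le_near[OF a_ge1 n2(1) x(1) rl])
    also have "\<dots> \<le> 24 * (2 * a) powr (2 * a - 1) * ?y powr (- (2 * a - 1))"
      using y L x a_ge1 by (intro mult_left_mono powr_mono2') auto
    finally have pn: "(profile a n ?r)\<^sup>2 \<le> 24 * (2 * a) powr (2 * a - 1) * ?y powr (- (2 * a - 1))" .
    have "(profile a n ?r)\<^sup>2 \<le> K * ?y powr (- \<beta>)"
    proof (cases "?y \<le> 1")
      case True
      have "1 \<le> ?y powr (- \<beta>)" using powr_mono2'[of "- \<beta>" ?y 1, OF _ y True] \<beta> by simp
      hence "2 * 1 \<le> K * ?y powr (- \<beta>)" using K by (intro mult_mono) auto
      thus ?thesis using p2 by simp
    next
      case False
      have "?y powr (- (2 * a - 1)) \<le> ?y powr (- \<beta>)" using False \<beta> by (intro powr_mono) auto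
      hence "24 * (2 * a) powr (2 * a - 1) * ?y powr (- (2 * a - 1)) \<le> K * ?y powr (- \<beta>)"
        using K by (intro mult_mono) auto
      thus ?thesis using pn by simp
    qed
    hence "(norm (\<psi> n 0))\<^sup>2 * (profile a n ?r)\<^sup>2 \<le> (C0 * real n powr (a - 1)) * (K * ?y powr (- \<beta>))"
      using C0 n2 by (intro mult_mono) auto
    thus "(norm (\<psi> n x))\<^sup>2 \<le> C0 * K * real n powr (a - 1) * (norm x * sqrt n) powr (- \<beta>)"
      unfolding psi_sq[of n x] by (simp add: mult_ac)
  next
    fix n :: nat and x :: "real^'d"
    assume n: "n \<ge> CARD('d)" and x: "1 \<le> norm x"
    have n2: "real n \<ge> 2 * a" "n \<ge> 2" using n d by (simp_all add: a_def)
    let ?\<Lambda> = "4 * real n + 2 * a"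
    have L: "?\<Lambda> \<ge> real n" using a_ge1 by simp
    have "(profile a n (norm x))\<^sup>2 \<le> 96 * (4 * a) powr (2 * a - 1) * ?\<Lambda> powr (1/6 - (2 * a - 1) / 2)"
      by (rule profile_sq_le_far[OF a_ge1 n2(1) x])
    also have "\<dots> \<le> K * real n powr (1/6 - (2 * a - 1) / 2)"
      using K L n2 a_ge1 by (intro mult_mono powr_mono2') auto
    finally have "(norm (\<psi> n 0))\<^sup>2 * (profile a n (norm x))\<^sup>2
        \<le> (C0 * real n powr (a - 1)) * (K * real n powr (1/6 - (2 * a - 1) / 2))"
      using C0 n2 by (intro mult_mono) auto
    also have "\<dots> = C0 * K * (real n powr (a - 1) * real n powr (1/6 - (2 * a - 1) / 2))" by (simp add: mult_ac)
    also have "real n powr (a - 1) * real n powr (1/6 - (2 * a - 1) / 2) = real n powr (- 1/3)"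
      by (simp only: powr_add[symmetric], rule arg_cong[where f = "\<lambda>y. real n powr y"]) (simp add: field_simps)
    finally show "(norm (\<psi> n x))\<^sup>2 \<le> C0 * K * real n powr (- 1/3)" unfolding psi_sq[of n x] .
  qed (use C0 K in simp)
qed

text \<open>On this ball the profile is at least \<open>1 / 2\<close>, so the value at the origin decides. For \<open>n = 0\<close> the
left-hand side is \<open>0\<close>, even if \<open>a = 1\<close>, because every power of \<open>0\<close> is \<open>0\<close> by convention.\<close>

lemma psi_lower_near_0:
  "\<exists>C>0. \<forall>n N x. n \<le> N \<longrightarrow> N \<ge> 1 \<longrightarrow> norm x \<le> 1 / (2 * sqrt (real N)) \<longrightarrow> real n powr (a - 1) \<le> C * (norm (\<psi> n x))\<^sup>2"
proof -
  obtain C where C: "C > 0" "\<And>n. n \<ge> 1 \<Longrightarrow> (norm (\<psi> n 0))\<^sup>2 \<le> C * real n powr (a - 1)"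
    "\<And>n. n \<ge> 1 \<Longrightarrow> real n powr (a - 1) \<le> C * (norm (\<psi> n 0))\<^sup>2"
    by (rule psi_0_bounds) (rule that)
  show ?thesis
  proof (intro exI[of _ "4 * C"] conjI allI impI)
    fix n N :: nat and x :: "real^'d"
    assume n: "n \<le> N" and N: "N \<ge> 1" and x: "norm x \<le> 1 / (2 * sqrt (real N))"
    have "(norm x)\<^sup>2 \<le> (1 / (2 * sqrt N))\<^sup>2" using x by (intro power_mono) auto
    hence r: "(norm x)\<^sup>2 \<le> 1 / (4 * real N)" by (simp add: power_divide power_mult_distrib)
    have r1: "(norm x)\<^sup>2 \<le> 1/4"
    proof -
      have "1 / (4 * real N) \<le> 1 / 4" using N by (intro divide_left_mono) auto
      thus ?thesis using r by linarith
    qed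
    have r2: "real n * (norm x)\<^sup>2 \<le> 1/4"
    proof -
      have "real n * (norm x)\<^sup>2 \<le> real N * (1 / (4 * real N))" using r n by (intro mult_mono) auto
      thus ?thesis using N by simp
    qed
    have "1/2 \<le> profile a n (norm x)" by (rule profile_lower[OF a_ge1 r2 r1])
    hence p2: "(1/2)\<^sup>2 \<le> (profile a n (norm x))\<^sup>2" by (intro power_mono) auto
    show "real n powr (a - 1) \<le> 4 * C * (norm (\<psi> n x))\<^sup>2"
    proof (cases "n = 0")
      case True
      thus ?thesis using C by simp
    next
      case False
      have "real n powr (a - 1) \<le> C * (norm (\<psi> n 0))\<^sup>2" using C(3) False by simp
      also have "\<dots> = 4 * C * ((norm (\<psi> n 0))\<^sup>2 * (1/2)\<^sup>2)" by (simp add: power2_eq_square)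
      also have "\<dots> \<le> 4 * C * ((norm (\<psi> n 0))\<^sup>2 * (profile a n (norm x))\<^sup>2)"
        using C(1) p2 by (intro mult_left_mono) auto
      finally show ?thesis unfolding psi_sq[of n x] .
    qed
  qed (use C in simp)
qed

abbreviation block_square :: "(nat \<Rightarrow> complex) \<Rightarrow> nat \<Rightarrow> real^'d \<Rightarrow> real" where
  "block_square c N x \<equiv> \<Sum>n\<in>{N<..2*N}. (norm (c n))\<^sup>2 * (norm (\<psi> n x))\<^sup>2"

text \<open>On the block the square function is at most \<open>N^(\<alpha> - \<beta>/2) |x|^(-\<beta>)\<close> up to a constant, and the condition on
\<open>\<beta>\<close> makes \<open>|x|^(-\<beta> p / 2)\<close> integrable at the origin.\<close>

lemma nn_integral_block_near:
  fixes p \<alpha> \<beta> :: real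
  assumes C: "\<And>n x. n \<ge> CARD('d) \<Longrightarrow> 0 < norm x \<Longrightarrow> norm x \<le> 1 \<Longrightarrow>
        (norm (\<psi> n x))\<^sup>2 \<le> C * real n powr (a - 1) * (norm x * sqrt n) powr (- \<beta>)" "C \<ge> 0"
    and \<beta>: "\<beta> \<ge> 0" "\<beta> * p / 2 < 2 * a" and p: "p > 2"
    and A: "\<And>N::nat. N \<ge> 1 \<Longrightarrow> weighted_sum a c N \<le> A * real N powr \<alpha>" "A \<ge> 0"
  shows "\<exists>K\<ge>0. \<forall>N\<ge>CARD('d).
     (\<integral>\<^sup>+x. indicator {x. norm x \<le> 1} x * ennreal (block_square c N x powr (p / 2)) \<partial>lborel)
       \<le> ennreal (K * real N powr (- ((\<beta> / 2 - \<alpha>) * p / 2)))"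
proof -
  define \<kappa> where "\<kappa> = pi powr a / Gamma a"
  have a0: "a > 0" using a_ge1 by simp
  have \<kappa>: "\<kappa> \<ge> 0" using Gamma_real_pos[OF a0] by (simp add: \<kappa>_def)
  define e where "e = a - 1 - \<beta> * p / 4"
  have e: "e > -1" using \<beta> by (simp add: e_def)
  have int: "(\<integral>\<^sup>+x. indicator {x :: real^'d. norm x \<le> 1} x * ennreal (norm x powr (- \<beta> * p / 2)) \<partial>lborel) \<le> ennreal (\<kappa> / (e + 1))"
  proof -
    have "(\<integral>\<^sup>+x. indicator {x :: real^'d. norm x \<le> 1} x * ennreal (norm x powr (- \<beta> * p / 2)) \<partial>lborel)
       = (\<integral>\<^sup>+(x :: real^'d). (\<lambda>y. indicator {..1} y * ennreal (y powr (- \<beta> * p / 4))) ((norm x)\<^sup>2) \<partial>lborel)"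
    proof (rule nn_integral_cong)
      fix x :: "real^'d"
      have "norm x powr (- \<beta> * p / 2) = (norm x)\<^sup>2 powr (- \<beta> * p / 4)"
        by (cases "x = 0") (simp_all add: powr_powr flip: powr_numeral)
      moreover have "norm x \<le> 1 \<longleftrightarrow> (norm x)\<^sup>2 \<le> 1"
        using abs_square_le_1[of "norm x"] by simp
      ultimately show "indicator {x :: real^'d. norm x \<le> 1} x * ennreal (norm x powr (- \<beta> * p / 2))
        = (\<lambda>y. indicator {..1} y * ennreal (y powr (- \<beta> * p / 4))) ((norm x)\<^sup>2)"
        by (simp add: indicator_def)
    qed
    also have "\<dots> = (\<integral>\<^sup>+y. ennreal (indicator {0..} y * (\<kappa> * y powr (a - 1))) * (indicator {..1} y * ennreal (y powr (- \<beta> * p / 4))) \<partial>lborel)"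
      by (subst nn_integral_norm_sq) (simp_all add: a_def \<kappa>_def)
    also have "\<dots> = (\<integral>\<^sup>+y. ennreal (indicator {0..1} y * (\<kappa> * y powr e)) \<partial>lborel)"
    proof (rule nn_integral_cong)
      fix y :: real
      have "y powr e = y powr (a - 1) * y powr (- \<beta> * p / 4)" by (simp add: e_def flip: powr_add)
      thus "ennreal (indicator {0..} y * (\<kappa> * y powr (a - 1))) * (indicator {..1} y * ennreal (y powr (- \<beta> * p / 4)))
          = ennreal (indicator {0..1} y * (\<kappa> * y powr e))"
        using \<kappa> by (auto simp: indicator_def ennreal_mult[symmetric] mult_ac)
    qed
    also have "\<dots> = ennreal (\<kappa> * (1 powr (e + 1) / (e + 1)))"
    proof (rule nn_integral_has_integral_lebesgue)
      show "((\<lambda>y. \<kappa> * y powr e) has_integral \<kappa> * (1 powr (e + 1) / (e + 1))) {0..1}"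
        by (intro has_integral_mult_right has_integral_powr_from_0) (use e in auto)
    qed (use \<kappa> in auto)
    finally show ?thesis by simp
  qed
  define K0 where "K0 = (C * A * 2 powr \<alpha>) powr (p / 2)"
  show ?thesis
  proof (intro exI[of _ "K0 * (\<kappa> / (e + 1))"] conjI allI impI)
    show "0 \<le> K0 * (\<kappa> / (e + 1))" using \<kappa> e by (simp add: K0_def)
    fix N assume N: "CARD('d) \<le> N"
    hence N1: "N \<ge> 1" using d by linarith
    let ?E = "- ((\<beta> / 2 - \<alpha>) * p / 2)"
    have pt: "block_square c N x powr (p / 2) \<le> (K0 * real N powr ?E) * norm x powr (- \<beta> * p / 2)"
      if x: "0 < norm x" "norm x \<le> 1" for x
    proof -
      have "block_square c N x
         \<le> (\<Sum>n\<in>{N<..2*N}. (norm (c n))\<^sup>2 * (C * real n powr (a - 1) * (norm x * sqrt N) powr (- \<beta>)))"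
      proof (intro sum_mono mult_left_mono)
        fix n assume n: "n \<in> {N<..2*N}"
        have "(norm (\<psi> n x))\<^sup>2 \<le> C * real n powr (a - 1) * (norm x * sqrt n) powr (- \<beta>)"
          by (rule C(1)) (use n N x in auto)
        also have "\<dots> \<le> C * real n powr (a - 1) * (norm x * sqrt N) powr (- \<beta>)"
          using n x N1 C(2) \<beta> by (intro mult_left_mono powr_mono2') auto
        finally show "(norm (\<psi> n x))\<^sup>2 \<le> C * real n powr (a - 1) * (norm x * sqrt N) powr (- \<beta>)" .
      qed auto
      also have "\<dots> = C * (norm x * sqrt N) powr (- \<beta>) * (\<Sum>n\<in>{N<..2*N}. real n powr (a - 1) * (norm (c n))\<^sup>2)"
        by (simp add: sum_distrib_left mult_ac)
      also have "\<dots> \<le> C * (norm x * sqrt N) powr (- \<beta>) * (A * real (2 * N) powr \<alpha>)"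
      proof (rule mult_left_mono)
        have "(\<Sum>n\<in>{N<..2*N}. real n powr (a - 1) * (norm (c n))\<^sup>2) \<le> (\<Sum>n\<le>2*N. real n powr (a - 1) * (norm (c n))\<^sup>2)"
          by (intro sum_mono2) auto
        also have "\<dots> \<le> A * real (2 * N) powr \<alpha>" by (rule A(1)) (use N1 in simp)
        finally show "(\<Sum>n\<in>{N<..2*N}. real n powr (a - 1) * (norm (c n))\<^sup>2) \<le> A * real (2 * N) powr \<alpha>" .
      qed (use C in auto)
      also have "\<dots> = (C * A * 2 powr \<alpha>) * (real N powr (\<alpha> - \<beta> / 2) * norm x powr (- \<beta>))"
      proof -
        have "(norm x * sqrt N) powr (- \<beta>) = norm x powr (- \<beta>) * real N powr (- \<beta> / 2)"
          using N1 by (simp add: powr_mult powr_half_sqrt[symmetric] powr_powr)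
        moreover have "real (2 * N) powr \<alpha> = 2 powr \<alpha> * real N powr \<alpha>" by (simp add: powr_mult)
        moreover have "real N powr (\<alpha> - \<beta> / 2) = real N powr \<alpha> * real N powr (- \<beta> / 2)" by (simp flip: powr_add)
        ultimately show ?thesis by (simp add: mult_ac)
      qed
      finally have "block_square c N x powr (p / 2)
         \<le> ((C * A * 2 powr \<alpha>) * (real N powr (\<alpha> - \<beta> / 2) * norm x powr (- \<beta>))) powr (p / 2)"
        using p by (intro powr_mono2 sum_nonneg) auto
      also have "\<dots> = K0 * ((real N powr (\<alpha> - \<beta> / 2)) powr (p / 2) * (norm x powr (- \<beta>)) powr (p / 2))"
        using C A by (simp add: powr_mult K0_def)
      also have "(real N powr (\<alpha> - \<beta> / 2)) powr (p / 2) = real N powr ?E"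
        by (simp add: powr_powr algebra_simps diff_divide_distrib)
      also have "(norm x powr (- \<beta>)) powr (p / 2) = norm x powr (- \<beta> * p / 2)" by (simp add: powr_powr)
      finally show ?thesis by (simp add: mult_ac)
    qed
    have "(\<integral>\<^sup>+x. indicator {x. norm x \<le> 1} x * ennreal (block_square c N x powr (p / 2)) \<partial>lborel)
      \<le> (\<integral>\<^sup>+x. ennreal (K0 * real N powr ?E) * (indicator {x :: real^'d. norm x \<le> 1} x * ennreal (norm x powr (- \<beta> * p / 2))) \<partial>lborel)"
    proof (rule nn_integral_mono_AE)
      have "AE x :: real^'d in lborel. x \<noteq> 0" by (rule AE_lborel_singleton)
      thus "AE x in lborel. indicator {x. norm x \<le> 1} x * ennreal (block_square c N x powr (p / 2))
         \<le> ennreal (K0 * real N powr ?E) * (indicator {x :: real^'d. norm x \<le> 1} x * ennreal (norm x powr (- \<beta> * p / 2)))"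
      proof eventually_elim
        case (elim x)
        show ?case
        proof (cases "norm x \<le> 1")
          case True
          hence "ennreal (block_square c N x powr (p / 2))
              \<le> ennreal ((K0 * real N powr ?E) * norm x powr (- \<beta> * p / 2))"
            using elim by (intro ennreal_leI pt) auto
          thus ?thesis using True by (simp add: K0_def ennreal_mult[symmetric])
        qed simp
      qed
    qed
    also have "\<dots> = ennreal (K0 * real N powr ?E) * (\<integral>\<^sup>+x. indicator {x :: real^'d. norm x \<le> 1} x * ennreal (norm x powr (- \<beta> * p / 2)) \<partial>lborel)"
      by (rule nn_integral_cmult) measurable
    also have "\<dots> \<le> ennreal (K0 * real N powr ?E) * ennreal (\<kappa> / (e + 1))" by (rule mult_left_mono[OF int]) simp
    finally show "(\<integral>\<^sup>+x. indicator {x. norm x \<le> 1} x * ennreal (block_square c N x powr (p / 2)) \<partial>lborel)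
       \<le> ennreal (K0 * (\<kappa> / (e + 1)) * real N powr ?E)"
      using \<kappa> e by (simp add: K0_def ennreal_mult[symmetric] mult_ac)
  qed
qed

text \<open>Interpolation between the supremum of the square function for \<open>|x| \<ge> 1\<close>, which carries the decay
\<open>N^(-1/3)\<close>, and its integral, which is the sum of \<open>|c\<^sub>n|^2\<close> over the block because the
eigenfunctions have norm one.\<close>

lemma nn_integral_block_far:
  fixes p \<epsilon> :: real
  assumes C: "\<And>n x. n \<ge> CARD('d) \<Longrightarrow> 1 \<le> norm x \<Longrightarrow> (norm (\<psi> n x))\<^sup>2 \<le> C * real n powr (- 1/3)" "C \<ge> 0"
    and p: "p > 2"
    and B: "\<And>N. N \<ge> 1 \<Longrightarrow> (\<Sum>n\<le>N. (norm (c n))\<^sup>2) \<le> B * real N powr \<epsilon>" "B \<ge> 0"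
  shows "\<exists>K\<ge>0. \<forall>N\<ge>CARD('d).
     (\<integral>\<^sup>+x. indicator {x. 1 \<le> norm x} x * ennreal (block_square c N x powr (p / 2)) \<partial>lborel)
       \<le> ennreal (K * real N powr (- ((p - 2) / 6 - \<epsilon> * p / 2)))"
proof -
  let ?B = "B * 2 powr \<epsilon>"
  let ?K = "C powr (p/2 - 1) * ?B powr (p / 2)"
  show ?thesis
  proof (intro exI[of _ ?K] conjI allI impI)
    fix N assume N: "CARD('d) \<le> N"
    hence N1: "N \<ge> 1" using d by linarith
    let ?G = "\<lambda>x. \<Sum>n\<in>{N<..2*N}. (norm (c n))\<^sup>2 * (norm (\<psi> n x))\<^sup>2"
    define T where "T = (\<Sum>n\<in>{N<..2*N}. (norm (c n))\<^sup>2)"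
    have T0: "T \<ge> 0" by (simp add: T_def sum_nonneg)
    have "T \<le> (\<Sum>n\<le>2*N. (norm (c n))\<^sup>2)" unfolding T_def by (intro sum_mono2) auto
    also have "\<dots> \<le> B * real (2 * N) powr \<epsilon>" by (rule B(1)) (use N1 in simp)
    finally have T: "T \<le> ?B * real N powr \<epsilon>" by (simp add: powr_mult mult_ac)
    have G0: "?G x \<ge> 0" for x by (intro sum_nonneg) auto
    have Gle: "?G x \<le> C * real N powr (- 1/3) * T" if "1 \<le> norm x" for x
    proof -
      have "?G x \<le> (\<Sum>n\<in>{N<..2*N}. (norm (c n))\<^sup>2 * (C * real N powr (- 1/3)))"
      proof (intro sum_mono mult_left_mono)
        fix n assume n: "n \<in> {N<..2*N}"
        have "(norm (\<psi> n x))\<^sup>2 \<le> C * real n powr (- 1/3)" by (rule C(1)) (use n N that in auto)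
        also have "\<dots> \<le> C * real N powr (- 1/3)" using n N1 C(2) by (intro mult_left_mono powr_mono2') auto
        finally show "(norm (\<psi> n x))\<^sup>2 \<le> C * real N powr (- 1/3)" .
      qed auto
      also have "\<dots> = C * real N powr (- 1/3) * T" by (simp add: T_def sum_distrib_left mult_ac)
      finally show ?thesis .
    qed
    have iG: "integrable lborel ?G" "(\<integral>x. ?G x \<partial>lborel) = T"
      using psi_unit by (simp_all add: T_def)
    have "(\<integral>\<^sup>+x. indicator {x. 1 \<le> norm x} x * ennreal (?G x powr (p / 2)) \<partial>lborel)
       \<le> (\<integral>\<^sup>+x. ennreal ((C * real N powr (- 1/3) * T) powr (p/2 - 1)) * ennreal (?G x) \<partial>lborel)"
    proof (rule nn_integral_mono)
      fix x
      show "indicator {x. 1 \<le> norm x} x * ennreal (?G x powr (p / 2)) \<le> ennreal ((C * real N powr (- 1/3) * T) powr (p/2 - 1)) * ennreal (?G x)"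
      proof (cases "1 \<le> norm x")
        case True
        have "?G x powr (p / 2) = ?G x powr (p/2 - 1) * ?G x powr 1" by (simp only: powr_add[symmetric]) simp
        also have "\<dots> \<le> (C * real N powr (- 1/3) * T) powr (p/2 - 1) * ?G x"
          using Gle[OF True] G0[of x] p by (intro mult_mono powr_mono2) auto
        finally show ?thesis using True G0[of x] by (simp add: ennreal_mult[symmetric] ennreal_leI)
      qed simp
    qed
    also have "\<dots> = ennreal ((C * real N powr (- 1/3) * T) powr (p/2 - 1)) * (\<integral>\<^sup>+x. ennreal (?G x) \<partial>lborel)"
      by (rule nn_integral_cmult) measurable
    also have "(\<integral>\<^sup>+x. ennreal (?G x) \<partial>lborel) = ennreal T"
      using nn_integral_eq_integral[OF iG(1)] G0 iG(2) by simp
    also have "ennreal ((C * real N powr (- 1/3) * T) powr (p/2 - 1)) * ennreal T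
       = ennreal ((C * real N powr (- 1/3) * T) powr (p/2 - 1) * T)" using T0 by (simp add: ennreal_mult[symmetric])
    also have "\<dots> \<le> ennreal (?K * real N powr (- ((p - 2) / 6 - \<epsilon> * p / 2)))"
    proof (rule ennreal_leI)
      have "(C * real N powr (- 1/3) * T) powr (p/2 - 1) * T = C powr (p/2 - 1) * real N powr (- (p - 2) / 6) * (T powr (p/2 - 1) * T powr 1)"
      proof -
        have e: "(- 1/3) * (p/2 - 1) = - (p - 2) / 6" by (simp add: field_simps)
        have "(real N powr (- 1/3)) powr (p/2 - 1) = real N powr (- (p - 2) / 6)" by (simp only: powr_powr e)
        moreover have "(C * real N powr (- 1/3) * T) powr (p/2 - 1) = C powr (p/2 - 1) * (real N powr (- 1/3)) powr (p/2 - 1) * T powr (p/2 - 1)"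
          using C T0 by (simp only: powr_mult mult_nonneg_nonneg powr_ge_zero)
        ultimately show ?thesis using T0 by simp
      qed
      also have "T powr (p/2 - 1) * T powr 1 = T powr (p / 2)" by (simp only: powr_add[symmetric]) simp
      also have "T powr (p / 2) \<le> (?B * real N powr \<epsilon>) powr (p / 2)" using T T0 p by (intro powr_mono2) auto
      also have "\<dots> = ?B powr (p / 2) * real N powr (\<epsilon> * p / 2)" using B by (simp add: powr_mult powr_powr)
      finally have "(C * real N powr (- 1/3) * T) powr (p/2 - 1) * T
         \<le> C powr (p/2 - 1) * real N powr (- (p - 2) / 6) * (?B powr (p / 2) * real N powr (\<epsilon> * p / 2))"
        by (simp add: mult_left_mono)
      also have "\<dots> = ?K * (real N powr (- (p - 2) / 6) * real N powr (\<epsilon> * p / 2))" by (simp add: mult_ac)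
      also have "real N powr (- (p - 2) / 6) * real N powr (\<epsilon> * p / 2) = real N powr (- ((p - 2) / 6 - \<epsilon> * p / 2))"
        by (simp only: powr_add[symmetric], rule arg_cong[where f = "\<lambda>y. real N powr y"]) (simp add: field_simps)
      finally show "(C * real N powr (- 1/3) * T) powr (p/2 - 1) * T \<le> ?K * real N powr (- ((p - 2) / 6 - \<epsilon> * p / 2))" .
    qed
    finally show "(\<integral>\<^sup>+x. indicator {x. 1 \<le> norm x} x * ennreal (?G x powr (p / 2)) \<partial>lborel)
       \<le> ennreal (?K * real N powr (- ((p - 2) / 6 - \<epsilon> * p / 2)))" .
  qed auto
qed

end


text \<open>As \<open>N^\<alpha> \<ge> 1\<close>, the finitely many exceptional indices are absorbed by the constant.\<close>

lemma bigo_bound_all: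
  fixes s :: "nat \<Rightarrow> real"
  assumes "s \<in> O(\<lambda>N. real N powr \<alpha>)" "\<alpha> > 0" "mono s" "s 0 \<ge> 0"
  shows "\<exists>A\<ge>0. \<forall>N\<ge>1. s N \<le> A * real N powr \<alpha>"
proof -
  obtain C where C: "C > 0" "eventually (\<lambda>N. norm (s N) \<le> C * norm (real N powr \<alpha>)) at_top"
    using assms(1) by (rule landau_o.bigE)
  then obtain N0 where N0: "\<And>N. N \<ge> N0 \<Longrightarrow> \<bar>s N\<bar> \<le> C * real N powr \<alpha>" by (auto simp: eventually_at_top_linorder)
  have s0: "s N \<ge> 0" for N using monoD[OF assms(3), of 0 N] assms(4) by simp
  show ?thesis
  proof (intro exI[of _ "C + s N0"] conjI allI impI)
    fix N :: nat assume N: "N \<ge> 1"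
    have g1: "real N powr \<alpha> \<ge> 1" using N assms(2) by (intro ge_one_powr_ge_zero) auto
    show "s N \<le> (C + s N0) * real N powr \<alpha>"
    proof (cases "N \<ge> N0")
      case True
      hence "s N \<le> C * real N powr \<alpha>" using N0[of N] by simp
      also have "\<dots> \<le> (C + s N0) * real N powr \<alpha>" using s0 by (intro mult_right_mono) auto
      finally show ?thesis .
    next
      case False
      hence "s N \<le> s N0 * 1" using monoD[OF assms(3), of N N0] by simp
      also have "\<dots> \<le> (C + s N0) * real N powr \<alpha>" using s0 g1 C by (intro mult_mono) auto
      finally show ?thesis .
    qed
  qed (use C s0 in auto)
qed

text \<open>On \<open>n \<le> N\<close> the weight \<open>(4 n + d)^(-\<epsilon>)\<close> is at least a constant times \<open>N^(-\<epsilon>)\<close>.\<close>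

lemma Hs_partial_sums:
  assumes "in_Hs_rad d (- \<epsilon>) c" "\<epsilon> > 0"
  shows "\<exists>B\<ge>0. \<forall>N\<ge>1. (\<Sum>n\<le>N. (norm (c n))\<^sup>2) \<le> B * real N powr \<epsilon>"
proof -
  let ?f = "\<lambda>n. real (4 * n + d) powr (- \<epsilon>) * (norm (c n))\<^sup>2"
  define m where "m = real (4 + d)"
  have sm: "summable ?f" using assms by (simp add: in_Hs_rad_def)
  have f0: "?f n \<ge> 0" for n by simp
  show ?thesis
  proof (intro exI[of _ "m powr \<epsilon> * suminf ?f + (norm (c 0))\<^sup>2"] conjI allI impI)
    show "0 \<le> m powr \<epsilon> * suminf ?f + (norm (c 0))\<^sup>2" using suminf_nonneg[OF sm f0] by simp
    fix N :: nat assume N: "N \<ge> 1"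
    have "(\<Sum>n\<le>N. (norm (c n))\<^sup>2) = (norm (c 0))\<^sup>2 + (\<Sum>n\<in>{1..N}. (norm (c n))\<^sup>2)"
      by (subst sum.atMost_shift) (simp add: sum.atLeast1_atMost_eq[symmetric] sum.atLeast1_atMost_eq)
    also have "(\<Sum>n\<in>{1..N}. (norm (c n))\<^sup>2) \<le> (\<Sum>n\<in>{1..N}. (m * real N) powr \<epsilon> * ?f n)"
    proof (rule sum_mono)
      fix n assume n: "n \<in> {1..N}"
      have "real (4 * n + d) \<le> m * real N"
      proof -
        have "4 * n + d \<le> 4 * N + d * N" using n N by (intro add_mono) auto
        hence "real (4 * n + d) \<le> real ((4 + d) * N)" by (simp only: of_nat_le_iff distrib_right)
        thus ?thesis by (simp add: m_def)
      qed
      hence "real (4 * n + d) powr \<epsilon> \<le> (m * real N) powr \<epsilon>" using assms n by (intro powr_mono2) auto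
      hence "(real (4 * n + d) powr \<epsilon> * real (4 * n + d) powr (- \<epsilon>)) * (norm (c n))\<^sup>2 \<le> (m * real N) powr \<epsilon> * ?f n"
        unfolding mult.assoc[symmetric] by (intro mult_right_mono) auto
      moreover have "real (4 * n + d) powr \<epsilon> * real (4 * n + d) powr (- \<epsilon>) = 1" using n by (simp add: powr_add[symmetric])
      ultimately show "(norm (c n))\<^sup>2 \<le> (m * real N) powr \<epsilon> * ?f n" by simp
    qed
    also have "\<dots> = (m * real N) powr \<epsilon> * (\<Sum>n\<in>{1..N}. ?f n)" by (rule sum_distrib_left[symmetric])
    also have "\<dots> \<le> (m * real N) powr \<epsilon> * suminf ?f"
      by (intro mult_left_mono sum_le_suminf[OF sm]) auto
    also have "(m * real N) powr \<epsilon> * suminf ?f = m powr \<epsilon> * suminf ?f * real N powr \<epsilon>"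
      by (simp add: powr_mult m_def)
    also have "(norm (c 0))\<^sup>2 + m powr \<epsilon> * suminf ?f * real N powr \<epsilon> \<le> (m powr \<epsilon> * suminf ?f + (norm (c 0))\<^sup>2) * real N powr \<epsilon>"
    proof -
      have "real N powr \<epsilon> \<ge> 1" using N assms(2) by (intro ge_one_powr_ge_zero) auto
      hence "(norm (c 0))\<^sup>2 * 1 \<le> (norm (c 0))\<^sup>2 * real N powr \<epsilon>" by (intro mult_left_mono) auto
      thus ?thesis by (simp add: distrib_right)
    qed
    finally show "(\<Sum>n\<le>N. (norm (c n))\<^sup>2) \<le> (m powr \<epsilon> * suminf ?f + (norm (c 0))\<^sup>2) * real N powr \<epsilon>" by simp
  qed
qed

abbreviation growth_exponents :: "nat \<Rightarrow> (nat \<Rightarrow> complex) \<Rightarrow> real set" where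
  "growth_exponents d c \<equiv> {\<alpha>. \<alpha> > 0 \<and> weighted_sum (real d / 2) c \<in> O(\<lambda>N. real N powr \<alpha>)}"

text \<open>Thus \<open>\<alpha>\<^sub>\<star> \<le> d / 2 - 1\<close>; this both shows that the infimum is over a nonempty set and keeps \<open>2 \<alpha>\<close> below
the decay exponent \<open>d - 1\<close> of the eigenfunctions.\<close>

lemma growth_exponent_of_Hs:
  fixes d :: nat
  assumes "in_Hs_rad d (- \<epsilon>) c" "\<epsilon> > 0" "d \<ge> 2"
  shows "real d / 2 - 1 + \<epsilon> \<in> growth_exponents d c"
proof -
  obtain B where B: "B \<ge> 0" "\<And>N. N \<ge> 1 \<Longrightarrow> (\<Sum>n\<le>N. (norm (c n))\<^sup>2) \<le> B * real N powr \<epsilon>"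
    using Hs_partial_sums[OF assms(1,2)] by blast
  have "(\<lambda>N. \<Sum>n\<le>N. real n powr (real d / 2 - 1) * (norm (c n))\<^sup>2) \<in> O(\<lambda>N. real N powr (real d / 2 - 1 + \<epsilon>))"
  proof (rule landau_o.bigI[of "B + 1"])
    show "eventually (\<lambda>N. norm (\<Sum>n\<le>N. real n powr (real d / 2 - 1) * (norm (c n))\<^sup>2) \<le> (B + 1) * norm (real N powr (real d / 2 - 1 + \<epsilon>))) at_top"
      using eventually_ge_at_top[of 1]
    proof eventually_elim
      case (elim N)
      have "norm (\<Sum>n\<le>N. real n powr (real d / 2 - 1) * (norm (c n))\<^sup>2) = (\<Sum>n\<le>N. real n powr (real d / 2 - 1) * (norm (c n))\<^sup>2)"
        by (simp add: sum_nonneg)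
      also have "\<dots> \<le> (\<Sum>n\<le>N. real N powr (real d / 2 - 1) * (norm (c n))\<^sup>2)"
        using assms(3) by (intro sum_mono mult_right_mono powr_mono2) auto
      also have "\<dots> = real N powr (real d / 2 - 1) * (\<Sum>n\<le>N. (norm (c n))\<^sup>2)" by (rule sum_distrib_left[symmetric])
      also have "\<dots> \<le> real N powr (real d / 2 - 1) * (B * real N powr \<epsilon>)" using B(2)[OF elim] by (intro mult_left_mono) auto
      also have "\<dots> = B * real N powr (real d / 2 - 1 + \<epsilon>)" by (simp add: powr_add)
      also have "\<dots> \<le> (B + 1) * norm (real N powr (real d / 2 - 1 + \<epsilon>))" by (intro mult_mono) (use B in auto)
      finally show ?case .
    qed
  qed (use B in auto)
  thus ?thesis using assms by simp
qed

context radial_setup begin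

text \<open>Below the critical exponent there is an admissible growth exponent \<open>\<alpha>\<close> with \<open>\<alpha> < d / p\<close> and \<open>2 \<alpha> < d - 1\<close>, and
so room for \<open>\<beta>\<close> strictly between \<open>2 \<alpha>\<close> and both \<open>2 d / p\<close> and \<open>d - 1\<close>. Then both the near and
the far part of the block integral decay.\<close>

lemma nn_integral_block:
  fixes p :: real
  assumes p: "p > 2" and pc: "ereal p < critical_exponent CARD('d) c"
    and Hs: "\<And>\<epsilon>. \<epsilon> > 0 \<Longrightarrow> in_Hs_rad CARD('d) (- \<epsilon>) c"
  shows "\<exists>K \<eta>. K \<ge> 0 \<and> \<eta> > 0 \<and> (\<forall>N\<ge>CARD('d).
     (\<integral>\<^sup>+x. ennreal (block_square c N x powr (p / 2)) \<partial>lborel)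
       \<le> ennreal (K * real N powr (- \<eta>)))"
proof -
  let ?S = "growth_exponents CARD('d) c"
  have Sd: "real CARD('d) / 2 - 1 + 1/4 \<in> ?S" by (rule growth_exponent_of_Hs) (use Hs d in auto)
  have Sne: "?S \<noteq> {}" using Sd by blast
  have "alpha_star CARD('d) c < real CARD('d) / p"
  proof (cases "alpha_star CARD('d) c = 0")
    case True
    thus ?thesis using p by simp
  next
    case False
    have "0 \<le> alpha_star CARD('d) c"
      unfolding alpha_star_def by (rule cInf_greatest) (use Sne in auto)
    hence pos: "alpha_star CARD('d) c > 0" using False by simp
    have "p < real CARD('d) / alpha_star CARD('d) c" using pc False by (simp add: critical_exponent_def)
    thus ?thesis using pos p by (simp add: field_simps)
  qed
  hence "\<exists>\<alpha>\<in>?S. \<alpha> < real CARD('d) / p"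
    unfolding alpha_star_def by (rule cInf_lessD[OF Sne])
  then obtain \<alpha>1 where a1: "\<alpha>1 \<in> ?S" "\<alpha>1 < real CARD('d) / p" by blast
  \<comment> \<open>Both are growth exponents; the second one is below \<open>(d - 1) / 2\<close>.\<close>
  define \<alpha> where "\<alpha> = min \<alpha>1 (real CARD('d) / 2 - 1 + 1/4)"
  have aS: "\<alpha> \<in> ?S" using a1 Sd by (simp only: \<alpha>_def min_def split: if_split) simp
  have a0: "\<alpha> > 0" using aS by simp
  have ap: "\<alpha> < 2 * a / p" "2 * \<alpha> < 2 * a - 1" using a1(2) by (auto simp: \<alpha>_def dim min_def)
  have big: "weighted_sum a c \<in> O(\<lambda>N. real N powr \<alpha>)"
    using aS by (simp add: dim)
  have mon: "mono (weighted_sum a c)"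
    by (intro monoI sum_mono2) auto
  obtain A where A: "A \<ge> 0" "\<And>N::nat. N \<ge> 1 \<Longrightarrow> weighted_sum a c N \<le> A * real N powr \<alpha>"
    using bigo_bound_all[OF big a0 mon] by auto
  have "2 * \<alpha> < min (4 * a / p) (2 * a - 1)" using ap by simp
  then obtain \<beta> where \<beta>: "2 * \<alpha> < \<beta>" "\<beta> < min (4 * a / p) (2 * a - 1)" using dense by blast
  have b0: "\<beta> \<ge> 0" using \<beta> a0 by simp
  have bp: "\<beta> * p / 2 < 2 * a" using \<beta> p by (simp add: field_simps)
  \<comment> \<open>Half of the largest \<open>\<epsilon>\<close> for which the far part is still bounded.\<close>
  define \<epsilon> where "\<epsilon> = (p - 2) / (6 * p)"
  have e0: "\<epsilon> > 0" using p by (simp add: \<epsilon>_def)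
  obtain B where B: "B \<ge> 0" "\<And>N. N \<ge> 1 \<Longrightarrow> (\<Sum>n\<le>N. (norm (c n))\<^sup>2) \<le> B * real N powr \<epsilon>"
    using Hs_partial_sums[OF Hs[OF e0] e0] by blast
  obtain C where C: "C > 0"
    "\<And>n x \<beta>. n \<ge> CARD('d) \<Longrightarrow> 0 < norm x \<Longrightarrow> norm x \<le> 1 \<Longrightarrow> 0 \<le> \<beta> \<Longrightarrow> \<beta> \<le> 2 * a - 1 \<Longrightarrow>
        (norm (\<psi> n x))\<^sup>2 \<le> C * real n powr (a - 1) * (norm x * sqrt n) powr (- \<beta>)"
    "\<And>n x. n \<ge> CARD('d) \<Longrightarrow> 1 \<le> norm x \<Longrightarrow> (norm (\<psi> n x))\<^sup>2 \<le> C * real n powr (- 1/3)"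
    by (rule psi_upper_bounds) (rule that)
  have Cn: "(norm (\<psi> n x))\<^sup>2 \<le> C * real n powr (a - 1) * (norm x * sqrt n) powr (- \<beta>)"
    if "n \<ge> CARD('d)" "0 < norm x" "norm x \<le> 1" for n x using C(2)[OF that b0] \<beta> by simp
  define e1 where "e1 = (\<beta> / 2 - \<alpha>) * p / 2"
  define e2 where "e2 = (p - 2) / 6 - \<epsilon> * p / 2"
  have C0: "C \<ge> 0" using C(1) by simp
  obtain K1 where K1: "K1 \<ge> 0" "\<And>N. N \<ge> CARD('d) \<Longrightarrow>
     (\<integral>\<^sup>+x. indicator {x. norm x \<le> 1} x * ennreal (block_square c N x powr (p / 2)) \<partial>lborel)
       \<le> ennreal (K1 * real N powr (- e1))"
    using nn_integral_block_near[OF Cn C0 b0 bp p A(2) A(1)] unfolding e1_def by blast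
  obtain K2 where K2: "K2 \<ge> 0" "\<And>N. N \<ge> CARD('d) \<Longrightarrow>
     (\<integral>\<^sup>+x. indicator {x. 1 \<le> norm x} x * ennreal (block_square c N x powr (p / 2)) \<partial>lborel)
       \<le> ennreal (K2 * real N powr (- e2))"
    using nn_integral_block_far[OF C(3) C0 p B(2) B(1)] unfolding e2_def by blast
  have e1p: "e1 > 0" using \<beta> p by (simp add: e1_def)
  have "e2 = (p - 2) / 12" using p by (simp add: e2_def \<epsilon>_def field_simps)
  hence e2p: "e2 > 0" using p by simp
  show ?thesis
  proof (rule exI[of _ "K1 + K2"], rule exI[of _ "min e1 e2"], intro conjI allI impI)
    fix N assume N: "CARD('d) \<le> N"
    let ?h = "\<lambda>x. ennreal (block_square c N x powr (p / 2))"
    have N1: "real N \<ge> 1" using N d by simp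
    have "(\<integral>\<^sup>+x. ?h x \<partial>lborel) \<le> (\<integral>\<^sup>+x. indicator {x. norm x \<le> 1} x * ?h x + indicator {x. 1 \<le> norm x} x * ?h x \<partial>lborel)"
      by (intro nn_integral_mono) (auto simp: indicator_def)
    also have "\<dots> = (\<integral>\<^sup>+x. indicator {x. norm x \<le> 1} x * ?h x \<partial>lborel) + (\<integral>\<^sup>+x. indicator {x. 1 \<le> norm x} x * ?h x \<partial>lborel)"
      by (rule nn_integral_add) measurable
    also have "\<dots> \<le> ennreal (K1 * real N powr (- e1)) + ennreal (K2 * real N powr (- e2))"
      by (intro add_mono K1 K2 N)
    also have "\<dots> = ennreal (K1 * real N powr (- e1) + K2 * real N powr (- e2))"
      using K1 K2 by (subst ennreal_plus) auto
    also have "\<dots> \<le> ennreal ((K1 + K2) * real N powr (- min e1 e2))"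
    proof (rule ennreal_leI)
      have "K1 * real N powr (- e1) \<le> K1 * real N powr (- min e1 e2)" "K2 * real N powr (- e2) \<le> K2 * real N powr (- min e1 e2)"
        using K1 K2 N1 by (intro mult_left_mono powr_mono; simp)+
      thus "K1 * real N powr (- e1) + K2 * real N powr (- e2) \<le> (K1 + K2) * real N powr (- min e1 e2)"
        by (simp only: distrib_right)
    qed
    finally show "(\<integral>\<^sup>+x. ?h x \<partial>lborel) \<le> ennreal ((K1 + K2) * real N powr (- min e1 e2))" .
  qed (use K1 K2 e1p e2p in auto)
qed

end


section \<open>Almost sure convergence\<close>

locale centred_iid = prob_space M for M :: "'w measure" +
  fixes X :: "nat \<Rightarrow> 'w \<Rightarrow> real"
  assumes indep: "indep_vars (\<lambda>_. borel) X UNIV"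
    and ident: "\<And>m n. distr M borel (X m) = distr M borel (X n)"
    and nonconst: "\<not> (\<exists>a. AE \<omega> in M. X 1 \<omega> = a)"
    and moments: "\<And>k::nat. k \<ge> 1 \<Longrightarrow> integrable M (\<lambda>\<omega>. \<bar>X 1 \<omega>\<bar> ^ k)"
    and mean1: "expectation (X 1) = 0"
begin

lemma X_measurable [measurable]: "X n \<in> borel_measurable M"
  using indep by (auto simp: indep_vars_def)

lemma expectation_X: 
  fixes h :: "real \<Rightarrow> real"
  assumes "h \<in> borel_measurable borel"
  shows "expectation (\<lambda>\<omega>. h (X n \<omega>)) = expectation (\<lambda>\<omega>. h (X 1 \<omega>))"
  using ident[of n 1] assms by (metis integral_distr X_measurable)

lemma integrable_X:
  fixes h :: "real \<Rightarrow> real"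
  assumes "h \<in> borel_measurable borel"
  shows "integrable M (\<lambda>\<omega>. h (X n \<omega>)) \<longleftrightarrow> integrable M (\<lambda>\<omega>. h (X 1 \<omega>))"
  using ident[of n 1] assms by (metis integrable_distr_eq X_measurable)

lemma integrable_abs_power: "integrable M (\<lambda>\<omega>. \<bar>X n \<omega>\<bar> ^ k)"
proof -
  have "integrable M (\<lambda>\<omega>. \<bar>X 1 \<omega>\<bar> ^ k)" using moments[of k] by (cases k) auto
  thus ?thesis by (subst integrable_X[where h = "\<lambda>x. \<bar>x\<bar> ^ k"]) auto
qed

lemma expectation_abs_power: "expectation (\<lambda>\<omega>. \<bar>X n \<omega>\<bar> ^ k) = expectation (\<lambda>\<omega>. \<bar>X 1 \<omega>\<bar> ^ k)"
  by (rule expectation_X[where h = "\<lambda>x. \<bar>x\<bar> ^ k"]) auto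

lemma mean0: "expectation (X n) = 0"
  using expectation_X[where h = "\<lambda>x. x" and n = n] mean1 by simp

abbreviation random_sum :: "(nat \<Rightarrow> complex) \<Rightarrow> nat set \<Rightarrow> 'w \<Rightarrow> complex" where
  "random_sum b I \<omega> \<equiv> \<Sum>i\<in>I. of_real (X i \<omega>) * b i"

lemma khinchine:
  "\<exists>C\<ge>0. \<forall>I (b :: nat \<Rightarrow> complex). finite I \<longrightarrow>
     integrable M (\<lambda>\<omega>. norm (random_sum b I \<omega>) ^ (2 * q)) \<and>
     expectation (\<lambda>\<omega>. norm (random_sum b I \<omega>) ^ (2 * q)) \<le> C * (\<Sum>i\<in>I. (norm (b i))\<^sup>2) ^ q"
  by (rule even_moment_bound_complex[OF indep integrable_abs_power _ mean0]) (rule eq_refl[OF expectation_abs_power])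

end

locale radial_random_series = radial_setup \<psi> + centred_iid M X
  for \<psi> :: "nat \<Rightarrow> real^'d \<Rightarrow> complex" and M :: "'w measure" and X +
  fixes c :: "nat \<Rightarrow> complex"
begin

definition u :: "'w \<Rightarrow> nat \<Rightarrow> real^'d \<Rightarrow> complex" where
  "u \<omega> N x = (\<Sum>n\<le>N. of_real (X n \<omega>) * c n * \<psi> n x)"

lemma u_in_Lp: "p \<ge> 2 \<Longrightarrow> in_Lp p (u \<omega> N)" for p :: real
  unfolding u_def by (rule partial_sum_in_Lp)

lemma u_measurable [measurable]: "(\<lambda>(\<omega>, x). u \<omega> N x) \<in> borel_measurable (M \<Otimes>\<^sub>M lborel)"
  unfolding u_def by measurable

lemma u_diff: "N \<le> k \<Longrightarrow> u \<omega> k x - u \<omega> N x = (\<Sum>n\<in>{N<..k}. of_real (X n \<omega>) * (c n * \<psi> n x))"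
proof -
  assume Nk: "N \<le> k"
  have "{..k} = {..N} \<union> {N<..k}" using Nk by auto
  hence "u \<omega> k x = u \<omega> N x + (\<Sum>n\<in>{N<..k}. of_real (X n \<omega>) * c n * \<psi> n x)"
    unfolding u_def by (simp only:) (subst sum.union_disjoint, auto)
  thus ?thesis by (simp add: mult.assoc)
qed

text \<open>The maximum over a block is at most the \<open>2m\<close>-norm of its terms, so it costs the factor
\<open>N^(p/(2m))\<close> compared with a single partial sum. Jensen's inequality descends from the moment of
order \<open>2m\<close> to the moment of order \<open>p\<close>.\<close>

lemma maximal_block_moment:
  fixes p :: real and m :: nat
  assumes p: "p > 0" and m: "real (2 * m) \<ge> p"
  shows "\<exists>C\<ge>0. \<forall>N x. N \<ge> 1 \<longrightarrow>
     (\<integral>\<^sup>+\<omega>. ennreal ((\<Sum>k\<in>{N<..2*N}. norm (u \<omega> k x - u \<omega> N x) ^ (2 * m)) powr (p / real (2 * m))) \<partial>M)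
      \<le> ennreal (C * real N powr (p / real (2 * m)) * block_square c N x powr (p / 2))"
proof -
  have m0: "m > 0" using p m by (cases m) auto
  obtain C where C: "C \<ge> 0" and kh: "\<And>I (b :: nat \<Rightarrow> complex). finite I \<Longrightarrow>
     integrable M (\<lambda>\<omega>. norm (random_sum b I \<omega>) ^ (2 * m)) \<and>
     expectation (\<lambda>\<omega>. norm (random_sum b I \<omega>) ^ (2 * m)) \<le> C * (\<Sum>i\<in>I. (norm (b i))\<^sup>2) ^ m"
    using khinchine[of m] by blast
  let ?\<theta> = "p / real (2 * m)"
  have th: "0 < ?\<theta>" "?\<theta> \<le> 1" using p m m0 by auto
  show ?thesis
  proof (intro exI[of _ "C powr ?\<theta>"] conjI allI impI)
    fix N :: nat and x :: "real^'d" assume N: "N \<ge> 1"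
    define G where "G = block_square c N x"
    have G0: "G \<ge> 0" by (simp add: G_def sum_nonneg)
    have um: "(\<lambda>\<omega>. u \<omega> k x) \<in> borel_measurable M" for k unfolding u_def by measurable
    have each: "(\<integral>\<^sup>+\<omega>. ennreal (norm (u \<omega> k x - u \<omega> N x) ^ (2 * m)) \<partial>M) \<le> ennreal (C * G ^ m)" if k: "k \<in> {N<..2*N}" for k
    proof -
      let ?b = "\<lambda>n. c n * \<psi> n x"
      have e: "u \<omega> k x - u \<omega> N x = (\<Sum>n\<in>{N<..k}. of_real (X n \<omega>) * ?b n)" for \<omega>
        by (rule u_diff) (use k in auto)
      have "(\<integral>\<^sup>+\<omega>. ennreal (norm (u \<omega> k x - u \<omega> N x) ^ (2 * m)) \<partial>M)
         = ennreal (expectation (\<lambda>\<omega>. norm (\<Sum>n\<in>{N<..k}. of_real (X n \<omega>) * ?b n) ^ (2 * m)))"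
        unfolding e by (rule nn_integral_eq_integral) (use kh[of "{N<..k}" ?b] in auto)
      also have "\<dots> \<le> ennreal (C * (\<Sum>n\<in>{N<..k}. (norm (?b n))\<^sup>2) ^ m)"
        by (intro ennreal_leI) (use kh[of "{N<..k}" ?b] in auto)
      also have "\<dots> \<le> ennreal (C * G ^ m)"
      proof (intro ennreal_leI mult_left_mono power_mono C)
        have "(\<Sum>n\<in>{N<..k}. (norm (?b n))\<^sup>2) = (\<Sum>n\<in>{N<..k}. (norm (c n))\<^sup>2 * (norm (\<psi> n x))\<^sup>2)"
          by (simp add: norm_mult power_mult_distrib)
        also have "\<dots> \<le> G" unfolding G_def by (intro sum_mono2) (use k in auto)
        finally show "(\<Sum>n\<in>{N<..k}. (norm (?b n))\<^sup>2) \<le> G" .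
      qed (auto intro: sum_nonneg)
      finally show ?thesis .
    qed
    have "(\<integral>\<^sup>+\<omega>. ennreal ((\<Sum>k\<in>{N<..2*N}. norm (u \<omega> k x - u \<omega> N x) ^ (2 * m)) powr ?\<theta>) \<partial>M)
        \<le> ennreal ((real N * (C * G ^ m)) powr ?\<theta>)"
    proof (rule nn_expectation_powr_le[OF th])
      show "(\<lambda>\<omega>. \<Sum>k\<in>{N<..2*N}. norm (u \<omega> k x - u \<omega> N x) ^ (2 * m)) \<in> borel_measurable M"
        using um by measurable
      have "(\<integral>\<^sup>+\<omega>. ennreal (\<Sum>k\<in>{N<..2*N}. norm (u \<omega> k x - u \<omega> N x) ^ (2 * m)) \<partial>M)
          = (\<integral>\<^sup>+\<omega>. (\<Sum>k\<in>{N<..2*N}. ennreal (norm (u \<omega> k x - u \<omega> N x) ^ (2 * m))) \<partial>M)"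
        by (intro nn_integral_cong) (simp add: sum_ennreal)
      also have "\<dots> = (\<Sum>k\<in>{N<..2*N}. \<integral>\<^sup>+\<omega>. ennreal (norm (u \<omega> k x - u \<omega> N x) ^ (2 * m)) \<partial>M)"
        using um by (intro nn_integral_sum) measurable
      also have "\<dots> \<le> (\<Sum>k\<in>{N<..2*N}. ennreal (C * G ^ m))" by (intro sum_mono each)
      also have "\<dots> = ennreal (\<Sum>k\<in>{N<..2*N}. C * G ^ m)" using C G0 by (intro sum_ennreal) auto
      also have "(\<Sum>k\<in>{N<..2*N}. C * G ^ m) = real N * (C * G ^ m)" by simp
      finally show "(\<integral>\<^sup>+\<omega>. ennreal (\<Sum>k\<in>{N<..2*N}. norm (u \<omega> k x - u \<omega> N x) ^ (2 * m)) \<partial>M) \<le> ennreal (real N * (C * G ^ m))" .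
    qed (use C G0 in \<open>auto intro: sum_nonneg\<close>)
    also have "(real N * (C * G ^ m)) powr ?\<theta> = real N powr ?\<theta> * (C powr ?\<theta> * (G ^ m) powr ?\<theta>)"
      using C G0 by (simp add: powr_mult)
    also have "(G ^ m) powr ?\<theta> = G powr (p / 2)"
      using G0 m0 p by (cases "G = 0") (auto simp: powr_realpow[symmetric] powr_powr)
    also have "real N powr ?\<theta> * (C powr ?\<theta> * G powr (p / 2)) = C powr ?\<theta> * real N powr ?\<theta> * G powr (p / 2)" by simp
    finally show "(\<integral>\<^sup>+\<omega>. ennreal ((\<Sum>k\<in>{N<..2*N}. norm (u \<omega> k x - u \<omega> N x) ^ (2 * m)) powr ?\<theta>) \<partial>M)
      \<le> ennreal (C powr ?\<theta> * real N powr ?\<theta> * block_square c N x powr (p / 2))"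
      by (simp only: G_def)
  qed auto
qed

text \<open>The decay \<open>N^(-\<eta>)\<close> of the block integrals pays for a weight \<open>2^(\<eta> j / 3)\<close> and, once \<open>p / (2m) \<le> \<eta> / 3\<close>,
for the maximum over the block. By Fubini's theorem the weighted series of block maxima has finite
expectation, hence it is finite almost surely.\<close>

lemma almost_sure_convergence:
  fixes p :: real
  assumes p: "p > 2" and pc: "ereal p < critical_exponent CARD('d) c"
    and Hs: "\<And>\<epsilon>. \<epsilon> > 0 \<Longrightarrow> in_Hs_rad CARD('d) (- \<epsilon>) c"
  shows "AE \<omega> in M. \<exists>f. Lp_tendsto p (u \<omega>) f"
proof -
  obtain K \<eta> where K: "K \<ge> 0" and \<eta>: "\<eta> > 0" and block: "\<And>N. N \<ge> CARD('d) \<Longrightarrow>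
     (\<integral>\<^sup>+x. ennreal (block_square c N x powr (p / 2)) \<partial>lborel)
       \<le> ennreal (K * real N powr (- \<eta>))"
    using nn_integral_block[OF p pc Hs] by blast
  \<comment> \<open>Large enough for \<open>2 m \<ge> p\<close> and for \<open>p / (2 m) \<le> \<eta> / 3\<close>.\<close>
  define m where "m = nat \<lceil>p / 2 + 3 * p / (2 * \<eta>)\<rceil>"
  have mb: "real m \<ge> p / 2 + 3 * p / (2 * \<eta>)" unfolding m_def by (rule real_nat_ceiling_ge)
  have pe: "3 * p / (2 * \<eta>) > 0" using p \<eta> by simp
  have m1: "real (2 * m) \<ge> p" using mb pe by simp
  have m2: "real m \<ge> 3 * p / (2 * \<eta>)" using mb p by simp
  define \<theta> where "\<theta> = p / real (2 * m)"
  have "real m > 0" using m1 p by simp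
  hence th: "0 < \<theta>" "\<theta> \<le> \<eta> / 3" using p m2 \<eta> by (simp_all add: \<theta>_def field_simps)
  obtain C where C: "C \<ge> 0" and mom: "\<And>N x. N \<ge> 1 \<Longrightarrow>
     (\<integral>\<^sup>+\<omega>. ennreal ((\<Sum>k\<in>{N<..2*N}. norm (u \<omega> k x - u \<omega> N x) ^ (2 * m)) powr \<theta>) \<partial>M)
      \<le> ennreal (C * real N powr \<theta> * block_square c N x powr (p / 2))"
    using maximal_block_moment[of p m] m1 p unfolding \<theta>_def by auto
  define j0 where "j0 = CARD('d)"
  define N where "N j = dyadic j0 j" for j
  have Nd: "N j \<ge> CARD('d)" for j
  proof -
    have "CARD('d) \<le> 2 ^ CARD('d)" by (rule less_imp_le[OF less_exp])
    also have "\<dots> \<le> N j" by (simp add: N_def dyadic_def j0_def)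
    finally show ?thesis .
  qed
  have N1: "N j \<ge> 1" for j using Nd[of j] d by linarith
  have NS: "dyadic j0 (Suc j) = 2 * N j" for j by (simp add: N_def dyadic_def)
  define D where "D \<omega> j x = (\<Sum>k\<in>{N j<..2 * N j}. norm (u \<omega> k x - u \<omega> (N j) x) ^ (2 * m)) powr \<theta>" for \<omega> j x
  have Dm [measurable]: "(\<lambda>(\<omega>, x). D \<omega> j x) \<in> borel_measurable (M \<Otimes>\<^sub>M lborel)" for j
    unfolding D_def by measurable
  have D0: "D \<omega> j x \<ge> 0" for \<omega> j x by (simp add: D_def)
  interpret P: pair_sigma_finite M lborel ..
  have int: "(\<integral>\<^sup>+\<omega>. \<integral>\<^sup>+x. ennreal (2 powr (\<eta> / 3 * j) * D \<omega> j x) \<partial>lborel \<partial>M) \<le> ennreal (C * K * (2 powr (- \<eta> / 3)) ^ j)" for j :: nat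
  proof -
    have "(\<integral>\<^sup>+\<omega>. \<integral>\<^sup>+x. ennreal (2 powr (\<eta> / 3 * j) * D \<omega> j x) \<partial>lborel \<partial>M)
       = (\<integral>\<^sup>+x. \<integral>\<^sup>+\<omega>. ennreal (2 powr (\<eta> / 3 * j) * D \<omega> j x) \<partial>M \<partial>lborel)"
      by (rule P.Fubini'[symmetric]) measurable
    also have "\<dots> \<le> (\<integral>\<^sup>+x. ennreal (2 powr (\<eta> / 3 * j) * (C * real (N j) powr \<theta>)) *
         ennreal (block_square c (N j) x powr (p / 2)) \<partial>lborel)"
    proof (rule nn_integral_mono)
      fix x :: "real^'d"
      have "(\<integral>\<^sup>+\<omega>. ennreal (2 powr (\<eta> / 3 * j) * D \<omega> j x) \<partial>M) = (\<integral>\<^sup>+\<omega>. ennreal (2 powr (\<eta> / 3 * j)) * ennreal (D \<omega> j x) \<partial>M)"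
        by (simp add: ennreal_mult' D0)
      also have "\<dots> = ennreal (2 powr (\<eta> / 3 * j)) * (\<integral>\<^sup>+\<omega>. ennreal (D \<omega> j x) \<partial>M)"
      proof (rule nn_integral_cmult)
        have "(\<lambda>\<omega>. (\<lambda>(\<omega>, x). D \<omega> j x) (\<omega>, x)) \<in> borel_measurable M"
          by (rule measurable_compose[OF measurable_Pair2' Dm]) simp
        thus "(\<lambda>\<omega>. ennreal (D \<omega> j x)) \<in> borel_measurable M" by simp
      qed
      also have "\<dots> \<le> ennreal (2 powr (\<eta> / 3 * j)) * ennreal (C * real (N j) powr \<theta> * block_square c (N j) x powr (p / 2))"
        unfolding D_def by (intro mult_left_mono mom N1) simp
      finally show "(\<integral>\<^sup>+\<omega>. ennreal (2 powr (\<eta> / 3 * j) * D \<omega> j x) \<partial>M) \<le> ennreal (2 powr (\<eta> / 3 * j) * (C * real (N j) powr \<theta>)) *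
         ennreal (block_square c (N j) x powr (p / 2))"
        using C by (simp add: ennreal_mult[symmetric] mult_ac)
    qed
    also have "\<dots> = ennreal (2 powr (\<eta> / 3 * j) * (C * real (N j) powr \<theta>)) *
        (\<integral>\<^sup>+x. ennreal (block_square c (N j) x powr (p / 2)) \<partial>lborel)"
      by (rule nn_integral_cmult) measurable
    also have "\<dots> \<le> ennreal (2 powr (\<eta> / 3 * j) * (C * real (N j) powr \<theta>)) * ennreal (K * real (N j) powr (- \<eta>))"
      by (intro mult_left_mono block Nd) simp
    also have "\<dots> = ennreal (2 powr (\<eta> / 3 * j) * (C * real (N j) powr \<theta>) * (K * real (N j) powr (- \<eta>)))"
      using C K by (simp add: ennreal_mult[symmetric])
    also have "\<dots> \<le> ennreal (C * K * (2 powr (- \<eta> / 3)) ^ j)"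
    proof (rule ennreal_leI)
      have "real (N j) powr \<theta> * real (N j) powr (- \<eta>) = real (N j) powr (\<theta> - \<eta>)" by (simp add: powr_add[symmetric])
      also have "\<dots> \<le> real (N j) powr (- (2 * \<eta> / 3))" using N1[of j] th by (intro powr_mono) auto
      also have "\<dots> \<le> (2 powr real j) powr (- (2 * \<eta> / 3))"
      proof (rule powr_mono2')
        show "2 powr real j \<le> real (N j)" by (simp add: N_def dyadic_def powr_realpow)
      qed (use \<eta> in auto)
      also have "\<dots> = 2 powr (- (2 * \<eta> / 3) * j)" by (simp add: powr_powr mult.commute)
      finally have le: "real (N j) powr \<theta> * real (N j) powr (- \<eta>) \<le> 2 powr (- (2 * \<eta> / 3) * j)" .
      have "2 powr (\<eta> / 3 * j) * (C * real (N j) powr \<theta>) * (K * real (N j) powr (- \<eta>))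
         = C * K * (2 powr (\<eta> / 3 * j) * (real (N j) powr \<theta> * real (N j) powr (- \<eta>)))" by (simp add: mult_ac)
      also have "\<dots> \<le> C * K * (2 powr (\<eta> / 3 * j) * 2 powr (- (2 * \<eta> / 3) * j))"
        using C K le by (intro mult_left_mono) auto
      also have "2 powr (\<eta> / 3 * j) * 2 powr (- (2 * \<eta> / 3) * j) = (2 powr (- \<eta> / 3)) ^ j"
        by (simp add: powr_add[symmetric] powr_realpow[symmetric] powr_powr field_simps)
      finally show "2 powr (\<eta> / 3 * j) * (C * real (N j) powr \<theta>) * (K * real (N j) powr (- \<eta>)) \<le> C * K * (2 powr (- \<eta> / 3)) ^ j" .
    qed
    finally show ?thesis .
  qed
  let ?T = "\<lambda>\<omega>. \<Sum>j. \<integral>\<^sup>+x. ennreal (2 powr (\<eta> / 3 * j) * D \<omega> j x) \<partial>lborel"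
  have Tm: "(\<lambda>\<omega>. \<integral>\<^sup>+x. ennreal (2 powr (\<eta> / 3 * j) * D \<omega> j x) \<partial>lborel) \<in> borel_measurable M" for j :: nat
    by measurable
  have "(\<integral>\<^sup>+\<omega>. ?T \<omega> \<partial>M) = (\<Sum>j. \<integral>\<^sup>+\<omega>. \<integral>\<^sup>+x. ennreal (2 powr (\<eta> / 3 * j) * D \<omega> j x) \<partial>lborel \<partial>M)"
    by (rule nn_integral_suminf[OF Tm])
  also have "\<dots> \<le> (\<Sum>j. ennreal (C * K * (2 powr (- \<eta> / 3)) ^ j))"
    by (intro suminf_le int summableI)
  also have "\<dots> < \<infinity>"
  proof -
    have "summable (\<lambda>j. C * K * (2 powr (- \<eta> / 3)) ^ j)"
      using \<eta> by (intro summable_mult summable_geometric) (simp add: powr_less_one)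
    hence "(\<Sum>j. ennreal (C * K * (2 powr (- \<eta> / 3)) ^ j)) = ennreal (\<Sum>j. C * K * (2 powr (- \<eta> / 3)) ^ j)"
      using C K by (intro suminf_ennreal2) auto
    thus ?thesis by simp
  qed
  finally have fin: "(\<integral>\<^sup>+\<omega>. ?T \<omega> \<partial>M) \<noteq> \<infinity>" by simp
  have "?T \<in> borel_measurable M" using Tm by measurable
  hence "AE \<omega> in M. ?T \<omega> \<noteq> \<infinity>" using fin by (rule nn_integral_noteq_infinite)
  thus ?thesis
  proof eventually_elim
    case (elim \<omega>)
    show ?case
    proof (rule Lp_tendsto_of_dyadic_blocks[where D = "D \<omega>" and \<eta> = "\<eta> / 3" and ?j0.0 = j0])
      show "in_Lp p (u \<omega> N)" for N by (rule u_in_Lp) (use p in simp)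
      show "D \<omega> j \<in> borel_measurable borel" for j
        unfolding D_def u_def by measurable
      show "(\<Sum>j. \<integral>\<^sup>+x. ennreal (2 powr (\<eta> / 3 * real j) * D \<omega> j x) \<partial>lborel) < \<infinity>"
        using elim by (simp add: less_top)
      show "norm (u \<omega> k x - u \<omega> (dyadic j0 j) x) powr p \<le> D \<omega> j x"
        if k: "dyadic j0 j \<le> k" "k \<le> dyadic j0 (Suc j)" for j k x
      proof (cases "k = N j")
        case True
        thus ?thesis by (simp add: N_def D_def)
      next
        case False
        let ?a = "norm (u \<omega> k x - u \<omega> (N j) x)"
        have kk: "k \<in> {N j<..2 * N j}" using k False NS by (auto simp: N_def)
        have "?a ^ (2 * m) \<le> (\<Sum>k\<in>{N j<..2 * N j}. norm (u \<omega> k x - u \<omega> (N j) x) ^ (2 * m))"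
          by (rule member_le_sum[OF kk]) auto
        hence "(?a ^ (2 * m)) powr \<theta> \<le> D \<omega> j x" unfolding D_def using th by (intro powr_mono2) auto
        moreover have "(?a ^ (2 * m)) powr \<theta> = ?a powr p"
        proof (cases "?a = 0")
          case True
          thus ?thesis using \<open>real m > 0\<close> by simp
        next
          case False
          hence ap: "?a > 0" by (simp add: less_le)
          have "(?a ^ (2 * m)) powr \<theta> = ?a powr (real (2 * m) * \<theta>)"
            unfolding powr_realpow[OF ap, symmetric] by (rule powr_powr)
          also have "real (2 * m) * \<theta> = p" using \<open>real m > 0\<close> by (simp add: \<theta>_def)
          finally show ?thesis .
        qed
        ultimately show ?thesis by (simp add: N_def)
      qed
    qed (use p \<eta> D0 in auto)
  qed
qed

end


section \<open>Almost sure divergence\<close>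

lemma nn_integral_add_powr_le:
  fixes p :: real and f g :: "'a::euclidean_space \<Rightarrow> complex"
  assumes "p \<ge> 0" and [measurable]: "f \<in> borel_measurable borel" "g \<in> borel_measurable borel"
  shows "(\<integral>\<^sup>+x. ennreal (norm (f x + g x) powr p) \<partial>lborel)
     \<le> ennreal (2 powr p) * ((\<integral>\<^sup>+x. ennreal (norm (f x) powr p) \<partial>lborel) + (\<integral>\<^sup>+x. ennreal (norm (g x) powr p) \<partial>lborel))"
proof -
  have "(\<integral>\<^sup>+x. ennreal (norm (f x + g x) powr p) \<partial>lborel)
    \<le> (\<integral>\<^sup>+x. ennreal (2 powr p) * (ennreal (norm (f x) powr p) + ennreal (norm (g x) powr p)) \<partial>lborel)"
  proof (rule nn_integral_mono)
    fix x
    have "ennreal (norm (f x + g x) powr p) \<le> ennreal (2 powr p * (norm (f x) powr p + norm (g x) powr p))"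
      by (intro ennreal_leI norm_add_powr_le assms)
    thus "ennreal (norm (f x + g x) powr p) \<le> ennreal (2 powr p) * (ennreal (norm (f x) powr p) + ennreal (norm (g x) powr p))"
      by (simp add: ennreal_mult)
  qed
  also have "\<dots> = ennreal (2 powr p) * (\<integral>\<^sup>+x. ennreal (norm (f x) powr p) + ennreal (norm (g x) powr p) \<partial>lborel)"
    by (rule nn_integral_cmult) measurable
  also have "(\<integral>\<^sup>+x. ennreal (norm (f x) powr p) + ennreal (norm (g x) powr p) \<partial>lborel)
     = (\<integral>\<^sup>+x. ennreal (norm (f x) powr p) \<partial>lborel) + (\<integral>\<^sup>+x. ennreal (norm (g x) powr p) \<partial>lborel)"
    by (rule nn_integral_add) measurable
  finally show ?thesis .
qed

lemma in_Lp_nn_integral: "in_Lp p f \<Longrightarrow> (\<integral>\<^sup>+x. ennreal (norm (f x) powr p) \<partial>lborel) < \<infinity>"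
  by (subst nn_integral_eq_integral) (auto simp: in_Lp_def)

lemma Lp_tendsto_bounded:
  fixes p :: real and u :: "nat \<Rightarrow> 'a::euclidean_space \<Rightarrow> complex"
  assumes p: "p > 0" and T: "Lp_tendsto p u f"
  shows "(SUP N. \<integral>\<^sup>+x. ennreal (norm (u N x) powr p) \<partial>lborel) < \<infinity>"
proof -
  have u: "in_Lp p (u N)" and f: "in_Lp p f" for N using T by (auto simp: Lp_tendsto_def)
  have um [measurable]: "u N \<in> borel_measurable borel" and fm [measurable]: "f \<in> borel_measurable borel" for N
    using u[of N] f by (auto simp: in_Lp_def)
  let ?J = "\<lambda>N. \<integral>x. norm (u N x - f x) powr p \<partial>lborel"
  have i: "integrable lborel (\<lambda>x. norm (u N x - f x) powr p)" for N
  proof (rule Bochner_Integration.integrable_bound)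
    show "integrable lborel (\<lambda>x. 2 powr p * (norm (u N x) powr p + norm (- f x) powr p))"
      using u[of N] f by (simp add: in_Lp_def)
    show "AE x in lborel. norm (norm (u N x - f x) powr p) \<le> norm (2 powr p * (norm (u N x) powr p + norm (- f x) powr p))"
      using norm_add_powr_le[of p "u N _" "- f _"] p by (intro AE_I2) (simp add: less_imp_le)
  qed measurable
  have "convergent (\<lambda>N. Lp_norm p (\<lambda>x. u N x - f x))" using T by (auto simp: Lp_tendsto_def convergent_def)
  hence "Bseq (\<lambda>N. Lp_norm p (\<lambda>x. u N x - f x))" by (rule convergent_imp_Bseq)
  then obtain B where B: "B > 0" "\<And>N. norm (Lp_norm p (\<lambda>x. u N x - f x)) \<le> B"
    unfolding Bseq_def by blast
  have J: "?J N \<le> B powr p" for N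
  proof -
    have "?J N = Lp_norm p (\<lambda>x. u N x - f x) powr p"
      using p by (simp add: Lp_norm_def powr_powr)
    also have "\<dots> \<le> B powr p" using B(2)[of N] p by (intro powr_mono2) (auto simp: Lp_norm_def)
    finally show ?thesis .
  qed
  let ?H = "ennreal (2 powr p) * (ennreal (B powr p) + (\<integral>\<^sup>+x. ennreal (norm (f x) powr p) \<partial>lborel))"
  have "(\<integral>\<^sup>+x. ennreal (norm (u N x) powr p) \<partial>lborel) \<le> ?H" for N
  proof -
    have "(\<integral>\<^sup>+x. ennreal (norm (u N x) powr p) \<partial>lborel) = (\<integral>\<^sup>+x. ennreal (norm ((u N x - f x) + f x) powr p) \<partial>lborel)" by simp
    also have "\<dots> \<le> ennreal (2 powr p) * ((\<integral>\<^sup>+x. ennreal (norm (u N x - f x) powr p) \<partial>lborel) + (\<integral>\<^sup>+x. ennreal (norm (f x) powr p) \<partial>lborel))"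
      by (rule nn_integral_add_powr_le) (use p in auto)
    also have "(\<integral>\<^sup>+x. ennreal (norm (u N x - f x) powr p) \<partial>lborel) = ennreal (?J N)"
      by (rule nn_integral_eq_integral[OF i]) auto
    also have "ennreal (2 powr p) * (ennreal (?J N) + (\<integral>\<^sup>+x. ennreal (norm (f x) powr p) \<partial>lborel)) \<le> ?H"
      by (intro mult_left_mono add_right_mono ennreal_leI J) auto
    finally show ?thesis .
  qed
  hence "(SUP N. \<integral>\<^sup>+x. ennreal (norm (u N x) powr p) \<partial>lborel) \<le> ?H" by (intro SUP_least)
  also have "\<dots> < \<infinity>" using in_Lp_nn_integral[OF f] by (auto simp: ennreal_mult_less_top less_top)
  finally show ?thesis .
qed

context centred_iid begin

definition var :: real where "var = expectation (\<lambda>\<omega>. (X 1 \<omega>)\<^sup>2)"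

lemma var_pos: "var > 0"
proof -
  have i: "integrable M (\<lambda>\<omega>. (X 1 \<omega>)\<^sup>2)" using integrable_abs_power[of 1 2] by simp
  have "var \<ge> 0" by (simp add: var_def)
  moreover have "var \<noteq> 0"
  proof
    assume "var = 0"
    hence "AE \<omega> in M. (X 1 \<omega>)\<^sup>2 = 0"
      unfolding var_def by (subst (asm) integral_nonneg_eq_0_iff_AE[OF i]) auto
    hence "AE \<omega> in M. X 1 \<omega> = 0" by eventually_elim simp
    thus False using nonconst by blast
  qed
  ultimately show ?thesis by simp
qed

lemma second_moment_real:
  fixes b :: "nat \<Rightarrow> real"
  assumes "finite I"
  shows "integrable M (\<lambda>\<omega>. (\<Sum>i\<in>I. b i * X i \<omega>) ^ k)"
    and "expectation (\<lambda>\<omega>. (\<Sum>i\<in>I. b i * X i \<omega>)\<^sup>2) = var * (\<Sum>i\<in>I. (b i)\<^sup>2)"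
proof -
  have int: "integrable M (\<lambda>\<omega>. (\<Sum>i\<in>I. b i * X i \<omega>) ^ k)" if "finite I" for k and I :: "nat set"
    by (intro integrable_power_sum that) (use integrable_abs_power in \<open>auto simp: abs_mult power_mult_distrib\<close>)
  show "integrable M (\<lambda>\<omega>. (\<Sum>i\<in>I. b i * X i \<omega>) ^ k)" by (rule int[OF assms])
  show "expectation (\<lambda>\<omega>. (\<Sum>i\<in>I. b i * X i \<omega>)\<^sup>2) = var * (\<Sum>i\<in>I. (b i)\<^sup>2)"
    using assms
  proof (induction I)
    case empty
    then show ?case by simp
  next
    case (insert i I)
    define S where "S \<omega> = (\<Sum>j\<in>I. b j * X j \<omega>)" for \<omega>
    define T where "T \<omega> = b i * X i \<omega>" for \<omega>
    have iS: "integrable M S" "integrable M (\<lambda>\<omega>. (S \<omega>)\<^sup>2)"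
      using int[of I 1] int[of I 2] insert(1) by (simp_all add: S_def[abs_def])
    have iT: "integrable M T" "integrable M (\<lambda>\<omega>. (T \<omega>)\<^sup>2)"
      using int[of "{i}" 1] int[of "{i}" 2] by (simp_all add: T_def[abs_def])
    have ind: "indep_var borel T borel S"
    proof -
      have "indep_vars (\<lambda>_. borel) (\<lambda>j \<omega>. b j * X j \<omega>) (insert i I)"
        using indep_vars_compose2[OF indep_vars_subset[OF indep, of "insert i I"], of "\<lambda>j x. b j * x" "\<lambda>_. borel"] by simp
      from indep_vars_sum[OF insert(1,2) this] show ?thesis by (simp add: S_def[abs_def] T_def[abs_def])
    qed
    have iTS: "integrable M (\<lambda>\<omega>. T \<omega> * S \<omega>)" using indep_var_integrable[OF ind iT(1) iS(1)] .
    have "expectation T = 0" unfolding T_def[abs_def] using mean0[of i] by simp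
    hence eTS: "expectation (\<lambda>\<omega>. T \<omega> * S \<omega>) = 0"
      using indep_var_lebesgue_integral[OF ind iT(1) iS(1)] by simp
    have eT: "expectation (\<lambda>\<omega>. (T \<omega>)\<^sup>2) = var * (b i)\<^sup>2"
    proof -
      have "expectation (\<lambda>\<omega>. (T \<omega>)\<^sup>2) = (b i)\<^sup>2 * expectation (\<lambda>\<omega>. \<bar>X i \<omega>\<bar> ^ 2)"
        by (simp add: T_def power_mult_distrib)
      also have "\<dots> = var * (b i)\<^sup>2" unfolding expectation_abs_power[of i 2] by (simp add: var_def)
      finally show ?thesis .
    qed
    have "expectation (\<lambda>\<omega>. (\<Sum>j\<in>insert i I. b j * X j \<omega>)\<^sup>2) = expectation (\<lambda>\<omega>. (T \<omega>)\<^sup>2 + (S \<omega>)\<^sup>2 + 2 * (T \<omega> * S \<omega>))"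
      using insert(1,2) by (simp add: S_def T_def power2_sum mult.assoc)
    also have "\<dots> = expectation (\<lambda>\<omega>. (T \<omega>)\<^sup>2) + expectation (\<lambda>\<omega>. (S \<omega>)\<^sup>2) + 2 * expectation (\<lambda>\<omega>. T \<omega> * S \<omega>)"
      using iS iT iTS by simp
    also have "\<dots> = var * (b i)\<^sup>2 + var * (\<Sum>j\<in>I. (b j)\<^sup>2)" using eT eTS insert.IH by (simp add: S_def)
    finally show ?case using insert(1,2) by (simp add: distrib_left)
  qed
qed

lemma second_moment_complex:
  fixes b :: "nat \<Rightarrow> complex"
  assumes "finite I"
  shows "integrable M (\<lambda>\<omega>. (norm (random_sum b I \<omega>))\<^sup>2)"
    and "expectation (\<lambda>\<omega>. (norm (random_sum b I \<omega>))\<^sup>2) = var * (\<Sum>i\<in>I. (norm (b i))\<^sup>2)"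
proof -
  have e: "(norm (random_sum b I \<omega>))\<^sup>2 = (\<Sum>i\<in>I. Re (b i) * X i \<omega>)\<^sup>2 + (\<Sum>i\<in>I. Im (b i) * X i \<omega>)\<^sup>2" for \<omega>
    unfolding cmod_power2 by (simp add: mult.commute)
  show "integrable M (\<lambda>\<omega>. (norm (random_sum b I \<omega>))\<^sup>2)"
    unfolding e by (intro Bochner_Integration.integrable_add second_moment_real assms)
  show "expectation (\<lambda>\<omega>. (norm (random_sum b I \<omega>))\<^sup>2) = var * (\<Sum>i\<in>I. (norm (b i))\<^sup>2)"
    unfolding e using second_moment_real[OF assms]
    by (simp add: cmod_power2 sum.distrib distrib_left)
qed

text \<open>Off the event, the elementary bound \<open>S^2 \<le> t / 2 + S^4 / (2 t)\<close> replaces the Cauchy-Schwarz inequality.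
With \<open>s = \<Sum> |b\<^sub>i|^2\<close>, the fourth moment is at most \<open>C s^2\<close>, so taking \<open>t\<close> proportional to \<open>s\<close> makes the loss a
small multiple of \<open>s\<close>, uniformly in the coefficients.\<close>

lemma second_moment_on_large_event:
  "\<exists>\<delta>>0. \<forall>A\<in>events. prob A \<ge> 1 - \<delta> \<longrightarrow> (\<forall>I (b :: nat \<Rightarrow> complex). finite I \<longrightarrow>
     var / 2 * (\<Sum>i\<in>I. (norm (b i))\<^sup>2) \<le> expectation (\<lambda>\<omega>. indicator A \<omega> * (norm (random_sum b I \<omega>))\<^sup>2))"
proof -
  obtain C where C: "C \<ge> 0" and kh: "\<And>I (b :: nat \<Rightarrow> complex). finite I \<Longrightarrow>
     integrable M (\<lambda>\<omega>. norm (random_sum b I \<omega>) ^ (2 * 2)) \<and>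
     expectation (\<lambda>\<omega>. norm (random_sum b I \<omega>) ^ (2 * 2)) \<le> C * (\<Sum>i\<in>I. (norm (b i))\<^sup>2) ^ 2"
    using khinchine[of 2] by blast
  \<comment> \<open>With \<open>t = \<tau> s\<close> and \<open>\<delta>\<close> as below, each of the two losses is at most a quarter of \<open>var * s\<close>.\<close>
  define \<tau> where "\<tau> = 2 * (C + 1) / var"
  have \<tau>: "\<tau> > 0" using C var_pos by (simp add: \<tau>_def)
  define \<delta> where "\<delta> = var / (2 * \<tau>)"
  have \<delta>: "\<delta> > 0" using \<tau> var_pos by (simp add: \<delta>_def)
  show ?thesis
  proof (intro exI[of _ \<delta>] conjI ballI impI allI \<delta>)
    fix A and I :: "nat set" and b :: "nat \<Rightarrow> complex"
    assume A [measurable]: "A \<in> events" and pA: "prob A \<ge> 1 - \<delta>" and I: "finite I"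
    define S where "S \<omega> = norm (random_sum b I \<omega>)" for \<omega>
    define s where "s = (\<Sum>i\<in>I. (norm (b i))\<^sup>2)"
    have s0: "s \<ge> 0" by (simp add: s_def sum_nonneg)
    have [measurable]: "S \<in> borel_measurable M" unfolding S_def[abs_def] by measurable
    have i2: "integrable M (\<lambda>\<omega>. (S \<omega>)\<^sup>2)" and e2: "expectation (\<lambda>\<omega>. (S \<omega>)\<^sup>2) = var * s"
      using second_moment_complex[OF I, of b] by (simp_all add: S_def s_def)
    have i4: "integrable M (\<lambda>\<omega>. S \<omega> ^ 4)" and e4: "expectation (\<lambda>\<omega>. S \<omega> ^ 4) \<le> C * s\<^sup>2"
      using kh[OF I, of b] by (simp_all add: S_def s_def)
    have iA: "integrable M (\<lambda>\<omega>. indicator A \<omega> * (S \<omega>)\<^sup>2)"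
      by (rule Bochner_Integration.integrable_bound[OF i2]) (auto simp: indicator_def)
    have iAc: "integrable M (\<lambda>\<omega>. indicator (space M - A) \<omega> :: real)"
      by (intro integrable_real_indicator) (auto simp: emeasure_eq_measure)
    show "var / 2 * (\<Sum>i\<in>I. (norm (b i))\<^sup>2) \<le> expectation (\<lambda>\<omega>. indicator A \<omega> * (norm (random_sum b I \<omega>))\<^sup>2)"
    proof (cases "s = 0")
      case True
      have "expectation (\<lambda>\<omega>. indicator A \<omega> * (S \<omega>)\<^sup>2) \<ge> 0" by (intro integral_nonneg_AE) auto
      thus ?thesis using True by (simp add: s_def S_def)
    next
      case False
      define t where "t = \<tau> * s"
      have t: "t > 0" using False s0 \<tau> by (simp add: t_def)
      have pt: "(S \<omega>)\<^sup>2 - (t / 2 * indicator (space M - A) \<omega> + 1 / (2 * t) * S \<omega> ^ 4) \<le> indicator A \<omega> * (S \<omega>)\<^sup>2"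
        if "\<omega> \<in> space M" for \<omega>
      proof (cases "\<omega> \<in> A")
        case True
        thus ?thesis using t by (simp add: zero_le_even_power)
      next
        case False
        have "0 \<le> ((S \<omega>)\<^sup>2 - t)\<^sup>2 / (2 * t)" using t by simp
        also have "((S \<omega>)\<^sup>2 - t)\<^sup>2 / (2 * t) = 1 / (2 * t) * S \<omega> ^ 4 - (S \<omega>)\<^sup>2 + t / 2"
          using t by (simp add: power2_diff power_mult[symmetric] add_divide_distrib diff_divide_distrib power2_eq_square[of t])
        finally show ?thesis using False that by simp
      qed
      have "var * s - (t / 2 * \<delta> + 1 / (2 * t) * (C * s\<^sup>2))
          \<le> expectation (\<lambda>\<omega>. (S \<omega>)\<^sup>2) - (t / 2 * prob (space M - A) + 1 / (2 * t) * expectation (\<lambda>\<omega>. S \<omega> ^ 4))"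
      proof -
        have "prob (space M - A) \<le> \<delta>" using pA prob_compl[OF A] by simp
        hence "t / 2 * prob (space M - A) \<le> t / 2 * \<delta>" using t by (intro mult_left_mono) auto
        moreover have "1 / (2 * t) * expectation (\<lambda>\<omega>. S \<omega> ^ 4) \<le> 1 / (2 * t) * (C * s\<^sup>2)" using t e4 by (intro mult_left_mono) auto
        ultimately show ?thesis unfolding e2 by linarith
      qed
      also have "\<dots> = expectation (\<lambda>\<omega>. (S \<omega>)\<^sup>2 - (t / 2 * indicator (space M - A) \<omega> + 1 / (2 * t) * S \<omega> ^ 4))"
      proof -
        have "expectation (\<lambda>\<omega>. indicator (space M - A) \<omega>) = prob (space M - A)" by (simp add: Int_absorb2)
        thus ?thesis using i2 i4 iAc by (simp del: integral_indicator)
      qed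
      also have "\<dots> \<le> expectation (\<lambda>\<omega>. indicator A \<omega> * (S \<omega>)\<^sup>2)"
        by (rule integral_mono_AE) (use i2 i4 iAc iA pt in \<open>auto intro!: AE_I2\<close>)
      also have "var / 2 * s \<le> var * s - (t / 2 * \<delta> + 1 / (2 * t) * (C * s\<^sup>2))"
      proof -
        have "t / 2 * \<delta> = var / 4 * s" using \<tau> by (simp add: t_def \<delta>_def)
        moreover have "1 / (2 * t) * (C * s\<^sup>2) \<le> 1 / (2 * t) * ((C + 1) * s\<^sup>2)" using t by (intro mult_left_mono mult_right_mono) auto
        moreover have "1 / (2 * t) * ((C + 1) * s\<^sup>2) = var / 4 * s"
        proof -
          have "1 / (2 * (2 * x / y * z)) * (x * z\<^sup>2) = y / 4 * z" if "x \<noteq> 0" "y \<noteq> 0" "z \<noteq> 0" for x y z :: real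
            using that by (simp add: power2_eq_square field_simps)
          from this[of "C + 1" var s] show ?thesis using False C var_pos by (simp add: t_def \<tau>_def)
        qed
        ultimately show ?thesis by linarith
      qed
      finally (xtrans) show ?thesis by (simp add: s_def S_def)
    qed
  qed
qed

end

context radial_random_series begin

definition lp_energy :: "real \<Rightarrow> nat set \<Rightarrow> 'w \<Rightarrow> ennreal" where
  "lp_energy p I \<omega> = (\<integral>\<^sup>+x. ennreal (norm (\<Sum>n\<in>I. of_real (X n \<omega>) * c n * \<psi> n x) powr p) \<partial>lborel)"

lemma lp_energy_measurable:
  assumes "\<And>n. n \<in> I \<Longrightarrow> X n \<in> borel_measurable N"
  shows "lp_energy p I \<in> borel_measurable N"
proof -
  have "(\<lambda>(\<omega>, x). \<Sum>n\<in>I. of_real (X n \<omega>) * c n * \<psi> n x) \<in> borel_measurable (N \<Otimes>\<^sub>M lborel)"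
    unfolding case_prod_beta'
  proof (rule borel_measurable_sum)
    fix n assume "n \<in> I"
    note [measurable] = assms[OF this]
    show "(\<lambda>z. of_real (X n (fst z)) * c n * \<psi> n (snd z)) \<in> borel_measurable (N \<Otimes>\<^sub>M lborel)" by measurable
  qed
  hence "(\<lambda>(\<omega>, x). ennreal (norm (\<Sum>n\<in>I. of_real (X n \<omega>) * c n * \<psi> n x) powr p)) \<in> borel_measurable (N \<Otimes>\<^sub>M lborel)"
    by (simp add: case_prod_beta')
  thus ?thesis unfolding lp_energy_def[abs_def] by (rule lborel.borel_measurable_nn_integral)
qed

lemma lp_energy_union:
  assumes "p \<ge> 0" "finite I" "finite J" "I \<inter> J = {}"
  shows "lp_energy p (I \<union> J) \<omega> \<le> ennreal (2 powr p) * (lp_energy p I \<omega> + lp_energy p J \<omega>)"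
proof -
  have "lp_energy p (I \<union> J) \<omega> = (\<integral>\<^sup>+x. ennreal (norm ((\<Sum>n\<in>I. of_real (X n \<omega>) * c n * \<psi> n x) + (\<Sum>n\<in>J. of_real (X n \<omega>) * c n * \<psi> n x)) powr p) \<partial>lborel)"
    unfolding lp_energy_def using assms by (simp add: sum.union_disjoint)
  also have "\<dots> \<le> ennreal (2 powr p) * (lp_energy p I \<omega> + lp_energy p J \<omega>)"
    unfolding lp_energy_def by (rule nn_integral_add_powr_le[OF assms(1)]) measurable
  finally show ?thesis .
qed

lemma lp_energy_diff:
  assumes "p \<ge> 0" "finite I" "J \<subseteq> I"
  shows "lp_energy p (I - J) \<omega> \<le> ennreal (2 powr p) * (lp_energy p I \<omega> + lp_energy p J \<omega>)"
proof -
  have fJ: "finite J" using assms finite_subset by blast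
  have "lp_energy p (I - J) \<omega> = (\<integral>\<^sup>+x. ennreal (norm ((\<Sum>n\<in>I. of_real (X n \<omega>) * c n * \<psi> n x) + - (\<Sum>n\<in>J. of_real (X n \<omega>) * c n * \<psi> n x)) powr p) \<partial>lborel)"
    unfolding lp_energy_def using assms by (simp add: sum_diff)
  also have "\<dots> \<le> ennreal (2 powr p) * ((\<integral>\<^sup>+x. ennreal (norm (\<Sum>n\<in>I. of_real (X n \<omega>) * c n * \<psi> n x) powr p) \<partial>lborel) +
      (\<integral>\<^sup>+x. ennreal (norm (- (\<Sum>n\<in>J. of_real (X n \<omega>) * c n * \<psi> n x)) powr p) \<partial>lborel))"
    by (rule nn_integral_add_powr_le[OF assms(1)]) measurable
  finally show ?thesis unfolding lp_energy_def by simp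
qed

lemma lp_energy_finite: "p \<ge> 2 \<Longrightarrow> lp_energy p {..N} \<omega> < \<infinity>"
  unfolding lp_energy_def using in_Lp_nn_integral[OF u_in_Lp[of p \<omega> N]] by (simp add: u_def)

text \<open>Removing the first \<open>n\<close> terms changes every partial sum by one of finitely many elements of \<open>L\<^sup>p\<close>.\<close>

lemma bounded_iff_tail_bounded:
  assumes p: "p \<ge> 2"
  shows "(SUP N. lp_energy p {..N} \<omega>) < \<infinity> \<longleftrightarrow> (SUP N. lp_energy p ({..N} - {..<n}) \<omega>) < \<infinity>"
proof -
  have p0: "p \<ge> 0" using p by simp
  define H where "H = lp_energy p {} \<omega> + (\<Sum>m<n. lp_energy p {..m} \<omega>)"
  have Hf: "H < \<infinity>"
    using lp_energy_finite[OF p] by (auto simp: H_def lp_energy_def less_top)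
  have H: "lp_energy p ({..N} \<inter> {..<n}) \<omega> \<le> H" for N
  proof (cases n)
    case 0
    thus ?thesis by (simp add: H_def)
  next
    case (Suc k)
    have "{..N} \<inter> {..<n} = {..min N k}" using Suc by auto
    moreover have "lp_energy p {..min N k} \<omega> \<le> (\<Sum>m<n. lp_energy p {..m} \<omega>)"
      by (rule member_le_sum) (use Suc in auto)
    ultimately show ?thesis by (simp add: H_def add_increasing)
  qed
  have fin: "ennreal (2 powr p) * (B + H) < \<infinity>" if "B < \<infinity>" for B
    using that Hf by (auto simp: ennreal_mult_less_top less_top)
  show ?thesis
  proof
    assume B: "(SUP N. lp_energy p {..N} \<omega>) < \<infinity>"
    have "lp_energy p ({..N} - {..<n}) \<omega> \<le> ennreal (2 powr p) * ((SUP N. lp_energy p {..N} \<omega>) + H)" for N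
    proof -
      have "lp_energy p ({..N} - ({..N} \<inter> {..<n})) \<omega> \<le> ennreal (2 powr p) * (lp_energy p {..N} \<omega> + lp_energy p ({..N} \<inter> {..<n}) \<omega>)"
        by (rule lp_energy_diff[OF p0]) auto
      also have "\<dots> \<le> ennreal (2 powr p) * ((SUP N. lp_energy p {..N} \<omega>) + H)"
        by (intro mult_left_mono add_mono H SUP_upper) auto
      also have "{..N} - ({..N} \<inter> {..<n}) = {..N} - {..<n}" by auto
      finally show ?thesis .
    qed
    hence "(SUP N. lp_energy p ({..N} - {..<n}) \<omega>) \<le> ennreal (2 powr p) * ((SUP N. lp_energy p {..N} \<omega>) + H)"
      by (intro SUP_least)
    thus "(SUP N. lp_energy p ({..N} - {..<n}) \<omega>) < \<infinity>" using fin[OF B] by (rule le_less_trans)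
  next
    assume B: "(SUP N. lp_energy p ({..N} - {..<n}) \<omega>) < \<infinity>"
    have "lp_energy p {..N} \<omega> \<le> ennreal (2 powr p) * ((SUP N. lp_energy p ({..N} - {..<n}) \<omega>) + H)" for N
    proof -
      have "{..N} = ({..N} - {..<n}) \<union> ({..N} \<inter> {..<n})" by auto
      hence "lp_energy p {..N} \<omega> \<le> ennreal (2 powr p) * (lp_energy p ({..N} - {..<n}) \<omega> + lp_energy p ({..N} \<inter> {..<n}) \<omega>)"
        using lp_energy_union[OF p0, of "{..N} - {..<n}" "{..N} \<inter> {..<n}" \<omega>] by auto
      also have "\<dots> \<le> ennreal (2 powr p) * ((SUP N. lp_energy p ({..N} - {..<n}) \<omega>) + H)"
        by (intro mult_left_mono add_mono H SUP_upper) auto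
      finally show ?thesis .
    qed
    hence "(SUP N. lp_energy p {..N} \<omega>) \<le> ennreal (2 powr p) * ((SUP N. lp_energy p ({..N} - {..<n}) \<omega>) + H)"
      by (intro SUP_least)
    thus "(SUP N. lp_energy p {..N} \<omega>) < \<infinity>" using fin[OF B] by (rule le_less_trans)
  qed
qed

text \<open>Kolmogorov's zero-one law: for every \<open>n\<close> the event can be expressed through \<open>X\<^sub>n, X\<^sub>n\<^sub>+\<^sub>1, ...\<close> alone.\<close>

lemma bounded_zero_one:
  assumes p: "p \<ge> 2"
  defines "A \<equiv> {\<omega> \<in> space M. (SUP N. lp_energy p {..N} \<omega>) < \<infinity>}"
  shows "A \<in> events" and "prob A = 0 \<or> prob A = 1"
proof -
  let ?F = "\<lambda>i. sigma_sets (space M) {X i -` B \<inter> space M | B. B \<in> sets borel}"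
  have [measurable]: "lp_energy p {..N} \<in> borel_measurable M" for N by (rule lp_energy_measurable) measurable
  show "A \<in> events" unfolding A_def by measurable
  show "prob A = 0 \<or> prob A = 1"
  proof (rule kolmogorov_0_1_law[where A = ?F])
    show "sigma_algebra (space M) (?F i)" for i by (rule sigma_algebra_sigma_sets) auto
    show "indep_sets ?F UNIV" using indep by (simp add: indep_vars_def)
    show "A \<in> tail_events ?F"
      unfolding tail_events_def
    proof
      fix n :: nat
      \<comment> \<open>The sigma-algebra generated by the variables with index at least \<open>n\<close>.\<close>
      define T where "T = sigma (space M) (\<Union> (?F ` {n..}))"
      have sub: "\<Union> (?F ` {n..}) \<subseteq> Pow (space M)"
        using sigma_sets_into_sp[of "{X i -` B \<inter> space M | B. B \<in> sets borel}" "space M" for i] by auto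
      have setsT: "sets T = sigma_sets (space M) (\<Union> (?F ` {n..}))" and spT: "space T = space M"
        using sub by (simp_all add: T_def)
      have XT: "X i \<in> borel_measurable T" if "i \<ge> n" for i
      proof (rule measurableI)
        fix B :: "real set" assume "B \<in> sets borel"
        hence "X i -` B \<inter> space M \<in> ?F i" by (intro sigma_sets.Basic) auto
        hence "X i -` B \<inter> space M \<in> \<Union> (?F ` {n..})" using that by blast
        thus "X i -` B \<inter> space T \<in> sets T" unfolding setsT spT by (rule sigma_sets.Basic)
      qed auto
      have [measurable]: "lp_energy p ({..N} - {..<n}) \<in> borel_measurable T" for N
        by (rule lp_energy_measurable) (auto intro: XT)
      have "{\<omega> \<in> space T. (SUP N. lp_energy p ({..N} - {..<n}) \<omega>) < \<infinity>} \<in> sets T" by measurable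
      moreover have "{\<omega> \<in> space T. (SUP N. lp_energy p ({..N} - {..<n}) \<omega>) < \<infinity>} = A"
        unfolding A_def spT using bounded_iff_tail_bounded[OF p, of _ n] by auto
      ultimately show "A \<in> sigma_sets (space M) (\<Union> (?F ` {n..}))" by (simp add: setsT)
    qed
  qed
qed

text \<open>Choose a bound \<open>k\<close> that holds uniformly on an event of probability close to one. There the second
moment at \<open>x\<close> still dominates the square function, and by Jensen's inequality so does the moment of
order \<open>p\<close>. Integrating over the ball of radius \<open>1 / (2 sqrt N)\<close>, whose volume is of order \<open>N^(-d/2)\<close> and
on which every \<open>|\<psi>\<^sub>n|^2\<close> with \<open>n \<le> N\<close> is at least a constant times \<open>n^(a-1)\<close>, bounds the weighted sum
by \<open>(k N^a)^(2/p)\<close> up to a constant.\<close>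

lemma weighted_sum_growth_of_bounded:
  fixes p :: real
  assumes p: "p > 2" and full: "prob {\<omega> \<in> space M. (SUP N. lp_energy p {..N} \<omega>) < \<infinity>} = 1"
  shows "\<exists>B\<ge>0. \<forall>N::nat\<ge>1. weighted_sum a c N \<le> B * real N powr (2 * a / p)"
proof -
  have p0: "p > 0" using p by simp
  have [measurable]: "lp_energy p {..N} \<in> borel_measurable M" for N by (rule lp_energy_measurable) measurable
  define A where "A k = {\<omega> \<in> space M. (SUP N. lp_energy p {..N} \<omega>) \<le> of_nat k}" for k :: nat
  have Am [measurable]: "A k \<in> events" for k unfolding A_def by measurable
  have "(\<lambda>k. prob (A k)) \<longlonglongrightarrow> prob (\<Union>k. A k)"
  proof (rule finite_Lim_measure_incseq)
    show "range A \<subseteq> events" by auto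
    show "incseq A" by (auto simp: incseq_def A_def intro: order_trans)
  qed
  moreover have "(\<Union>k. A k) = {\<omega> \<in> space M. (SUP N. lp_energy p {..N} \<omega>) < \<infinity>}"
  proof -
    have "(\<exists>k::nat. y \<le> of_nat k) \<longleftrightarrow> y < \<infinity>" for y :: ennreal
    proof
      assume "\<exists>k::nat. y \<le> of_nat k"
      thus "y < \<infinity>" using of_nat_less_top le_less_trans by (metis infinity_ennreal_def)
    next
      assume "y < \<infinity>"
      then obtain r where r: "y = ennreal r" "r \<ge> 0" by (cases y) auto
      obtain k :: nat where "r \<le> real k" using real_arch_simple by blast
      hence "y \<le> of_nat k" using r by (simp add: ennreal_of_nat_eq_real_of_nat ennreal_leI)
      thus "\<exists>k::nat. y \<le> of_nat k" by blast
    qed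
    thus ?thesis unfolding A_def by auto
  qed
  ultimately have lim: "(\<lambda>k. prob (A k)) \<longlonglongrightarrow> 1" using full by simp
  obtain \<delta> where \<delta>: "\<delta> > 0" and big: "\<And>A I (b :: nat \<Rightarrow> complex). A \<in> events \<Longrightarrow> prob A \<ge> 1 - \<delta> \<Longrightarrow> finite I \<Longrightarrow>
     var / 2 * (\<Sum>i\<in>I. (norm (b i))\<^sup>2) \<le> expectation (\<lambda>\<omega>. indicator A \<omega> * (norm (random_sum b I \<omega>))\<^sup>2)"
    using second_moment_on_large_event by blast
  have "eventually (\<lambda>k. prob (A k) > 1 - \<delta>) sequentially" using lim \<delta> by (intro order_tendstoD) auto
  then obtain k where k: "prob (A k) \<ge> 1 - \<delta>" by (auto simp: eventually_sequentially intro: less_imp_le)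
  obtain C where C: "C > 0" and low: "\<And>n N x. n \<le> N \<Longrightarrow> N \<ge> 1 \<Longrightarrow> norm x \<le> 1 / (2 * sqrt (real N)) \<Longrightarrow> real n powr (a - 1) \<le> C * (norm (\<psi> n x))\<^sup>2"
    using psi_lower_near_0 by blast
  define s where "s N = weighted_sum a c N" for N :: nat
  have s0: "s N \<ge> 0" for N by (simp add: s_def sum_nonneg)
  have pointwise: "ennreal ((var / 2 * (s N / C)) powr (p / 2)) \<le> (\<integral>\<^sup>+\<omega>. ennreal (indicator (A k) \<omega> * norm (u \<omega> N x) powr p) \<partial>M)"
    if N: "N \<ge> 1" and x: "norm x \<le> 1 / (2 * sqrt (real N))" for N x
  proof (cases "(\<integral>\<^sup>+\<omega>. ennreal (indicator (A k) \<omega> * norm (u \<omega> N x) powr p) \<partial>M)")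
    case (real r)
    have um [measurable]: "(\<lambda>\<omega>. u \<omega> N x) \<in> borel_measurable M" unfolding u_def by measurable
    have eu: "u \<omega> N x = (\<Sum>n\<le>N. of_real (X n \<omega>) * (c n * \<psi> n x))" for \<omega> by (simp add: u_def mult.assoc)
    have "s N / C \<le> (\<Sum>n\<le>N. (norm (c n * \<psi> n x))\<^sup>2)"
    proof -
      have "s N \<le> (\<Sum>n\<le>N. C * (norm (\<psi> n x))\<^sup>2 * (norm (c n))\<^sup>2)"
        unfolding s_def by (intro sum_mono mult_right_mono low[OF _ N x]) auto
      also have "\<dots> = C * (\<Sum>n\<le>N. (norm (c n * \<psi> n x))\<^sup>2)"
        by (simp add: sum_distrib_left norm_mult power_mult_distrib mult_ac)
      finally show ?thesis using C by (simp add: field_simps)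
    qed
    hence "var / 2 * (s N / C) \<le> var / 2 * (\<Sum>n\<le>N. (norm (c n * \<psi> n x))\<^sup>2)" using var_pos by (intro mult_left_mono) auto
    also have "\<dots> \<le> expectation (\<lambda>\<omega>. indicator (A k) \<omega> * (norm (u \<omega> N x))\<^sup>2)"
      unfolding eu by (rule big[OF Am k]) simp
    finally have le1: "var / 2 * (s N / C) \<le> expectation (\<lambda>\<omega>. indicator (A k) \<omega> * (norm (u \<omega> N x))\<^sup>2)" .
    have i: "integrable M (\<lambda>\<omega>. indicator (A k) \<omega> * (norm (u \<omega> N x))\<^sup>2)"
      by (rule Bochner_Integration.integrable_bound[OF second_moment_complex(1)[of "{..N}" "\<lambda>n. c n * \<psi> n x"]])
         (auto simp: indicator_def eu)
    have "ennreal (expectation (\<lambda>\<omega>. indicator (A k) \<omega> * (norm (u \<omega> N x))\<^sup>2))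
       = (\<integral>\<^sup>+\<omega>. ennreal (indicator (A k) \<omega> * (norm (u \<omega> N x))\<^sup>2) \<partial>M)"
      by (rule nn_integral_eq_integral[OF i, symmetric]) auto
    also have "\<dots> = (\<integral>\<^sup>+\<omega>. ennreal ((indicator (A k) \<omega> * norm (u \<omega> N x) powr p) powr (2 / p)) \<partial>M)"
    proof (rule nn_integral_cong)
      fix \<omega>
      show "ennreal (indicator (A k) \<omega> * (norm (u \<omega> N x))\<^sup>2) = ennreal ((indicator (A k) \<omega> * norm (u \<omega> N x) powr p) powr (2 / p))"
        using p0 by (cases "\<omega> \<in> A k") (simp_all add: powr_powr)
    qed
    also have "\<dots> \<le> ennreal (r powr (2 / p))"
      by (rule nn_expectation_powr_le) (use p real in auto)
    finally have "expectation (\<lambda>\<omega>. indicator (A k) \<omega> * (norm (u \<omega> N x))\<^sup>2) \<le> r powr (2 / p)"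
      by (simp add: ennreal_le_iff)
    hence "var / 2 * (s N / C) \<le> r powr (2 / p)" using le1 by linarith
    hence "(var / 2 * (s N / C)) powr (p / 2) \<le> (r powr (2 / p)) powr (p / 2)"
      using var_pos s0[of N] C p by (intro powr_mono2) auto
    also have "\<dots> = r" using p real by (simp add: powr_powr)
    finally show ?thesis unfolding real(2) by (intro ennreal_leI)
  qed simp
  interpret P: pair_sigma_finite M lborel ..
  define v where "v = unit_ball_vol (real CARD('d))"
  have v: "v > 0" by (simp add: v_def)
  have main: "(var / 2 * (s N / C)) powr (p / 2) * (v * (1 / (2 * sqrt (real N))) ^ CARD('d)) \<le> real k" if N: "N \<ge> 1" for N
  proof -
    let ?R = "1 / (2 * sqrt (real N))"
    let ?b = "cball (0 :: real^'d) ?R"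
    let ?L = "(var / 2 * (s N / C)) powr (p / 2)"
    have vol: "emeasure lborel ?b = ennreal (v * ?R ^ CARD('d))"
      using emeasure_cball[of ?R "0 :: real^'d"] N by (simp add: v_def)
    have "ennreal (?L * (v * ?R ^ CARD('d))) = ennreal ?L * emeasure lborel ?b"
      unfolding vol using v by (intro ennreal_mult) auto
    also have "\<dots> = (\<integral>\<^sup>+x. ennreal ?L * indicator ?b x \<partial>lborel)"
      by (simp add: nn_integral_cmult_indicator)
    also have "\<dots> \<le> (\<integral>\<^sup>+x. \<integral>\<^sup>+\<omega>. ennreal (indicator (A k) \<omega> * norm (u \<omega> N x) powr p) \<partial>M \<partial>lborel)"
      by (intro nn_integral_mono) (use pointwise[OF N] in \<open>auto simp: indicator_def\<close>)
    also have "\<dots> = (\<integral>\<^sup>+\<omega>. \<integral>\<^sup>+x. ennreal (indicator (A k) \<omega> * norm (u \<omega> N x) powr p) \<partial>lborel \<partial>M)"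
      by (rule P.Fubini') measurable
    also have "\<dots> \<le> (\<integral>\<^sup>+\<omega>. of_nat k \<partial>M)"
    proof (rule nn_integral_mono)
      fix \<omega>
      show "(\<integral>\<^sup>+x. ennreal (indicator (A k) \<omega> * norm (u \<omega> N x) powr p) \<partial>lborel) \<le> of_nat k"
      proof (cases "\<omega> \<in> A k")
        case True
        have "(\<integral>\<^sup>+x. ennreal (indicator (A k) \<omega> * norm (u \<omega> N x) powr p) \<partial>lborel) = lp_energy p {..N} \<omega>"
          using True by (simp add: lp_energy_def u_def)
        also have "\<dots> \<le> (SUP N. lp_energy p {..N} \<omega>)" by (rule SUP_upper) simp
        also have "\<dots> \<le> of_nat k" using True by (simp add: A_def)
        finally show ?thesis .
      qed simp
    qed
    also have "\<dots> = ennreal (real k)" by (simp add: emeasure_space_1 ennreal_of_nat_eq_real_of_nat)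
    finally show ?thesis by (simp add: ennreal_le_iff)
  qed
  define Q where "Q = (real k * 2 ^ CARD('d) / v) powr (2 / p) * (2 * C / var)"
  show ?thesis
  proof (intro exI[of _ Q] conjI allI impI)
    show "Q \<ge> 0" using C var_pos by (simp add: Q_def)
    fix N :: nat assume N: "N \<ge> 1"
    have rt: "(1 / (2 * sqrt (real N))) ^ CARD('d) = 1 / (2 ^ CARD('d) * real N powr a)"
    proof -
      have "sqrt (real N) ^ CARD('d) = real N powr a"
        using N by (simp add: powr_realpow[symmetric] powr_half_sqrt[symmetric] powr_powr a_def)
      thus ?thesis by (simp add: power_divide power_mult_distrib)
    qed
    have Na: "real N powr a > 0" using N by simp
    let ?w = "var / 2 * (s N / C)"
    have w0: "?w \<ge> 0" using var_pos s0[of N] C by simp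
    have "?w powr (p / 2) * v \<le> real k * (2 ^ CARD('d) * real N powr a)"
      using main[OF N] Na unfolding rt by (simp add: divide_le_eq)
    hence "?w powr (p / 2) \<le> (real k * 2 ^ CARD('d) / v) * real N powr a"
      using v by (simp add: field_simps)
    hence "(?w powr (p / 2)) powr (2 / p) \<le> ((real k * 2 ^ CARD('d) / v) * real N powr a) powr (2 / p)"
      using p by (intro powr_mono2) auto
    also have "\<dots> = (real k * 2 ^ CARD('d) / v) powr (2 / p) * (real N powr a) powr (2 / p)"
      by (rule powr_mult)
    also have "(real N powr a) powr (2 / p) = real N powr (2 * a / p)" by (simp add: powr_powr mult.commute)
    also have "(?w powr (p / 2)) powr (2 / p) = ?w"
    proof -
      have "(y powr (p / 2)) powr (2 / p) = y" if "y \<ge> 0" for y :: real using that p by (simp add: powr_powr)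
      from this[OF w0] show ?thesis .
    qed
    finally have "?w \<le> (real k * 2 ^ CARD('d) / v) powr (2 / p) * real N powr (2 * a / p)" .
    hence "(2 * C / var) * ?w \<le> (2 * C / var) * ((real k * 2 ^ CARD('d) / v) powr (2 / p) * real N powr (2 * a / p))"
      using C var_pos by (intro mult_left_mono) auto
    moreover have "(2 * C / var) * ?w = s N" using C var_pos by simp
    ultimately show "weighted_sum a c N \<le> Q * real N powr (2 * a / p)"
      by (simp add: Q_def s_def mult_ac)
  qed
qed

text \<open>Otherwise \<open>d / p\<close> would be an admissible growth exponent, against \<open>p > d / \<alpha>\<^sub>\<star>\<close>. That \<open>p > 2\<close>, which the
second-moment argument uses, follows from \<open>\<alpha>\<^sub>\<star> < d / 2\<close>.\<close>

lemma almost_sure_divergence: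
  fixes p :: real
  assumes pc: "ereal p > critical_exponent CARD('d) c"
    and Hs: "\<And>\<epsilon>. \<epsilon> > 0 \<Longrightarrow> in_Hs_rad CARD('d) (- \<epsilon>) c"
  shows "AE \<omega> in M. \<not> (\<exists>f. Lp_tendsto p (u \<omega>) f)"
proof -
  let ?S = "growth_exponents CARD('d) c"
  let ?\<alpha> = "alpha_star CARD('d) c"
  have bdd: "bdd_below ?S" by (rule bdd_belowI[of _ 0]) auto
  have Sd: "real CARD('d) / 2 - 1 + 1/4 \<in> ?S" by (rule growth_exponent_of_Hs) (use Hs d in auto)
  have up: "?\<alpha> \<le> real CARD('d) / 2 - 1 + 1/4" unfolding alpha_star_def by (rule cInf_lower[OF Sd bdd])
  have Sne: "?S \<noteq> {}" using Sd by blast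
  have "0 \<le> ?\<alpha>" unfolding alpha_star_def by (rule cInf_greatest) (use Sne in auto)
  moreover have "?\<alpha> \<noteq> 0" using pc by (auto simp: critical_exponent_def)
  ultimately have pos: "?\<alpha> > 0" by simp
  have pc': "p > real CARD('d) / ?\<alpha>" using pc pos by (simp add: critical_exponent_def)
  have "2 \<le> real CARD('d) / ?\<alpha>" using up pos by (simp add: field_simps)
  hence p: "p > 2" using pc' by simp
  define A where "A = {\<omega> \<in> space M. (SUP N. lp_energy p {..N} \<omega>) < \<infinity>}"
  have Am: "A \<in> events" and A01: "prob A = 0 \<or> prob A = 1"
    using bounded_zero_one[of p] p by (auto simp: A_def)
  have "prob A \<noteq> 1"
  proof
    assume "prob A = 1"
    then obtain B where B: "B \<ge> 0" "\<And>N::nat. N \<ge> 1 \<Longrightarrow> weighted_sum a c N \<le> B * real N powr (2 * a / p)"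
      using weighted_sum_growth_of_bounded[OF p] unfolding A_def by blast
    have "weighted_sum a c \<in> O(\<lambda>N. real N powr (2 * a / p))"
    proof (rule landau_o.bigI[of "B + 1"])
      show "eventually (\<lambda>N. norm (weighted_sum a c N) \<le> (B + 1) * norm (real N powr (2 * a / p))) at_top"
        using eventually_ge_at_top[of 1]
      proof eventually_elim
        case (elim N)
        have "norm (weighted_sum a c N) \<le> B * real N powr (2 * a / p)"
          using B(2)[OF elim] by (simp add: sum_nonneg)
        also have "\<dots> \<le> (B + 1) * norm (real N powr (2 * a / p))" by (intro mult_mono) (use B in auto)
        finally show ?case .
      qed
    qed (use B in auto)
    hence "2 * a / p \<in> ?S" using p a_ge1 by (simp add: dim)
    hence "?\<alpha> \<le> 2 * a / p" unfolding alpha_star_def by (rule cInf_lower[OF _ bdd])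
    hence "p \<le> real CARD('d) / ?\<alpha>" using pos p by (simp add: dim field_simps)
    thus False using pc' by simp
  qed
  hence "prob A = 0" using A01 by blast
  hence "AE \<omega> in M. \<omega> \<notin> A" using Am by (simp add: AE_iff_null_sets[symmetric] null_sets_def emeasure_eq_measure)
  thus ?thesis
    using AE_space
  proof eventually_elim
    case (elim \<omega>)
    show ?case
    proof
      assume "\<exists>f. Lp_tendsto p (u \<omega>) f"
      then obtain f where "Lp_tendsto p (u \<omega>) f" by blast
      hence "(SUP N. \<integral>\<^sup>+x. ennreal (norm (u \<omega> N x) powr p) \<partial>lborel) < \<infinity>"
        using p by (intro Lp_tendsto_bounded) auto
      hence "\<omega> \<in> A" using elim by (simp add: A_def lp_energy_def u_def)
      thus False using elim by simp
    qed
  qed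
qed

end

theorem theorem2p3:
  fixes \<psi> :: "nat \<Rightarrow> real^'d \<Rightarrow> complex"
    and M :: "'w measure"
    and X :: "nat \<Rightarrow> 'w \<Rightarrow> real"
    and c :: "nat \<Rightarrow> complex"
  assumes "CARD('d) \<ge> 2"
    and "radial_eigenbasis \<psi>"
    and "prob_space M"
    and "prob_space.indep_vars M (\<lambda>_. borel) X UNIV"
    and "\<And>m n. distr M borel (X m) = distr M borel (X n)"
    and "\<not> (\<exists>a. AE \<omega> in M. X 1 \<omega> = a)"
    and "\<And>k::nat. k \<ge> 1 \<Longrightarrow> integrable M (\<lambda>\<omega>. \<bar>X 1 \<omega>\<bar> ^ k)"
    and "prob_space.expectation M (X 1) = 0"
    and "\<And>\<epsilon>. \<epsilon> > 0 \<Longrightarrow> in_Hs_rad CARD('d) (- \<epsilon>) c"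
  shows "(\<forall>p::real. 2 < p \<and> ereal p < critical_exponent CARD('d) c \<longrightarrow>
            (AE \<omega> in M. series_converges_Lp p (\<lambda>n x. of_real (X n \<omega>) * c n * \<psi> n x)))
       \<and> (\<forall>p::real. ereal p > critical_exponent CARD('d) c \<longrightarrow>
            (AE \<omega> in M. \<not> series_converges_Lp p (\<lambda>n x. of_real (X n \<omega>) * c n * \<psi> n x)))"
proof -
  interpret radial_random_series \<psi> M X c
    by (intro radial_random_series.intro radial_setup.intro centred_iid.intro centred_iid_axioms.intro)
       (fact assms)+
  have conv: "series_converges_Lp p (\<lambda>n x. of_real (X n \<omega>) * c n * \<psi> n x) \<longleftrightarrow> (\<exists>f. Lp_tendsto p (u \<omega>) f)" for p \<omega>
    by (simp add: series_converges_Lp_def u_def[abs_def])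
  show ?thesis
    unfolding conv using almost_sure_convergence almost_sure_divergence assms(9) by blast
qed

end
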